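(* Let $A=\{f_1,\cdots,f_s\}\subset H^2_{\mathbb C^n}$, let $F:=[f_1,\cdots,f_s]$ be the $n\times s$ matrix function with these columns, and let $\bar g_i\in\overline{H^2_{\mathbb C^s}}$ be the $i$-th column of $F^*$ ($i=1,\dots,n$). Set $\alpha:=\mathrm{ind}_{\mathcal N}\{\bar g_1,\cdots,\bar g_n\}$. Then $E^*_A=H^2_{\mathbb C^n}\ominus\Theta H^2_{\mathbb C^{n-\alpha}}$ for some $n\times(n-\alpha)$ matrix inner function $\Theta$.
   Context: $S$ is the shift $Sf=zf$ on $H^2_{\mathbb C^n}$ and $S^*$ its adjoint (backward shift). $E^*_A$ is the closed linear span of $\{S^{*k}f_i: k\ge0,\ 1\le i\le s\}$. $F^*(\zeta)=F(\zeta)^*$ pointwise. A matrix function $\Theta\in H^\infty_{M_{n\times k}}$ is inner if $\Theta^*\Theta=I$ a.e. on $\mathbb T$; by convention, for $k=0$, $\Theta H^2_{\mathbb C^0}=\{0\}$. The Nevanlinna class $\mathcal N$ is the set of functions on $\mathbb T$ of the form $f/g$ with $f,g\in H^\infty$, $g\neq0$; $\mathcal N_{\mathbb C^s}$ denotes vectors with entries in $\mathcal N$. Vectors $\varphi_1,\dots,\varphi_r\in L^2_{\mathbb C^s}$ are independent modulo Nevanlinna class if $a_i\in\mathcal N$ and $\sum a_i\varphi_i\in\mathcal N_{\mathbb C^s}$ imply all $a_i=0$; $\mathrm{ind}_{\mathcal N}$ of a finite list is the largest size of an independent sub-list ($0$ if none). *)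

theory Defs
  imports "HOL-Analysis.Analysis"
begin

text \<open>Functions on the unit circle T are represented as functions of the angle
  t in [0, 2 pi] (the point e^(i t)), with normalised-free Lebesgue measure.
  C^n-valued functions are represented by their components: a function
  g :: nat => real => complex with component g c for c < n (components c >= n are 0).\<close>

definition circ :: "real measure" where
  "circ = lebesgue_on {0..2*pi}"

definition fourier :: "(real \<Rightarrow> complex) \<Rightarrow> int \<Rightarrow> complex" where
  "fourier f k = (\<integral>t. f t * exp (- \<i> * of_int k * of_real t) \<partial>circ) / of_real (2*pi)"

definition L2 :: "(real \<Rightarrow> complex) set" where
  "L2 = {f. f \<in> borel_measurable circ \<and> integrable circ (\<lambda>t. (cmod (f t))\<^sup>2)}"

definition H2 :: "(real \<Rightarrow> complex) set" where
  "H2 = {f. f \<in> L2 \<and> (\<forall>k::int. k < 0 \<longrightarrow> fourier f k = 0)}"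

definition Hinf :: "(real \<Rightarrow> complex) set" where
  "Hinf = {f. f \<in> borel_measurable circ \<and> (\<exists>B. AE t in circ. cmod (f t) \<le> B)
              \<and> (\<forall>k::int. k < 0 \<longrightarrow> fourier f k = 0)}"

text \<open>Vector-valued H^2_{C^n}.\<close>
definition H2vec :: "nat \<Rightarrow> (nat \<Rightarrow> real \<Rightarrow> complex) set" where
  "H2vec n = {g. (\<forall>c<n. g c \<in> H2) \<and> (\<forall>c\<ge>n. g c = (\<lambda>_. 0))}"

definition vinner :: "nat \<Rightarrow> (nat \<Rightarrow> real \<Rightarrow> complex) \<Rightarrow> (nat \<Rightarrow> real \<Rightarrow> complex) \<Rightarrow> complex" where
  "vinner n g h = (\<integral>t. (\<Sum>c<n. g c t * cnj (h c t)) \<partial>circ)"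

definition vnorm :: "nat \<Rightarrow> (nat \<Rightarrow> real \<Rightarrow> complex) \<Rightarrow> real" where
  "vnorm n g = sqrt (\<integral>t. (\<Sum>c<n. (cmod (g c t))\<^sup>2) \<partial>circ)"

text \<open>Backward shift S^* f = (f - f(0)) / z, componentwise.\<close>
definition bshift :: "(nat \<Rightarrow> real \<Rightarrow> complex) \<Rightarrow> (nat \<Rightarrow> real \<Rightarrow> complex)" where
  "bshift g = (\<lambda>c t. exp (- \<i> * of_real t) * (g c t - fourier (g c) 0))"

text \<open>E^*_A: closed linear span (in H^2_{C^n}) of the S^{*k} f_i, k >= 0, i < s.\<close>
definition Estar :: "nat \<Rightarrow> nat \<Rightarrow> (nat \<Rightarrow> nat \<Rightarrow> real \<Rightarrow> complex) \<Rightarrow> (nat \<Rightarrow> real \<Rightarrow> complex) set" where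
  "Estar n s f = {g \<in> H2vec n. \<forall>\<epsilon>>0. \<exists>K::nat. \<exists>a :: nat \<Rightarrow> nat \<Rightarrow> complex.
      vnorm n (\<lambda>c t. g c t - (\<Sum>k\<le>K. \<Sum>i<s. a k i * (bshift ^^ k) (f i) c t)) < \<epsilon>}"

text \<open>Matrix inner function (n x k): entries in H^infinity, Theta^* Theta = I a.e.\<close>
definition inner_matrix :: "nat \<Rightarrow> nat \<Rightarrow> (nat \<Rightarrow> nat \<Rightarrow> real \<Rightarrow> complex) \<Rightarrow> bool" where
  "inner_matrix n k \<Theta> \<longleftrightarrow> (\<forall>i<n. \<forall>j<k. \<Theta> i j \<in> Hinf) \<and>
     (AE t in circ. \<forall>j<k. \<forall>l<k. (\<Sum>i<n. cnj (\<Theta> i j t) * \<Theta> i l t) = (if j = l then 1 else 0))"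

definition mat_apply :: "nat \<Rightarrow> nat \<Rightarrow> (nat \<Rightarrow> nat \<Rightarrow> real \<Rightarrow> complex) \<Rightarrow> (nat \<Rightarrow> real \<Rightarrow> complex)
    \<Rightarrow> (nat \<Rightarrow> real \<Rightarrow> complex)" where
  "mat_apply n k \<Theta> h = (\<lambda>c t. if c < n then (\<Sum>j<k. \<Theta> c j t * h j t) else 0)"

text \<open>H^2_{C^n} \<ominus> Theta H^2_{C^k}.\<close>
definition H2_ominus :: "nat \<Rightarrow> nat \<Rightarrow> (nat \<Rightarrow> nat \<Rightarrow> real \<Rightarrow> complex) \<Rightarrow> (nat \<Rightarrow> real \<Rightarrow> complex) set" where
  "H2_ominus n k \<Theta> = {g \<in> H2vec n. \<forall>h \<in> H2vec k. vinner n g (mat_apply n k \<Theta> h) = 0}"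

text \<open>Nevanlinna class: f/g with f, g in H^infinity, g nonzero (a.e. equality on T).\<close>
definition Nev :: "(real \<Rightarrow> complex) set" where
  "Nev = {\<phi>. \<exists>a b. a \<in> Hinf \<and> b \<in> Hinf \<and> \<not> (AE t in circ. b t = 0) \<and>
                (AE t in circ. \<phi> t = a t / b t)}"

text \<open>The family (phi j)_{j in J} of C^s-valued functions is independent modulo Nevanlinna class.\<close>
definition indep_Nev :: "nat \<Rightarrow> nat set \<Rightarrow> (nat \<Rightarrow> nat \<Rightarrow> real \<Rightarrow> complex) \<Rightarrow> bool" where
  "indep_Nev s J \<phi> \<longleftrightarrow> (\<forall>a :: nat \<Rightarrow> real \<Rightarrow> complex.
      (\<forall>j\<in>J. a j \<in> Nev) \<and> (\<forall>c<s. (\<lambda>t. \<Sum>j\<in>J. a j t * \<phi> j c t) \<in> Nev)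
      \<longrightarrow> (\<forall>j\<in>J. AE t in circ. a j t = 0))"

text \<open>ind_N of the list phi_0, ..., phi_(n-1): largest size of an independent sub-list.\<close>
definition ind_Nev :: "nat \<Rightarrow> nat \<Rightarrow> (nat \<Rightarrow> nat \<Rightarrow> real \<Rightarrow> complex) \<Rightarrow> nat" where
  "ind_Nev s n \<phi> = Max {card J | J. J \<subseteq> {..<n} \<and> indep_Nev s J \<phi>}"

end

theory Submission
  imports Defs
begin

text \<open>
  The complement \<open>M = H\<^sup>2 \<ominus> E\<^sup>*\<^sub>A\<close> consists of those \<open>h\<close> for which \<open>F\<^sup>*h\<close> has no Fourier
  coefficients of index \<open>\<le> 0\<close>. It is invariant under multiplication by \<open>z\<close>, so
  \<open>M = \<Theta> H\<^sup>2\<close> with \<open>\<Theta>\<close> inner with \<open>k\<close> columns: \<open>\<Theta>\<close> collects a maximal pointwise orthonormal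
  family of wandering vectors. The columns of \<open>\<Theta>\<close> form a basis over the Nevanlinna field of the space of
  \<open>a\<close> with \<open>F\<^sup>*a\<close> Nevanlinna: they lie in it because \<open>F\<^sup>*\<theta>\<^sub>j \<in> H\<^sup>2\<close> is Nevanlinna, and clearing
  denominators moves any such \<open>a\<close> into \<open>M\<close>. Hence the rank \<open>\<alpha>\<close> equals \<open>n - k\<close>.

  Both facts needed about the Nevanlinna class (a nonzero \<open>H\<^sup>2\<close> function is nonzero almost everywhere,
  and \<open>H\<^sup>2\<close> functions are quotients of bounded analytic ones) come from the same projection argument
  in \<open>L\<^sup>2\<close>, without factorisation theory.
\<close>

section \<open>Fourier uniqueness on the circle\<close>

text \<open>The projection argument: from g subtract better and better approximations in the span of
  zg, z^2 g, ... The limit \<phi> is orthogonal to z^j g for j > 0, hence to its own shifts, so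
  |\<phi>|^2 has no Fourier coefficient besides index 0 and is constant; it also vanishes wherever g
  does. Boundary uniqueness is the case g = f. For quotients, g = (1 + |f|^2)^(-1/2): then v = g cnj
  \<phi> and fv are bounded and analytic, and f = fv / v. The same passage from L^2 orthogonality of
  shifts to a pointwise identity makes wandering vectors pointwise orthonormal, which bounds their
  number by n. The rank step rests on a duality of index sets. \<alpha> is a maximum over sets J of
  columns of F^*, whereas \<Theta> describes relations between them. J is independent exactly when
  the rows of \<Theta> outside J have trivial kernel over the Nevanlinna field; elimination finds k
  such rows, and their complement is a largest J. Functions are not identified modulo null sets, so
  \<open>vnorm\<close> is a seminorm; closed subspaces appear as \<open>orth n W\<close>, closures
  as explicit limits.\<close>

lemma space_circ [simp]: "space circ = {0..2*pi}"
  by (simp add: circ_def)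

lemma finite_measure_circ: "finite_measure circ"
  unfolding circ_def by (rule finite_measure_lebesgue_on) simp

interpretation circ: finite_measure circ
  by (rule finite_measure_circ)

lemma measurable_circ_continuous:
  fixes f :: "real \<Rightarrow> 'a::euclidean_space"
  assumes "continuous_on UNIV f"
  shows "f \<in> borel_measurable circ"
  unfolding circ_def using assms
  by (intro continuous_imp_measurable_on_sets_lebesgue) (auto intro: continuous_on_subset)

lemma measurable_cis_mult [measurable]: "(\<lambda>t. cis (of_int k * t)) \<in> borel_measurable circ"
  by (intro measurable_circ_continuous continuous_intros)

lemma integrable_circ_cis_mult:
  "integrable circ f \<Longrightarrow> integrable circ (\<lambda>t. f t * cis (of_int k * t))"
  by (rule Bochner_Integration.integrable_bound[where f=f]) (auto simp: norm_mult)

lemma integral_circ_cis: "(\<integral>t. cis (of_int k * t) \<partial>circ) = (if k = 0 then of_real (2*pi) else 0)"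
proof -
  have cont: "continuous_on {0..2*pi} (\<lambda>t. cis (of_int k * t))"
    by (intro continuous_intros)
  have int: "integrable circ (\<lambda>t. cis (of_int k * t))"
    by (rule circ.integrable_const_bound[where B=1]) auto
  have eq: "(\<integral>t. cis (of_int k * t) \<partial>circ) = integral {0..2*pi} (\<lambda>t. cis (of_int k * t))"
    using int unfolding circ_def by (intro lebesgue_integral_eq_integral) auto
  show ?thesis
  proof (cases "k = 0")
    case True
    then show ?thesis unfolding eq by simp (simp add: scaleR_conv_of_real)
  next
    case False
    have "((\<lambda>t. cis (of_int k * t)) has_integral
        (cis (of_int k * (2*pi)) / (\<i> * of_int k) - cis (of_int k * 0) / (\<i> * of_int k))) {0..2*pi}"
    proof (rule fundamental_theorem_of_calculus)
      fix x assume "x \<in> {0..2*pi}"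
      show "((\<lambda>t. cis (of_int k * t) / (\<i> * of_int k)) has_vector_derivative cis (of_int k * x)) (at x within {0..2*pi})"
      proof -
        have "((\<lambda>z. exp (\<i> * of_int k * z) / (\<i> * of_int k)) has_field_derivative exp (\<i> * of_int k * of_real x)) (at (of_real x))"
          using False by (auto intro!: derivative_eq_intros)
        from has_vector_derivative_real_field[OF this] show ?thesis
          by (simp add: cis_conv_exp mult.assoc)
      qed
    qed simp
    moreover have "cis (of_int k * (2*pi)) = 1"
      by (metis cis_multiple_2pi mult.commute Ints_of_int)
    ultimately show ?thesis unfolding eq using False by (simp add: integral_unique)
  qed
qed

text \<open>Stone-Weierstrass will supply polynomials in Re z and Im z, so the induction follows
  that grammar. \<open>f\<close> is generalised: for a product, \<open>f\<close> times the first
  factor again has vanishing coefficients and serves as the new \<open>f\<close> for the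
  second.\<close>

lemma trig_polynomial_annihilates:
  fixes p :: "complex \<Rightarrow> real"
  assumes "real_polynomial_function p" "integrable circ f"
    and "\<And>k::int. (\<integral>t. f t * cis (of_int k * t) \<partial>circ) = 0"
  shows "integrable circ (\<lambda>t. f t * of_real (p (cis t))) \<and>
    (\<forall>k::int. (\<integral>t. f t * of_real (p (cis t)) * cis (of_int k * t) \<partial>circ) = 0)"
  using assms
proof (induction p arbitrary: f rule: real_polynomial_function.induct)
  case (linear h)
  interpret h: bounded_linear h by fact
  \<comment> \<open>Real linearity gives \<open>h (cis t) = h 1 * cos t + h \<i> * sin t\<close>.
    Written with z and 1/z, multiplication by it only moves Fourier indices by one.\<close>
  have h: "of_real (h (cis t)) = (of_real (h 1)/2 - \<i> * of_real (h \<i>)/2) * cis (of_int 1 * t)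
      + (of_real (h 1)/2 + \<i> * of_real (h \<i>)/2) * cis (of_int (-1) * t)" for t
  proof -
    have "h (cis t) = h (cos t *\<^sub>R 1 + sin t *\<^sub>R \<i>)"
      by (rule arg_cong[where f=h]) (simp add: complex_eq_iff)
    also have "\<dots> = cos t * h 1 + sin t * h \<i>"
      by (simp only: h.add h.scaleR real_scaleR_def)
    finally show ?thesis by (simp add: complex_eq_iff field_simps)
  qed
  define a where "a = of_real (h 1)/2 - \<i> * of_real (h \<i>)/2"
  define b where "b = of_real (h 1)/2 + \<i> * of_real (h \<i>)/2"
  have i: "integrable circ (\<lambda>t. f t * cis (of_int k * t))" for k
    by (rule integrable_circ_cis_mult) fact
  have 1: "(\<lambda>t. f t * of_real (h (cis t)) * cis (of_int k * t)) =
      (\<lambda>t. a * (f t * cis (of_int (k+1) * t)) + b * (f t * cis (of_int (k-1) * t)))" for k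
  proof
    fix t
    have "cis (of_int (k+1) * t) = cis (of_int 1 * t) * cis (of_int k * t)"
      "cis (of_int (k-1) * t) = cis (of_int (-1) * t) * cis (of_int k * t)"
      unfolding cis_mult by (simp_all add: algebra_simps)
    then show "f t * of_real (h (cis t)) * cis (of_int k * t) =
        a * (f t * cis (of_int (k+1) * t)) + b * (f t * cis (of_int (k-1) * t))"
      unfolding h a_def[symmetric] b_def[symmetric] by (simp only:) (simp only: ring_distribs ac_simps)
  qed
  have 2: "integrable circ (\<lambda>t. f t * of_real (h (cis t)) * cis (of_int k * t))" for k
    unfolding 1 using i by (intro Bochner_Integration.integrable_add integrable_mult_right) 
  have "(\<integral>t. f t * of_real (h (cis t)) * cis (of_int k * t) \<partial>circ) = 0" for k
    unfolding 1 using i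
    by (subst Bochner_Integration.integral_add) (simp_all only: integrable_mult_right integral_mult_right_zero linear(3), simp_all)
  moreover have "integrable circ (\<lambda>t. f t * of_real (h (cis t)))"
    using 2[of 0] by simp
  ultimately show ?case by blast
next
  case (const c)
  have "(\<lambda>t. f t * of_real c * cis (of_int k * t)) = (\<lambda>t. of_real c * (f t * cis (of_int k * t)))" for k
    by (simp add: ac_simps)
  with const show ?case by simp
next
  case (add p q)
  then show ?case
    using integrable_circ_cis_mult add.IH[OF add.prems] by (simp add: ring_distribs)
next
  case (mult p q)
  from mult.IH(1)[OF mult.prems] have "integrable circ (\<lambda>t. f t * of_real (p (cis t)))"
    "\<And>k::int. (\<integral>t. f t * of_real (p (cis t)) * cis (of_int k * t) \<partial>circ) = 0" by auto
  from mult.IH(2)[OF this] show ?case by (simp add: mult.assoc)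
qed

text \<open>Equal endpoint values let \<open>g\<close> descend to a continuous function on the
  circle, which is a uniform limit of polynomials, each of them annihilated by
  \<open>f\<close>.\<close>

lemma continuous_circle_annihilates:
  fixes g :: "real \<Rightarrow> real"
  assumes f: "integrable circ f"
    and f0: "\<And>k::int. (\<integral>t. f t * cis (of_int k * t) \<partial>circ) = 0"
    and g: "continuous_on UNIV g" "g 0 = 0" "g (2*pi) = 0"
  shows "(\<integral>t. f t * of_real (g t) \<partial>circ) = 0"
proof -
  define \<gamma> where "\<gamma> = (\<lambda>x. g (2*pi*x))"
  have "path \<gamma>" unfolding path_def \<gamma>_def
    by (intro continuous_on_compose2[OF g(1)] continuous_intros) auto
  \<comment> \<open>Continuity of the descended function at z = 1, where \<open>Arg2pi\<close>
    jumps, is read off from the trivial homotopy of the loop \<open>\<gamma>\<close> to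
    itself.\<close>
  then have "homotopic_loops UNIV \<gamma> \<gamma>"
    using g by (simp add: homotopic_loops_refl pathstart_def pathfinish_def \<gamma>_def)
  then have "homotopic_with_canon (\<lambda>h. True) (sphere 0 1) UNIV
      (\<gamma> \<circ> (\<lambda>z. Arg2pi z / (2*pi))) (\<gamma> \<circ> (\<lambda>z. Arg2pi z / (2*pi)))"
    by (rule homotopic_loops_imp_homotopic_circlemaps)
  then have cont: "continuous_on (sphere 0 1) (\<gamma> \<circ> (\<lambda>z. Arg2pi z / (2*pi)))"
    using homotopic_with_imp_continuous by blast
  have G: "(\<gamma> \<circ> (\<lambda>z. Arg2pi z / (2*pi))) (cis t) = g t" if "t \<in> {0..2*pi}" for t
  proof (cases "t = 2*pi")
    case True
    then show ?thesis using g Arg2pi_of_real[of 1] by (simp add: \<gamma>_def cis_2pi)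
  next
    case False
    then have "Arg2pi (cis t) = t"
      using that by (intro Arg2pi_unique[where r=1]) (auto simp: cis_conv_exp)
    then show ?thesis by (simp add: \<gamma>_def)
  qed
  have gm[measurable]: "g \<in> borel_measurable circ"
    using g(1) by (rule measurable_circ_continuous)
  have fm[measurable]: "f \<in> borel_measurable circ" using f by auto
  have bound: "norm (\<integral>t. f t * of_real (g t) \<partial>circ) \<le> e * (\<integral>t. norm (f t) \<partial>circ)" if "e > 0" for e
  proof -
    obtain p where p: "real_polynomial_function p"
        "\<And>x. x \<in> sphere 0 1 \<Longrightarrow> \<bar>(\<gamma> \<circ> (\<lambda>z. Arg2pi z / (2*pi))) x - p x\<bar> < e"
      using Stone_Weierstrass_real_polynomial_function[OF compact_sphere cont \<open>e > 0\<close>] by blast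
    from trig_polynomial_annihilates[OF p(1) f f0]
    have P: "integrable circ (\<lambda>t. f t * of_real (p (cis t)))"
      and P0: "(\<integral>t. f t * of_real (p (cis t)) \<partial>circ) = 0"
      by (auto dest: spec[of _ 0])
    have [measurable]: "(\<lambda>t. p (cis t)) \<in> borel_measurable circ"
      by (intro measurable_circ_continuous continuous_on_compose2[OF continuous_on_polymonial_function[of p UNIV]]
          continuous_intros) (use p(1) real_polynomial_function_eq in auto)
    have le: "norm (f t * of_real (g t - p (cis t))) \<le> e * norm (f t)" if "t \<in> {0..2*pi}" for t
    proof -
      have "\<bar>g t - p (cis t)\<bar> \<le> e" using p(2)[of "cis t"] G[OF that] by simp
      then have "norm (f t) * \<bar>g t - p (cis t)\<bar> \<le> norm (f t) * e" by (rule mult_left_mono) simp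
      then show ?thesis unfolding norm_mult norm_of_real by (simp only: mult.commute)
    qed
    have D: "integrable circ (\<lambda>t. f t * of_real (g t - p (cis t)))"
      by (rule Bochner_Integration.integrable_bound[where f="\<lambda>t. e * norm (f t)"])
        (use f le \<open>e > 0\<close> in \<open>auto intro!: AE_I2 simp: abs_mult simp del: of_real_diff\<close>)
    have "(\<integral>t. f t * of_real (g t) \<partial>circ) = (\<integral>t. f t * of_real (g t - p (cis t)) + f t * of_real (p (cis t)) \<partial>circ)"
      by (simp add: algebra_simps)
    also have "\<dots> = (\<integral>t. f t * of_real (g t - p (cis t)) \<partial>circ)"
      using D P P0 by simp
    also have "norm \<dots> \<le> (\<integral>t. e * norm (f t) \<partial>circ)"
      by (rule Bochner_Integration.integral_norm_bound_integral) (use D f le in auto)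
    finally show ?thesis by simp
  qed
  have "norm (\<integral>t. f t * of_real (g t) \<partial>circ) \<le> 0"
  proof (rule field_le_epsilon)
    fix e :: real assume "e > 0"
    define I where "I = (\<integral>t. norm (f t) \<partial>circ)"
    have "I \<ge> 0" unfolding I_def by (rule integral_nonneg_AE) auto
    with bound[of "e / (I + 1)", folded I_def] \<open>e > 0\<close>
    have "norm (\<integral>t. f t * of_real (g t) \<partial>circ) \<le> e / (I + 1) * I" by simp
    also have "\<dots> \<le> e" using \<open>I \<ge> 0\<close> \<open>e > 0\<close> by (simp add: field_simps)
    finally show "norm (\<integral>t. f t * of_real (g t) \<partial>circ) \<le> 0 + e" by simp
  qed
  then show ?thesis by simp
qed

lemma fourier_cis: "fourier f k = (\<integral>t. f t * cis (of_int (-k) * t) \<partial>circ) / of_real (2*pi)"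
  unfolding fourier_def by (simp add: cis_conv_exp mult.assoc)

text \<open>\<open>density_zero\<close> reduces the claim to integrals over measurable sets.
  Indicators are a.e. limits of bounded continuous functions vanishing at both endpoints, and |f|
  dominates.\<close>

proposition fourier_unique:
  assumes f: "integrable circ f" and f0: "\<And>k. fourier f k = 0"
  shows "AE t in circ. f t = 0"
proof (rule circ.density_zero[OF f])
  fix A assume A: "A \<in> sets circ"
  have f0': "(\<integral>t. f t * cis (of_int k * t) \<partial>circ) = 0" for k
    using f0[of "-k"] by (simp add: fourier_cis)
  have A': "A \<in> sets lebesgue" "A \<subseteq> {0..2*pi}"
    using A by (auto simp: circ_def sets_restrict_space)
  then have "(\<lambda>x. indicat_real A x) measurable_on UNIV"
    by (intro lebesgue_measurable_imp_measurable_on) auto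
  then obtain N g where N: "negligible N" "\<And>n. continuous_on UNIV (g n)"
    "\<And>x. x \<notin> N \<Longrightarrow> (\<lambda>n. g n x) \<longlonglongrightarrow> indicat_real A x"
    unfolding measurable_on_def by auto
  \<comment> \<open>Truncation to [0,1] keeps the limits 0 and 1 and permits domination; the last
    two factors are ramps that force the value 0 at the endpoints and tend to 1 in between.\<close>
  define h where "h = (\<lambda>n x. max 0 (min 1 (g n x)) * max 0 (min 1 (real n * x)) * max 0 (min 1 (real n * (2*pi - x))))"
  have hc: "continuous_on UNIV (h n)" for n
    unfolding h_def by (intro continuous_intros N)
  have h0: "(\<integral>t. f t * of_real (h n t) \<partial>circ) = 0" for n
    by (rule continuous_circle_annihilates[OF f f0' hc]) (auto simp: h_def)
  have hb: "\<bar>h n t\<bar> \<le> 1" for n t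
    unfolding h_def abs_mult by (intro mult_le_one) auto
  have one: "(\<lambda>n. max 0 (min 1 (real n * x))) \<longlonglongrightarrow> 1" if "x > 0" for x :: real
  proof (rule tendsto_eventually)
    show "\<forall>\<^sub>F n in sequentially. max 0 (min 1 (real n * x)) = 1"
      using eventually_ge_at_top[of "nat \<lceil>1/x\<rceil>"]
    proof eventually_elim
      case (elim n)
      then have "1/x \<le> real n" by linarith
      then have "1 \<le> real n * x" using that by (simp add: field_simps)
      then show ?case by auto
    qed
  qed
  have lim: "(\<lambda>n. h n x) \<longlonglongrightarrow> indicat_real A x" if "x \<notin> N" "x > 0" "x < 2*pi" for x
  proof -
    have "(\<lambda>n. h n x) \<longlonglongrightarrow> max 0 (min 1 (indicat_real A x)) * 1 * 1"
      unfolding h_def using that by (intro tendsto_intros N one) auto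
    then show ?thesis by (simp add: indicator_def split: if_splits)
  qed
  have "negligible (N \<union> {0, 2*pi})"
    using N(1) by (intro negligible_Un) auto
  then have "AE x in lebesgue. x \<notin> N \<union> {0, 2*pi}"
    by (intro AE_not_in) (simp add: negligible_iff_null_sets)
  then have "AE x in lebesgue. x \<in> {0..2*pi} \<longrightarrow> x \<notin> N \<and> x \<noteq> 0 \<and> x \<noteq> 2*pi"
    by eventually_elim auto
  then have AE: "AE x in circ. x \<notin> N \<and> x \<noteq> 0 \<and> x \<noteq> 2*pi"
    unfolding circ_def by (subst AE_restrict_space_iff) auto
  have fm[measurable]: "f \<in> borel_measurable circ" using f by auto
  have hm[measurable]: "h n \<in> borel_measurable circ" for n
    by (rule measurable_circ_continuous[OF hc])
  have "(\<lambda>n. \<integral>t. f t * of_real (h n t) \<partial>circ) \<longlonglongrightarrow> (\<integral>t. f t * of_real (indicat_real A t) \<partial>circ)"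
  proof (rule integral_dominated_convergence[where w="\<lambda>t. norm (f t)"])
    show "AE x in circ. (\<lambda>n. f x * of_real (h n x)) \<longlonglongrightarrow> f x * of_real (indicat_real A x)"
      using AE AE_space by eventually_elim (auto intro!: tendsto_intros lim)
    show "AE x in circ. norm (f x * of_real (h n x)) \<le> norm (f x)" for n
      using hb by (auto simp: norm_mult intro!: mult_left_le)
  qed (use f A in auto)
  then have "(\<integral>t. f t * of_real (indicat_real A t) \<partial>circ) = 0"
    unfolding h0 by (simp add: LIMSEQ_const_iff)
  then show "set_lebesgue_integral circ A f = 0"
    unfolding set_lebesgue_integral_def by (simp add: scaleR_conv_of_real mult.commute)
qed

section \<open>Square-integrable functions\<close>

text \<open>The monomial z^k at z = e^(it). A constant of its own, so that products and conjugates
  simplify by adding and negating exponents.\<close>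

definition ez :: "int \<Rightarrow> real \<Rightarrow> complex" where
  "ez k t = cis (of_int k * t)"

lemma ez_mult: "ez j t * ez k t = ez (j + k) t"
  by (simp add: ez_def cis_mult ring_distribs)

lemma cnj_ez [simp]: "cnj (ez k t) = ez (- k) t"
  by (simp add: ez_def cis_cnj)

lemma norm_ez [simp]: "cmod (ez k t) = 1"
  by (simp add: ez_def)

lemma ez_0 [simp]: "ez 0 t = 1"
  by (simp add: ez_def)

lemma ez_nz [simp]: "ez k t \<noteq> 0"
  by (simp add: ez_def)

lemma measurable_ez [measurable]: "ez k \<in> borel_measurable circ"
  unfolding ez_def[abs_def] by measurable

lemma integral_ez: "(\<integral>t. ez k t \<partial>circ) = (if k = 0 then of_real (2*pi) else 0)"
  unfolding ez_def by (rule integral_circ_cis)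

lemma fourier_ez: "fourier f k = (\<integral>t. f t * ez (-k) t \<partial>circ) / of_real (2*pi)"
  unfolding ez_def by (rule fourier_cis)

lemma fourier_eq_0_iff: "fourier f k = 0 \<longleftrightarrow> (\<integral>t. f t * ez (-k) t \<partial>circ) = 0"
  by (simp add: fourier_ez)

lemma borel_measurable_cnj [measurable]:
  "f \<in> borel_measurable M \<Longrightarrow> (\<lambda>x. cnj (f x)) \<in> borel_measurable M"
  by (rule borel_measurable_continuous_on[of cnj]) (intro continuous_intros)

lemma L2_measurable: "f \<in> L2 \<Longrightarrow> f \<in> borel_measurable circ"
  by (simp add: L2_def)

lemma L2_integrable_sq: "f \<in> L2 \<Longrightarrow> integrable circ (\<lambda>t. (cmod (f t))\<^sup>2)"
  by (simp add: L2_def)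

lemma L2_mult:
  assumes "f \<in> L2" "g \<in> L2"
  shows "integrable circ (\<lambda>t. f t * g t)"
proof (rule Bochner_Integration.integrable_bound)
  show "integrable circ (\<lambda>t. (cmod (f t))\<^sup>2 + (cmod (g t))\<^sup>2)"
    using assms by (simp add: L2_def)
  show "(\<lambda>t. f t * g t) \<in> borel_measurable circ"
    using assms[THEN L2_measurable] by measurable
  have "cmod (f t * g t) \<le> (cmod (f t))\<^sup>2 + (cmod (g t))\<^sup>2" for t
    using sum_squares_bound[of "cmod (f t)" "cmod (g t)"]
    by (auto simp: norm_mult intro: order_trans[rotated])
  then show "AE t in circ. cmod (f t * g t) \<le> norm ((cmod (f t))\<^sup>2 + (cmod (g t))\<^sup>2)"
    by simp
qed

lemma L2_add: 
  assumes "f \<in> L2" "g \<in> L2"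
  shows "(\<lambda>t. f t + g t) \<in> L2"
proof -
  have "integrable circ (\<lambda>t. (cmod (f t + g t))\<^sup>2)"
  proof (rule Bochner_Integration.integrable_bound)
    show "integrable circ (\<lambda>t. 2 * ((cmod (f t))\<^sup>2 + (cmod (g t))\<^sup>2))"
      using assms by (simp add: L2_def)
    show "(\<lambda>t. (cmod (f t + g t))\<^sup>2) \<in> borel_measurable circ"
      using assms[THEN L2_measurable] by measurable
    have "(cmod (f t + g t))\<^sup>2 \<le> 2 * ((cmod (f t))\<^sup>2 + (cmod (g t))\<^sup>2)" for t
    proof -
      have "(cmod (f t + g t))\<^sup>2 \<le> (cmod (f t) + cmod (g t))\<^sup>2"
        by (intro power_mono norm_triangle_ineq) auto
      also have "\<dots> \<le> 2 * ((cmod (f t))\<^sup>2 + (cmod (g t))\<^sup>2)"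
        using sum_squares_bound[of "cmod (f t)" "cmod (g t)"] by (simp add: power2_sum)
      finally show ?thesis .
    qed
    then show "AE t in circ. norm ((cmod (f t + g t))\<^sup>2) \<le> norm (2 * ((cmod (f t))\<^sup>2 + (cmod (g t))\<^sup>2))"
      by simp
  qed
  then show ?thesis using assms by (auto simp: L2_def)
qed

lemma L2_bounded_mult:
  assumes "m \<in> borel_measurable circ" "AE t in circ. cmod (m t) \<le> B" "f \<in> L2"
  shows "(\<lambda>t. m t * f t) \<in> L2"
proof -
  have "integrable circ (\<lambda>t. (cmod (m t * f t))\<^sup>2)"
  proof (rule Bochner_Integration.integrable_bound)
    show "integrable circ (\<lambda>t. B\<^sup>2 * (cmod (f t))\<^sup>2)"
      using assms by (simp add: L2_def)
    show "(\<lambda>t. (cmod (m t * f t))\<^sup>2) \<in> borel_measurable circ"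
      using assms(1) L2_measurable[OF assms(3)] by measurable
    show "AE t in circ. norm ((cmod (m t * f t))\<^sup>2) \<le> norm (B\<^sup>2 * (cmod (f t))\<^sup>2)"
      using assms(2) by eventually_elim
        (auto simp: norm_mult power_mult_distrib intro!: mult_right_mono power_mono)
  qed
  then show ?thesis using assms by (auto simp: L2_def)
qed

lemma L2_bounded:
  assumes "m \<in> borel_measurable circ" "AE t in circ. cmod (m t) \<le> B"
  shows "m \<in> L2"
proof -
  have "(\<lambda>_. 1) \<in> L2" by (simp add: L2_def)
  from L2_bounded_mult[OF assms this] show ?thesis by simp
qed

lemma L2_cmult: "f \<in> L2 \<Longrightarrow> (\<lambda>t. a * f t) \<in> L2"
  by (rule L2_bounded_mult[where B="cmod a"]) auto

lemma L2_diff: "f \<in> L2 \<Longrightarrow> g \<in> L2 \<Longrightarrow> (\<lambda>t. f t - g t) \<in> L2"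
  using L2_add[OF _ L2_cmult[of g "-1"]] by simp

lemma L2_const: "(\<lambda>_. a) \<in> L2"
  by (simp add: L2_def)

lemma L2_sum: "(\<And>i. i \<in> I \<Longrightarrow> f i \<in> L2) \<Longrightarrow> (\<lambda>t. \<Sum>i\<in>I. f i t) \<in> L2"
  by (induction I rule: infinite_finite_induct) (auto intro: L2_add L2_const)

lemma L2_cnj: "f \<in> L2 \<Longrightarrow> (\<lambda>t. cnj (f t)) \<in> L2"
  using borel_measurable_cnj[OF L2_measurable] by (simp add: L2_def)

lemma L2_ez_mult: "f \<in> L2 \<Longrightarrow> (\<lambda>t. ez k t * f t) \<in> L2"
  by (rule L2_bounded_mult[where B=1]) auto

lemma L2_ez: "ez k \<in> L2"
  by (rule L2_bounded[where B=1]) auto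

lemma L2_integrable: "f \<in> L2 \<Longrightarrow> integrable circ f"
  using L2_mult[OF _ L2_const[of 1]] by simp

lemma fourier_unique_L2: "f \<in> L2 \<Longrightarrow> (\<And>k. fourier f k = 0) \<Longrightarrow> AE t in circ. f t = 0"
  by (rule fourier_unique[OF L2_integrable])

text \<open>Riesz-Fischer for raw functions: a subsequence with geometrically small steps converges
  a.e., and Fatou makes the pointwise limit the L^2 limit of the whole sequence.\<close>

lemma L2_complete:
  assumes x: "\<And>m. x m \<in> L2"
    and cauchy: "\<And>e. e > 0 \<Longrightarrow> \<exists>M. \<forall>m\<ge>M. \<forall>l\<ge>M. (\<integral>t. (cmod (x m t - x l t))\<^sup>2 \<partial>circ) < e"
  shows "\<exists>f\<in>L2. (\<lambda>m. \<integral>t. (cmod (x m t - f t))\<^sup>2 \<partial>circ) \<longlonglongrightarrow> 0"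
proof -
  let ?D = "\<lambda>m l. \<integral>t. (cmod (x m t - x l t))\<^sup>2 \<partial>circ"
  have [measurable]: "x m \<in> borel_measurable circ" for m using x by (rule L2_measurable)
  have isq: "integrable circ (\<lambda>t. (cmod (x m t - x l t))\<^sup>2)" for m l
    by (intro L2_integrable_sq L2_diff x)
  have "\<exists>r. \<forall>k. (\<forall>m\<ge>r k. \<forall>l\<ge>r k. ?D m l < (1/4)^k) \<and> r k < r (Suc k)"
  proof (rule dependent_nat_choice)
    show "\<exists>M. \<forall>m\<ge>M. \<forall>l\<ge>M. ?D m l < (1/4)^0" using cauchy[of 1] by simp
    fix M k
    obtain M' where "\<forall>m\<ge>M'. \<forall>l\<ge>M'. ?D m l < (1/4)^(Suc k)"
      using cauchy[of "(1/4)^(Suc k)"] by auto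
    then show "\<exists>M'. (\<forall>m\<ge>M'. \<forall>l\<ge>M'. ?D m l < (1/4)^(Suc k)) \<and> M < M'"
      by (intro exI[of _ "max M' (Suc M)"]) auto
  qed
  then obtain r where r: "\<And>k m l. m \<ge> r k \<Longrightarrow> l \<ge> r k \<Longrightarrow> ?D m l < (1/4)^k" "\<And>k. r k < r (Suc k)"
    by blast
  then have "strict_mono r" by (simp add: strict_mono_Suc_iff)
  define d where "d = (\<lambda>k t. x (r (Suc k)) t - x (r k) t)"
  have [measurable]: "d k \<in> borel_measurable circ" for k unfolding d_def by measurable
  have dL2: "d k \<in> L2" for k unfolding d_def by (intro L2_diff x)
  \<comment> \<open>An L^1 bound from the squared L^2 bound 4^(-k): pointwise |d| \<le> 2^k |d|^2 /
    2 + 2^(-k) / 2, and integrating the constant over length 2 pi produces the term with pi.\<close>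
  have d: "(\<integral>t. cmod (d k t) \<partial>circ) \<le> (1/2)^k * (1/2 + pi)" for k
  proof -
    have "(\<integral>t. cmod (d k t) \<partial>circ) \<le> (\<integral>t. 2^k / 2 * (cmod (d k t))\<^sup>2 + (1/2)^k / 2 \<partial>circ)"
    proof (rule integral_mono)
      show "integrable circ (\<lambda>t. cmod (d k t))" using L2_integrable[OF dL2] by simp
      show "integrable circ (\<lambda>t. 2^k / 2 * (cmod (d k t))\<^sup>2 + (1/2)^k / 2)"
        using L2_integrable_sq[OF dL2] by simp
      fix t
      have "0 \<le> (2^k * cmod (d k t) - 1)\<^sup>2 / (2 * 2^k)" by simp
      also have "\<dots> = 2^k / 2 * (cmod (d k t))\<^sup>2 + (1/2)^k / 2 - cmod (d k t)"
        by (simp add: power2_diff field_simps power2_eq_square)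
      finally show "cmod (d k t) \<le> 2^k / 2 * (cmod (d k t))\<^sup>2 + (1/2)^k / 2" by simp
    qed
    also have "\<dots> = 2^k / 2 * (\<integral>t. (cmod (d k t))\<^sup>2 \<partial>circ) + (1/2)^k / 2 * (2*pi)"
      using L2_integrable_sq[OF dL2] by (simp add: circ_def measure_restrict_space)
    also have "\<dots> \<le> 2^k / 2 * (1/4)^k + (1/2)^k / 2 * (2*pi)"
      using r(1)[of k "r (Suc k)" "r k"] r(2)[of k] by (auto simp: d_def intro!: mult_left_mono)
    also have "\<dots> = (1/2)^k * (1/2 + pi)"
    proof -
      have "(2::real)^k * (1/4)^k = (1/2)^k" by (simp flip: power_mult_distrib)
      then show ?thesis by (simp add: ring_distribs)
    qed
    finally show ?thesis .
  qed
  have "AE t in circ. (\<Sum>k. ennreal (cmod (d k t))) \<noteq> \<infinity>"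
  proof (rule nn_integral_PInf_AE)
    have "(\<integral>\<^sup>+t. (\<Sum>k. ennreal (cmod (d k t))) \<partial>circ) = (\<Sum>k. \<integral>\<^sup>+t. ennreal (cmod (d k t)) \<partial>circ)"
      by (rule nn_integral_suminf) auto
    also have "\<dots> = (\<Sum>k. ennreal (\<integral>t. cmod (d k t) \<partial>circ))"
      using L2_integrable[OF dL2] by (intro suminf_cong nn_integral_eq_integral) auto
    also have "\<dots> \<noteq> \<infinity>"
      unfolding infinity_ennreal_def
    proof (rule ennreal_suminf_neq_top)
      show "summable (\<lambda>k. \<integral>t. cmod (d k t) \<partial>circ)"
      proof (rule summable_comparison_test')
        show "summable (\<lambda>k. (1/2)^k * (1/2 + pi))" by (intro summable_mult2 summable_geometric) simp
      qed (use d in auto)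
    qed auto
    finally show "(\<integral>\<^sup>+t. (\<Sum>k. ennreal (cmod (d k t))) \<partial>circ) \<noteq> \<infinity>" .
  qed auto
  define f where "f = (\<lambda>t. lim (\<lambda>k. x (r k) t))"
  have [measurable]: "f \<in> borel_measurable circ" unfolding f_def by measurable
  have lim: "AE t in circ. (\<lambda>k. x (r k) t) \<longlonglongrightarrow> f t"
    using \<open>AE t in circ. (\<Sum>k. ennreal (cmod (d k t))) \<noteq> \<infinity>\<close>
  proof eventually_elim
    case (elim t)
    then have "summable (\<lambda>k. cmod (d k t))" by (intro summable_suminf_not_top) auto
    then have "summable (\<lambda>k. d k t)" by (rule summable_norm_cancel)
    then have "convergent (\<lambda>m. \<Sum>k<m. d k t)" by (simp add: summable_iff_convergent)
    then have "convergent (\<lambda>m. (\<Sum>k<m. d k t) + x (r 0) t)" by (intro convergent_add convergent_const)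
    moreover have "(\<Sum>k<m. d k t) + x (r 0) t = x (r m) t" for m
      unfolding d_def by (subst sum_lessThan_telescope) simp
    ultimately show ?case by (simp add: f_def convergent_LIMSEQ_iff)
  qed
  \<comment> \<open>Fatou along the subsequence with \<open>m\<close> fixed; finiteness of the bound
    yields integrability as well.\<close>
  have bound: "integrable circ (\<lambda>t. (cmod (x m t - f t))\<^sup>2) \<and> (\<integral>t. (cmod (x m t - f t))\<^sup>2 \<partial>circ) \<le> (1/4)^k"
    if "m \<ge> r k" for m k
  proof -
    have "(\<integral>\<^sup>+t. ennreal ((cmod (x m t - f t))\<^sup>2) \<partial>circ)
        = (\<integral>\<^sup>+t. liminf (\<lambda>j. ennreal ((cmod (x m t - x (r j) t))\<^sup>2)) \<partial>circ)"
    proof (rule nn_integral_cong_AE)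
      show "AE t in circ. ennreal ((cmod (x m t - f t))\<^sup>2) = liminf (\<lambda>j. ennreal ((cmod (x m t - x (r j) t))\<^sup>2))"
        using lim
      proof eventually_elim
        case (elim t)
        have "(\<lambda>j. ennreal ((cmod (x m t - x (r j) t))\<^sup>2)) \<longlonglongrightarrow> ennreal ((cmod (x m t - f t))\<^sup>2)"
          by (intro tendsto_intros elim)
        then show ?case by (intro lim_imp_Liminf[symmetric]) auto
      qed
    qed
    also have "\<dots> \<le> liminf (\<lambda>j. \<integral>\<^sup>+t. ennreal ((cmod (x m t - x (r j) t))\<^sup>2) \<partial>circ)"
      by (rule nn_integral_liminf) auto
    also have "\<dots> = liminf (\<lambda>j. ennreal (?D m (r j)))"
      using isq by (intro arg_cong[where f=liminf] ext nn_integral_eq_integral) auto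
    also have "\<dots> \<le> limsup (\<lambda>j. ennreal (?D m (r j)))" by (rule Liminf_le_Limsup) auto
    also have "\<dots> \<le> ennreal ((1/4)^k)"
    proof (rule Limsup_bounded)
      show "\<forall>\<^sub>F j in sequentially. ennreal (?D m (r j)) \<le> ennreal ((1/4)^k)"
        using eventually_ge_at_top[of k]
      proof eventually_elim
        case (elim j)
        then have "r j \<ge> r k" using \<open>strict_mono r\<close> by (simp add: strict_mono_less_eq)
        from r(1)[OF that this] show ?case by (intro ennreal_leI) simp
      qed
    qed
    finally have *: "(\<integral>\<^sup>+t. ennreal ((cmod (x m t - f t))\<^sup>2) \<partial>circ) \<le> ennreal ((1/4)^k)" .
    then have "integrable circ (\<lambda>t. (cmod (x m t - f t))\<^sup>2)"
      by (intro integrableI_bounded) (auto simp: top_unique intro: le_less_trans)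
    then show ?thesis using * by (auto simp: nn_integral_eq_integral)
  qed
  have "(\<lambda>t. x (r 0) t - f t) \<in> L2" using bound[of 0 "r 0"] by (simp add: L2_def)
  from L2_diff[OF x[of "r 0"] this] have "f \<in> L2" by simp
  moreover have "(\<lambda>m. \<integral>t. (cmod (x m t - f t))\<^sup>2 \<partial>circ) \<longlonglongrightarrow> 0"
  proof (rule LIMSEQ_I)
    fix e :: real assume "e > 0"
    obtain k where k: "(1/4)^k < e" using real_arch_pow_inv[OF \<open>e > 0\<close>, of "1/4"] by auto
    show "\<exists>M. \<forall>m\<ge>M. norm ((\<integral>t. (cmod (x m t - f t))\<^sup>2 \<partial>circ) - 0) < e"
      using bound[of k] k by (intro exI[of _ "r k"]) (auto intro: le_less_trans)
  qed
  ultimately show ?thesis by blast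
qed

section \<open>Orthogonal projection of vector-valued functions\<close>

text \<open>Components of index \<ge> n are left free, so that vectors written by a formula qualify
  without padding; \<open>vinner\<close> and \<open>vnorm\<close> do not see them.\<close>

definition L2v :: "nat \<Rightarrow> (nat \<Rightarrow> real \<Rightarrow> complex) \<Rightarrow> bool" where
  "L2v n g \<longleftrightarrow> (\<forall>c<n. g c \<in> L2)"

lemma L2v_add: "L2v n g \<Longrightarrow> L2v n h \<Longrightarrow> L2v n (\<lambda>c t. g c t + h c t)"
  by (auto simp: L2v_def intro: L2_add)

lemma L2v_diff: "L2v n g \<Longrightarrow> L2v n h \<Longrightarrow> L2v n (\<lambda>c t. g c t - h c t)"
  by (auto simp: L2v_def intro: L2_diff)

lemma L2v_cmult: "L2v n g \<Longrightarrow> L2v n (\<lambda>c t. a * g c t)"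
  by (auto simp: L2v_def intro: L2_cmult)

lemma L2v_ez: "L2v n g \<Longrightarrow> L2v n (\<lambda>c t. ez k t * g c t)"
  by (auto simp: L2v_def intro: L2_ez_mult)

lemma L2v_sum: "(\<And>i. i \<in> I \<Longrightarrow> L2v n (g i)) \<Longrightarrow> L2v n (\<lambda>c t. \<Sum>i\<in>I. g i c t)"
  by (auto simp: L2v_def intro: L2_sum)

lemma vinner_eq_sum:
  assumes "L2v n g" "L2v n h"
  shows "vinner n g h = (\<Sum>c<n. \<integral>t. g c t * cnj (h c t) \<partial>circ)"
  unfolding vinner_def using assms
  by (intro Bochner_Integration.integral_sum L2_mult L2_cnj) (auto simp: L2v_def)

lemma vinner_integrable:
  assumes "L2v n g" "L2v n h"
  shows "integrable circ (\<lambda>t. \<Sum>c<n. g c t * cnj (h c t))"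
  using assms
  by (intro Bochner_Integration.integrable_sum L2_mult L2_cnj) (auto simp: L2v_def)

lemma vinner_add_left:
  assumes "L2v n g" "L2v n h" "L2v n k"
  shows "vinner n (\<lambda>c t. g c t + h c t) k = vinner n g k + vinner n h k"
  unfolding vinner_def
  by (subst Bochner_Integration.integral_add[symmetric])
     (use assms vinner_integrable in \<open>auto simp: ring_distribs sum.distrib\<close>)

lemma vinner_cmult_left: "vinner n (\<lambda>c t. a * g c t) k = a * vinner n g k"
  unfolding vinner_def by (simp add: mult.assoc flip: sum_distrib_left)

lemma vinner_diff_left:
  assumes "L2v n g" "L2v n h" "L2v n k"
  shows "vinner n (\<lambda>c t. g c t - h c t) k = vinner n g k - vinner n h k"
  using vinner_add_left[OF assms(1) L2v_cmult[OF assms(2), of "-1"] assms(3)]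
    vinner_cmult_left[of n "-1" h k] by simp

lemma vinner_commute: "vinner n h g = cnj (vinner n g h)"
  unfolding vinner_def by (simp add: mult.commute flip: Bochner_Integration.integral_cnj)

lemma vinner_sum_left:
  assumes "\<And>i. i \<in> I \<Longrightarrow> L2v n (g i)" "L2v n k"
  shows "vinner n (\<lambda>c t. \<Sum>i\<in>I. g i c t) k = (\<Sum>i\<in>I. vinner n (g i) k)"
  using assms
proof (induction I rule: infinite_finite_induct)
  case (insert i I)
  then show ?case
    using vinner_add_left[of n "g i" "\<lambda>c t. \<Sum>i\<in>I. g i c t" k]
    by (simp add: L2v_sum)
qed (simp_all add: vinner_def)

lemma vinner_ez_left: "vinner n (\<lambda>c t. ez k t * g c t) h = vinner n g (\<lambda>c t. ez (-k) t * h c t)"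
  unfolding vinner_def by (simp add: ac_simps)

lemma vinner_self:
  assumes "L2v n g"
  shows "vinner n g g = of_real ((vnorm n g)\<^sup>2)"
proof -
  have "(\<Sum>c<n. g c t * cnj (g c t)) = of_real (\<Sum>c<n. (cmod (g c t))\<^sup>2)" for t
    by (simp flip: complex_norm_square)
  then have "vinner n g g = of_real (\<integral>t. (\<Sum>c<n. (cmod (g c t))\<^sup>2) \<partial>circ)"
    unfolding vinner_def by (simp flip: of_real_sum of_real_power)
  moreover have "(\<integral>t. (\<Sum>c<n. (cmod (g c t))\<^sup>2) \<partial>circ) \<ge> 0"
    by (intro Bochner_Integration.integral_nonneg sum_nonneg) auto
  ultimately show ?thesis by (simp add: vnorm_def)
qed

section \<open>Norm inequalities and the projection\<close>

lemma vnorm_nonneg: "vnorm n g \<ge> 0"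
  unfolding vnorm_def by (intro real_sqrt_ge_zero Bochner_Integration.integral_nonneg sum_nonneg) auto

lemma vnorm_sq: "(vnorm n g)\<^sup>2 = (\<integral>t. (\<Sum>c<n. (cmod (g c t))\<^sup>2) \<partial>circ)"
proof -
  have "(\<integral>t. (\<Sum>c<n. (cmod (g c t))\<^sup>2) \<partial>circ) \<ge> 0"
    by (intro Bochner_Integration.integral_nonneg sum_nonneg) auto
  then show ?thesis by (simp add: vnorm_def)
qed

text \<open>The one expansion behind Cauchy-Schwarz, the triangle inequality, the parallelogram law
  and the variational step of the projection.\<close>

lemma vnorm_sq_diff_cmult:
  assumes g: "L2v n g" and h: "L2v n h"
  shows "(vnorm n (\<lambda>c t. g c t - a * h c t))\<^sup>2
    = (vnorm n g)\<^sup>2 - 2 * Re (cnj a * vinner n g h) + (cmod a)\<^sup>2 * (vnorm n h)\<^sup>2"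
proof -
  let ?ah = "\<lambda>c t. a * h c t"
  have ah: "L2v n ?ah" using h by (rule L2v_cmult)
  define d where "d = (\<lambda>c t. g c t - a * h c t)"
  have d: "L2v n d" using ah g unfolding d_def by (intro L2v_diff)
  have left: "vinner n d k = vinner n g k - a * vinner n h k" if "L2v n k" for k
    unfolding d_def vinner_diff_left[OF g ah that] vinner_cmult_left ..
  have "vinner n d d = cnj (vinner n d g) - a * cnj (vinner n d h)"
    unfolding left[OF d] by (subst (1 2) vinner_commute) simp
  also have "\<dots> = cnj (vinner n g g) - cnj (a * vinner n h g) - (a * cnj (vinner n g h) - a * cnj (a * vinner n h h))"
    unfolding left[OF g] left[OF h] by (simp add: algebra_simps)
  also have "\<dots> = of_real ((vnorm n g)\<^sup>2 - 2 * Re (cnj a * vinner n g h) + (cmod a)\<^sup>2 * (vnorm n h)\<^sup>2)"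
    unfolding vinner_self[OF g] vinner_self[OF h] vinner_commute[of n h g]
    by (simp add: complex_eq_iff cmod_power2) (simp add: algebra_simps power2_eq_square)
  finally show ?thesis unfolding vinner_self[OF d] of_real_eq_iff unfolding d_def .
qed

lemma Cauchy_Schwarz_vinner:
  assumes g: "L2v n g" and h: "L2v n h"
  shows "cmod (vinner n g h) \<le> vnorm n g * vnorm n h"
proof (cases "vnorm n h = 0")
  \<comment> \<open>An \<open>h\<close> of seminorm 0 cannot be divided by. Subtracting from g the
    multiples r c h with r large would push the squared norm below 0 unless c = 0.\<close>
  case True
  define c where "c = vinner n g h"
  have *: "2 * r * (cmod c)\<^sup>2 \<le> (vnorm n g)\<^sup>2" for r
  proof -
    have "0 \<le> (vnorm n (\<lambda>i t. g i t - (of_real r * c) * h i t))\<^sup>2" by simp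
    also have "\<dots> = (vnorm n g)\<^sup>2 - 2 * Re (cnj (of_real r * c) * c)"
      unfolding vnorm_sq_diff_cmult[OF g h] c_def True by simp
    also have "cnj (of_real r * c) * c = of_real (r * (cmod c)\<^sup>2)"
      by (simp only: of_real_mult complex_norm_square) simp
    finally show ?thesis by simp
  qed
  have "c = 0"
  proof (rule ccontr)
    assume "c \<noteq> 0"
    with *[of "((vnorm n g)\<^sup>2 + 1) / (2 * (cmod c)\<^sup>2)"] show False by simp
  qed
  then show ?thesis by (simp add: c_def True)
next
  case False
  then have pos: "(vnorm n h)\<^sup>2 > 0" by simp
  define c where "c = vinner n g h"
  define a where "a = c / of_real ((vnorm n h)\<^sup>2)"
  have "0 \<le> (vnorm n (\<lambda>i t. g i t - a * h i t))\<^sup>2" by simp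
  also have "\<dots> = (vnorm n g)\<^sup>2 - (cmod c)\<^sup>2 / (vnorm n h)\<^sup>2"
  proof -
    have "cnj a * c = of_real ((cmod c)\<^sup>2 / (vnorm n h)\<^sup>2)"
      by (simp only: of_real_divide complex_norm_square) (simp add: a_def)
    moreover have "(cmod a)\<^sup>2 * (vnorm n h)\<^sup>2 = (cmod c)\<^sup>2 / (vnorm n h)\<^sup>2"
      using False by (simp add: a_def norm_divide power_divide power2_eq_square norm_mult)
    ultimately show ?thesis
      unfolding vnorm_sq_diff_cmult[OF g h] c_def[symmetric] by simp
  qed
  finally have "(cmod c)\<^sup>2 \<le> (vnorm n g * vnorm n h)\<^sup>2"
    using pos by (simp add: field_simps power_mult_distrib)
  then show ?thesis unfolding c_def[symmetric]
    by (rule power2_le_imp_le) (simp add: vnorm_nonneg)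
qed

lemma vinner_tendsto:
  assumes "\<And>m. L2v n (x m)" "L2v n \<phi>" "L2v n w"
    and "(\<lambda>m. vnorm n (\<lambda>c t. x m c t - \<phi> c t)) \<longlonglongrightarrow> 0"
  shows "(\<lambda>m. vinner n (x m) w) \<longlonglongrightarrow> vinner n \<phi> w"
proof (rule LIM_zero_cancel, rule Lim_null_comparison)
  show "\<forall>\<^sub>F m in sequentially. norm (vinner n (x m) w - vinner n \<phi> w) \<le> vnorm n (\<lambda>c t. x m c t - \<phi> c t) * vnorm n w"
    using Cauchy_Schwarz_vinner[OF L2v_diff[OF assms(1,2)] assms(3)]
    by (simp add: vinner_diff_left[OF assms(1-3)])
  show "(\<lambda>m. vnorm n (\<lambda>c t. x m c t - \<phi> c t) * vnorm n w) \<longlonglongrightarrow> 0"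
    by (rule tendsto_mult_left_zero) fact
qed

lemma vnorm_sq_sum:
  assumes "L2v n g"
  shows "(vnorm n g)\<^sup>2 = (\<Sum>c<n. \<integral>t. (cmod (g c t))\<^sup>2 \<partial>circ)"
  unfolding vnorm_sq using assms
  by (intro Bochner_Integration.integral_sum L2_integrable_sq) (auto simp: L2v_def)

text \<open>Written with the midpoint because the minimising sequence is compared with midpoints,
  which are again of the form u - v.\<close>

lemma parallelogram_law:
  assumes g: "L2v n g" and h: "L2v n h"
  shows "(vnorm n (\<lambda>c t. g c t - h c t))\<^sup>2 + 4 * (vnorm n (\<lambda>c t. (1/2) * g c t + (1/2) * h c t))\<^sup>2
    = 2 * (vnorm n g)\<^sup>2 + 2 * (vnorm n h)\<^sup>2"
proof -
  have 1: "(vnorm n (\<lambda>c t. g c t - h c t))\<^sup>2 = (vnorm n g)\<^sup>2 - 2 * Re (vinner n g h) + (vnorm n h)\<^sup>2"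
    using vnorm_sq_diff_cmult[OF g h, of 1] by simp
  have "(vnorm n (\<lambda>c t. (1/2) * g c t - (-(1/2)) * h c t))\<^sup>2
      = (vnorm n (\<lambda>c t. (1/2) * g c t))\<^sup>2 + Re (vinner n (\<lambda>c t. (1/2) * g c t) h) + (vnorm n h)\<^sup>2 / 4"
    using vnorm_sq_diff_cmult[OF L2v_cmult[OF g, of "1/2"] h, of "-(1/2)"]
    by (simp add: norm_divide power_divide)
  moreover have "(vnorm n (\<lambda>c t. (1/2) * g c t))\<^sup>2 = (vnorm n g)\<^sup>2 / 4"
    unfolding vnorm_sq by (simp add: norm_mult norm_divide power_divide power_mult_distrib flip: sum_divide_distrib)
  moreover have "Re (vinner n (\<lambda>c t. (1/2) * g c t) h) = Re (vinner n g h) / 2"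
    unfolding vinner_cmult_left by simp
  ultimately show ?thesis using 1 by simp
qed

text \<open>\<open>V\<close> may fail to be closed, so the projection of \<open>u\<close> can lie
  outside it. What is returned is the residual \<open>\<phi>\<close> with \<open>v m\<close> in
  \<open>V\<close> such that u - v m tends to \<open>\<phi>\<close>; later uses carry properties of
  u - v m over to \<open>\<phi>\<close> along this limit.\<close>

theorem orthogonal_projection:
  assumes V: "\<And>v. v \<in> V \<Longrightarrow> L2v n v" "V \<noteq> {}"
    and lin: "\<And>v w a. v \<in> V \<Longrightarrow> w \<in> V \<Longrightarrow> (\<lambda>c t. v c t + a * w c t) \<in> V"
    and u: "L2v n u"
  obtains \<phi> v where "L2v n \<phi>" "\<And>m. v m \<in> V"
    "(\<lambda>m. vnorm n (\<lambda>c t. (u c t - v m c t) - \<phi> c t)) \<longlonglongrightarrow> 0"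
    "\<And>w. w \<in> V \<Longrightarrow> vinner n \<phi> w = 0"
proof -
  define N where "N = (\<lambda>v. (vnorm n (\<lambda>c t. u c t - v c t))\<^sup>2)"
  define D where "D = Inf (N ` V)"
  have bdd: "bdd_below (N ` V)" by (rule bdd_belowI[of _ 0]) (auto simp: N_def)
  have DN: "D \<le> N v" if "v \<in> V" for v
    unfolding D_def using that bdd by (intro cInf_lower) auto
  have "\<exists>v\<in>V. N v < D + 1 / real (Suc m)" for m
    using cInf_lessD[of "N ` V" "D + 1 / real (Suc m)"] V(2) by (auto simp: D_def)
  then obtain v where v: "\<And>m. v m \<in> V" "\<And>m. N (v m) < D + 1 / real (Suc m)" by metis
  define x where "x = (\<lambda>m c t. u c t - v m c t)"
  have x: "L2v n (x m)" for m unfolding x_def by (intro L2v_diff u V v)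
  have Nx: "(vnorm n (x m))\<^sup>2 < D + 1 / real (Suc m)" for m
    using v(2)[of m] by (simp add: N_def x_def)
  \<comment> \<open>The midpoint of \<open>x m\<close> and \<open>x l\<close> is u minus an element
    of \<open>V\<close>, so its squared norm is at least \<open>D\<close>; the parallelogram law
    leaves only the two excesses over \<open>D\<close>.\<close>
  have dist: "(vnorm n (\<lambda>c t. x m c t - x l c t))\<^sup>2 \<le> 2 / real (Suc m) + 2 / real (Suc l)" for m l
  proof -
    have "(\<lambda>c t. v m c t + (1/2) * (v l c t + (-1) * v m c t)) \<in> V" by (intro lin v)
    from DN[OF this] have "D \<le> (vnorm n (\<lambda>c t. (1/2) * x m c t + (1/2) * x l c t))\<^sup>2"
      unfolding N_def x_def by (rule back_subst[where P="\<lambda>w. D \<le> (vnorm n w)\<^sup>2"]) (intro ext, simp add: field_simps)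
    with parallelogram_law[OF x x, of m l] Nx[of m] Nx[of l] show ?thesis by simp
  qed
  have cauchy: "\<exists>M. \<forall>m\<ge>M. \<forall>l\<ge>M. (vnorm n (\<lambda>c t. x m c t - x l c t))\<^sup>2 < e" if e: "e > 0" for e
  proof -
    obtain M where M: "1 / real (Suc M) < e / 4" by (rule nat_approx_posE[of "e/4"]) (use e in auto)
    have "(vnorm n (\<lambda>c t. x m c t - x l c t))\<^sup>2 < e" if "m \<ge> M" "l \<ge> M" for m l
    proof -
      have "1 / real (Suc m) \<le> 1 / real (Suc M)" "1 / real (Suc l) \<le> 1 / real (Suc M)"
        using that by (auto simp: field_simps)
      with M dist[of m l] show ?thesis by simp
    qed
    then show ?thesis by blast
  qed
  have "\<exists>f\<in>L2. (\<lambda>m. \<integral>t. (cmod (x m c t - f t))\<^sup>2 \<partial>circ) \<longlonglongrightarrow> 0" if c: "c < n" for c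
  proof (rule L2_complete)
    show "x m c \<in> L2" for m using x c by (auto simp: L2v_def)
    fix e :: real assume "e > 0"
    have "(\<integral>t. (cmod (x m c t - x l c t))\<^sup>2 \<partial>circ) \<le> (vnorm n (\<lambda>c t. x m c t - x l c t))\<^sup>2" for m l
      unfolding vnorm_sq_sum[OF L2v_diff[OF x x]] using c
      by (intro member_le_sum[where f="\<lambda>c. \<integral>t. (cmod (x m c t - x l c t))\<^sup>2 \<partial>circ"]) auto
    note le = this
    from cauchy[OF \<open>e > 0\<close>] obtain M where "\<forall>m\<ge>M. \<forall>l\<ge>M. (vnorm n (\<lambda>c t. x m c t - x l c t))\<^sup>2 < e" ..
    then show "\<exists>M. \<forall>m\<ge>M. \<forall>l\<ge>M. (\<integral>t. (cmod (x m c t - x l c t))\<^sup>2 \<partial>circ) < e"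
      using le_less_trans[OF le] by blast
  qed
  then have "\<forall>c. \<exists>f. c < n \<longrightarrow> f \<in> L2 \<and> (\<lambda>m. \<integral>t. (cmod (x m c t - f t))\<^sup>2 \<partial>circ) \<longlonglongrightarrow> 0" by blast
  from choice[OF this] obtain \<phi> where \<phi>: "\<And>c. c < n \<Longrightarrow> \<phi> c \<in> L2"
      "\<And>c. c < n \<Longrightarrow> (\<lambda>m. \<integral>t. (cmod (x m c t - \<phi> c t))\<^sup>2 \<partial>circ) \<longlonglongrightarrow> 0" by blast
  have L: "L2v n \<phi>" using \<phi> by (simp add: L2v_def)
  have "(\<lambda>m. (vnorm n (\<lambda>c t. x m c t - \<phi> c t))\<^sup>2) \<longlonglongrightarrow> 0"
    unfolding vnorm_sq_sum[OF L2v_diff[OF x L]] using \<phi>(2) by (intro tendsto_null_sum) auto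
  from tendsto_real_sqrt[OF this]
  have lim: "(\<lambda>m. vnorm n (\<lambda>c t. x m c t - \<phi> c t)) \<longlonglongrightarrow> 0"
    by (simp add: vnorm_nonneg)
  have "vinner n \<phi> w = 0" if w: "w \<in> V" for w
  proof -
    define c where "c = vinner n \<phi> w"
    \<comment> \<open>Moving from \<open>v m\<close> along \<open>w\<close> cannot bring the squared
      distance below \<open>D\<close>, and \<open>x m\<close> exceeds \<open>D\<close> by less than
      1/(m+1); this error disappears in the limit.\<close>
    have key: "2 * Re (cnj a * c) \<le> (cmod a)\<^sup>2 * (vnorm n w)\<^sup>2" for a
    proof (rule LIMSEQ_le)
      show "(\<lambda>m. 2 * Re (cnj a * vinner n (x m) w)) \<longlonglongrightarrow> 2 * Re (cnj a * c)"
        unfolding c_def using vinner_tendsto[OF x L V(1)[OF w] lim] by (intro tendsto_intros)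
      show "(\<lambda>m. inverse (real (Suc m)) + (cmod a)\<^sup>2 * (vnorm n w)\<^sup>2) \<longlonglongrightarrow> (cmod a)\<^sup>2 * (vnorm n w)\<^sup>2"
        using tendsto_add[OF LIMSEQ_inverse_real_of_nat tendsto_const] by simp
      have "2 * Re (cnj a * vinner n (x m) w) \<le> inverse (real (Suc m)) + (cmod a)\<^sup>2 * (vnorm n w)\<^sup>2" for m
      proof -
        have "D \<le> N (\<lambda>c t. v m c t + a * w c t)" by (intro DN lin v w)
        also have "\<dots> = (vnorm n (\<lambda>c t. x m c t - a * w c t))\<^sup>2"
          by (simp add: N_def x_def algebra_simps)
        finally show ?thesis
          using Nx[of m] unfolding vnorm_sq_diff_cmult[OF x V(1)[OF w]] inverse_eq_divide by linarith
      qed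
      then show "\<exists>N. \<forall>m\<ge>N. 2 * Re (cnj a * vinner n (x m) w) \<le> inverse (real (Suc m)) + (cmod a)\<^sup>2 * (vnorm n w)\<^sup>2"
        by blast
    qed
    \<comment> \<open>With a = r c the left side of \<open>key\<close> is of first order in r and
      the right side of second order. The summand 1 gives r times the squared norm of w at most 1
      also when that norm is 0.\<close>
    define r where "r = 1 / ((vnorm n w)\<^sup>2 + 1)"
    have pos: "(vnorm n w)\<^sup>2 + 1 > 0" by (simp add: add_nonneg_pos)
    have "cnj (of_real r * c) * c = of_real (r * (cmod c)\<^sup>2)"
      by (simp only: of_real_mult complex_norm_square) simp
    then have "Re (cnj (of_real r * c) * c) = r * (cmod c)\<^sup>2" by (simp only: Re_complex_of_real)
    with key[of "of_real r * c"] have "2 * (r * (cmod c)\<^sup>2) \<le> (cmod (of_real r * c))\<^sup>2 * (vnorm n w)\<^sup>2"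
      by (simp only:)
    also have "\<dots> = r * (cmod c)\<^sup>2 * (r * (vnorm n w)\<^sup>2)"
      by (simp add: norm_mult power_mult_distrib power2_eq_square)
    also have "\<dots> \<le> r * (cmod c)\<^sup>2 * 1"
      using pos by (intro mult_left_mono) (auto simp: r_def)
    finally have "r * (cmod c)\<^sup>2 \<le> 0" by simp
    moreover have "r > 0" using pos by (simp add: r_def)
    ultimately have "(cmod c)\<^sup>2 \<le> 0" by (simp add: mult_le_0_iff)
    then show ?thesis by (simp add: c_def)
  qed
  with that[of \<phi> v, OF L v(1)] lim show ?thesis unfolding x_def by blast
qed

section \<open>Hardy spaces\<close>

lemma vnorm_triangle:
  assumes g: "L2v n g" and h: "L2v n h"
  shows "vnorm n (\<lambda>c t. g c t + h c t) \<le> vnorm n g + vnorm n h"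
proof (rule power2_le_imp_le)
  have "(vnorm n (\<lambda>c t. g c t + h c t))\<^sup>2 = (vnorm n g)\<^sup>2 + 2 * Re (vinner n g h) + (vnorm n h)\<^sup>2"
    using vnorm_sq_diff_cmult[OF g h, of "-1"] by simp
  also have "Re (vinner n g h) \<le> vnorm n g * vnorm n h"
    using complex_Re_le_cmod Cauchy_Schwarz_vinner[OF g h] by (rule order_trans)
  finally show "(vnorm n (\<lambda>c t. g c t + h c t))\<^sup>2 \<le> (vnorm n g + vnorm n h)\<^sup>2"
    by (simp add: power2_sum)
qed (simp add: vnorm_nonneg)

text \<open>The approximants are explicit double sums, the shape used by \<open>Estar\<close>; with
  s = 1 the lemma also serves polynomials and the shifts of a single function.\<close>

lemma span_projection:
  fixes w :: "nat \<Rightarrow> nat \<Rightarrow> nat \<Rightarrow> real \<Rightarrow> complex"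
  assumes w: "\<And>k i. i < s \<Longrightarrow> L2v n (w k i)" and u: "L2v n u"
  obtains \<phi> K a where "L2v n \<phi>"
    "(\<lambda>m. vnorm n (\<lambda>c t. (u c t - (\<Sum>k\<le>K m. \<Sum>i<s. a m k i * w k i c t)) - \<phi> c t)) \<longlonglongrightarrow> 0"
    "\<And>k i. i < s \<Longrightarrow> vinner n \<phi> (w k i) = 0"
proof -
  define L where "L = (\<lambda>K a c t. \<Sum>k\<le>(K::nat). \<Sum>i<s. a k i * w k i c t)"
  define V where "V = {v. \<exists>K a. v = L K a}"
  \<comment> \<open>Zero coefficients bring two combinations to a common length, which makes
    \<open>V\<close> closed under addition.\<close>
  have pad: "L K a = L M (\<lambda>k i. if k \<le> K then a k i else 0)" if "K \<le> M" for K M a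
    unfolding L_def using that by (intro ext sum.mono_neutral_cong_left) auto
  have memV: "L K a \<in> V" for K a unfolding V_def by blast
  have V: "L2v n v" if "v \<in> V" for v
    using that unfolding V_def L_def by (auto intro!: L2v_sum L2v_cmult w)
  have lin: "(\<lambda>c t. v c t + x * v' c t) \<in> V" if v: "v \<in> V" and v': "v' \<in> V" for v v' x
  proof -
    from v v' obtain K a K' a' where "v = L K a" "v' = L K' a'" unfolding V_def by blast
    then obtain b b' where b: "v = L (max K K') b" "v' = L (max K K') b'"
      using pad[of K "max K K'" a] pad[of K' "max K K'" a'] by auto
    have "(\<lambda>c t. v c t + x * v' c t) = L (max K K') (\<lambda>k i. b k i + x * b' k i)"
      unfolding b L_def by (simp add: sum.distrib ring_distribs sum_distrib_left mult.assoc)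
    then show ?thesis using memV by simp
  qed
  obtain \<phi> v where P: "L2v n \<phi>" "\<And>m. v m \<in> V"
    "(\<lambda>m. vnorm n (\<lambda>c t. (u c t - v m c t) - \<phi> c t)) \<longlonglongrightarrow> 0"
    "\<And>w. w \<in> V \<Longrightarrow> vinner n \<phi> w = 0"
    using orthogonal_projection[OF V _ lin u] memV by blast
  from P(2) obtain K a where Ka: "\<And>m. v m = L (K m) (a m)" unfolding V_def by simp metis
  have "vinner n \<phi> (w k i) = 0" if "i < s" for k i
  proof -
    have "w k i = L k (\<lambda>k' i'. if k' = k \<and> i' = i then 1 else 0)"
    proof (intro ext)
      fix c t
      have "(\<Sum>i'<s. (if k' = k \<and> i' = i then 1 else 0) * w k' i' c t) = (if k' = k then w k i c t else 0)" for k'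
      proof (cases "k' = k")
        case True
        have "(\<Sum>i'<s. (if k' = k \<and> i' = i then 1 else 0) * w k' i' c t) = (\<Sum>i'<s. if i' = i then w k i c t else 0)"
          using True by (intro sum.cong) auto
        then show ?thesis using True that by simp
      qed simp
      then have "L k (\<lambda>k' i'. if k' = k \<and> i' = i then 1 else 0) c t = (\<Sum>k'\<le>k. if k' = k then w k i c t else 0)"
        unfolding L_def by (simp only:)
      also have "\<dots> = w k i c t" by simp
      finally show "w k i c t = L k (\<lambda>k' i'. if k' = k \<and> i' = i then 1 else 0) c t" ..
    qed
    then show ?thesis using P(4)[OF memV] by metis
  qed
  with that[OF P(1)] P(3) show ?thesis unfolding Ka L_def by blast
qed

section \<open>Scalar functions as vectors with one component\<close>

lemma L2v_1 [simp]: "L2v (Suc 0) g \<longleftrightarrow> g 0 \<in> L2"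
  by (simp add: L2v_def)

lemma vinner_1: "vinner (Suc 0) g h = (\<integral>t. g 0 t * cnj (h 0 t) \<partial>circ)"
  by (simp add: vinner_def)

lemma fourier_vinner: "fourier f k = vinner (Suc 0) (\<lambda>_. f) (\<lambda>_. ez k) / of_real (2*pi)"
  by (simp add: vinner_1 fourier_ez)

lemma fourier_add: "integrable circ f \<Longrightarrow> integrable circ g \<Longrightarrow>
    fourier (\<lambda>t. f t + g t) k = fourier f k + fourier g k"
  unfolding fourier_ez ez_def ring_distribs
  by (subst Bochner_Integration.integral_add) (auto simp only: integrable_circ_cis_mult add_divide_distrib)

lemma fourier_cmult: "fourier (\<lambda>t. a * f t) k = a * fourier f k"
  unfolding fourier_ez by (simp add: mult.assoc)

lemma fourier_ez_mult: "fourier (\<lambda>t. ez j t * f t) k = fourier f (k - j)"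
proof -
  have "ez j t * f t * ez (-k) t = f t * ez (- (k - j)) t" for t
    using ez_mult[of j t "-k"] by (simp add: ac_simps)
  then show ?thesis unfolding fourier_ez by (simp only:)
qed

lemma fourier_const: "k \<noteq> 0 \<Longrightarrow> fourier (\<lambda>_. a) k = 0"
  by (simp add: fourier_ez integral_ez)

lemma H2_L2: "f \<in> H2 \<Longrightarrow> f \<in> L2"
  by (simp add: H2_def)

lemma H2_add: "f \<in> H2 \<Longrightarrow> g \<in> H2 \<Longrightarrow> (\<lambda>t. f t + g t) \<in> H2"
  by (auto simp: H2_def fourier_add L2_integrable intro: L2_add)

lemma H2_cmult: "f \<in> H2 \<Longrightarrow> (\<lambda>t. a * f t) \<in> H2"
  by (auto simp: H2_def fourier_cmult intro: L2_cmult)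

lemma H2_diff: "f \<in> H2 \<Longrightarrow> g \<in> H2 \<Longrightarrow> (\<lambda>t. f t - g t) \<in> H2"
  using H2_add[OF _ H2_cmult[of g "-1"]] by simp

lemma H2_const: "(\<lambda>_. a) \<in> H2"
  by (simp add: H2_def L2_const fourier_const)

lemma H2_sum: "(\<And>i. i \<in> I \<Longrightarrow> f i \<in> H2) \<Longrightarrow> (\<lambda>t. \<Sum>i\<in>I. f i t) \<in> H2"
  by (induction I rule: infinite_finite_induct) (auto intro: H2_add H2_const)

lemma H2_ez_mult: "f \<in> H2 \<Longrightarrow> j \<ge> 0 \<Longrightarrow> (\<lambda>t. ez j t * f t) \<in> H2"
  by (auto simp: H2_def fourier_ez_mult intro: L2_ez_mult)

text \<open>The residual of \<open>f\<close> off the polynomials is orthogonal to z^k for k \<ge> 0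
  by projection, and for k < 0 as a limit of H^2 functions; Fourier uniqueness makes it vanish
  a.e.\<close>

lemma polynomials_dense_H2:
  assumes f: "f \<in> H2"
  shows "\<exists>K a. (\<lambda>m. vnorm (Suc 0) (\<lambda>c t. f t - (\<Sum>k\<le>K m. a m k * ez (int k) t))) \<longlonglongrightarrow> 0"
proof -
  let ?w = "\<lambda>k (i::nat) (c::nat). ez (int k)"
  let ?u = "\<lambda>c::nat. f"
  have fL: "f \<in> L2" using f by (rule H2_L2)
  have w: "\<And>k::nat. L2v (Suc 0) (\<lambda>c::nat. ez (int k))" and u: "L2v (Suc 0) ?u"
    using fL L2_ez by auto
  obtain \<phi> K a where P: "L2v (Suc 0) \<phi>"
    "(\<lambda>m. vnorm (Suc 0) (\<lambda>c t. (?u c t - (\<Sum>k\<le>K m. \<Sum>i<Suc 0. a m k i * ?w k i c t)) - \<phi> c t)) \<longlonglongrightarrow> 0"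
    "\<And>k i. i < Suc 0 \<Longrightarrow> vinner (Suc 0) \<phi> (?w k i) = 0"
    by (rule span_projection[where w="?w" and s="Suc 0", OF w u]) (rule that)
  define x where "x = (\<lambda>m t. f t - (\<Sum>k\<le>K m. a m k 0 * ez (int k) t))"
  have lim: "(\<lambda>m. vnorm (Suc 0) (\<lambda>c t. x m t - \<phi> c t)) \<longlonglongrightarrow> 0"
    using P(2) unfolding x_def by simp
  have xH: "x m \<in> H2" for m
    unfolding x_def by (intro H2_diff f H2_sum H2_cmult H2_ez_mult[of "\<lambda>_. 1", simplified] H2_const) simp
  have "fourier (\<phi> 0) k = 0" for k
  proof (cases "k \<ge> 0")
    case True
    then show ?thesis using P(3)[of 0 "nat k"] unfolding fourier_vinner by (simp add: vinner_1)
  next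
    case False
    have "(\<lambda>m. vinner (Suc 0) (\<lambda>_. x m) (\<lambda>_. ez k)) \<longlonglongrightarrow> vinner (Suc 0) \<phi> (\<lambda>_. ez k)"
      by (rule vinner_tendsto) (use P(1) lim xH H2_L2 L2_ez in auto)
    moreover have "vinner (Suc 0) (\<lambda>_. x m) (\<lambda>_. ez k) = 0" for m
      using xH[of m] False by (simp add: H2_def fourier_vinner)
    ultimately have "vinner (Suc 0) \<phi> (\<lambda>_. ez k) = 0" by (simp add: LIMSEQ_const_iff)
    then show ?thesis unfolding fourier_vinner by (simp add: vinner_1)
  qed
  with P(1) have AE: "AE t in circ. \<phi> 0 t = 0" by (intro fourier_unique_L2) auto
  have "vnorm (Suc 0) (\<lambda>c t. x m t - \<phi> c t) = vnorm (Suc 0) (\<lambda>c. x m)" for m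
  proof -
    have [measurable]: "\<phi> 0 \<in> borel_measurable circ" "x m \<in> borel_measurable circ"
      using P(1) xH H2_L2 L2_measurable by auto
    show ?thesis unfolding vnorm_def
      by (intro arg_cong[where f=sqrt] integral_cong_AE) (use AE in auto)
  qed
  with lim show ?thesis unfolding x_def by auto
qed

text \<open>A bilinear pairing, without conjugation, extended from monomials to H^2 by density. It
  takes the place of multiplying Fourier series when a product of analytic functions is
  tested.\<close>

lemma H2_annihilator:
  assumes f: "f \<in> H2" and h: "h \<in> L2" and 0: "\<And>j::nat. (\<integral>t. ez (int j) t * h t \<partial>circ) = 0"
  shows "(\<integral>t. f t * h t \<partial>circ) = 0"
proof -
  obtain K a where lim: "(\<lambda>m. vnorm (Suc 0) (\<lambda>c t. f t - (\<Sum>k\<le>K m. a m k * ez (int k) t))) \<longlonglongrightarrow> 0"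
    using polynomials_dense_H2[OF f] by blast
  define p where "p = (\<lambda>m t. \<Sum>k\<le>K m. a m k * ez (int k) t)"
  have pL: "p m \<in> L2" for m unfolding p_def by (intro L2_sum L2_cmult L2_ez)
  have "(\<lambda>m. vinner (Suc 0) (\<lambda>_. p m) (\<lambda>_ t. cnj (h t))) \<longlonglongrightarrow> vinner (Suc 0) (\<lambda>_. f) (\<lambda>_ t. cnj (h t))"
  proof (rule vinner_tendsto)
    show "(\<lambda>m. vnorm (Suc 0) (\<lambda>c t. p m t - f t)) \<longlonglongrightarrow> 0"
      using lim unfolding vnorm_def p_def by (simp add: norm_minus_commute)
  qed (use pL f H2_L2 h L2_cnj in auto)
  moreover have "vinner (Suc 0) (\<lambda>_. p m) (\<lambda>_ t. cnj (h t)) = 0" for m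
  proof -
    have "(\<integral>t. p m t * h t \<partial>circ) = (\<integral>t. (\<Sum>k\<le>K m. a m k * (ez (int k) t * h t)) \<partial>circ)"
      unfolding p_def by (simp add: sum_distrib_right mult.assoc)
    also have "\<dots> = (\<Sum>k\<le>K m. \<integral>t. a m k * (ez (int k) t * h t) \<partial>circ)"
      by (intro Bochner_Integration.integral_sum L2_integrable L2_cmult L2_ez_mult h)
    also have "\<dots> = 0" using 0 by simp
    finally show ?thesis by (simp add: vinner_1)
  qed
  ultimately show ?thesis by (simp add: LIMSEQ_const_iff vinner_1)
qed

text \<open>The product is merely integrable, so the claim concerns coefficients and not membership
  in \<open>H2\<close>; membership follows where the product is separately known to be
  square-integrable.\<close>

lemma fourier_H2_mult:
  assumes f: "f \<in> H2" and g: "g \<in> H2" and "k < 0"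
  shows "fourier (\<lambda>t. f t * g t) k = 0"
proof -
  have "(\<integral>t. f t * (ez (-k) t * g t) \<partial>circ) = 0"
  proof (rule H2_annihilator[OF f L2_ez_mult[OF H2_L2[OF g]]])
    fix j :: nat
    have "fourier g (k - int j) = 0" using g \<open>k < 0\<close> by (simp add: H2_def)
    moreover have "ez (int j) t * (ez (-k) t * g t) = g t * ez (- (k - int j)) t" for t
      using ez_mult[of "int j" t "-k"] by (simp add: ac_simps)
    ultimately show "(\<integral>t. ez (int j) t * (ez (-k) t * g t) \<partial>circ) = 0"
      unfolding fourier_eq_0_iff by (simp only:)
  qed
  then show ?thesis unfolding fourier_eq_0_iff by (simp add: ac_simps)
qed

section \<open>Bounded analytic functions\<close>

lemma HinfD:
  assumes "f \<in> Hinf"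
  obtains B where "f \<in> borel_measurable circ" "AE t in circ. cmod (f t) \<le> B" "f \<in> H2"
proof -
  from assms obtain B where B: "f \<in> borel_measurable circ" "AE t in circ. cmod (f t) \<le> B"
    unfolding Hinf_def by blast
  moreover from this have "f \<in> L2" by (rule L2_bounded)
  ultimately show ?thesis using that assms by (auto simp: Hinf_def H2_def)
qed

lemma HinfI: "f \<in> H2 \<Longrightarrow> AE t in circ. cmod (f t) \<le> B \<Longrightarrow> f \<in> Hinf"
  by (auto simp: Hinf_def H2_def L2_def)

lemma Hinf_H2: "f \<in> Hinf \<Longrightarrow> f \<in> H2"
  by (erule HinfD)

lemma Hinf_H2_mult:
  assumes "f \<in> Hinf" "g \<in> H2"
  shows "(\<lambda>t. f t * g t) \<in> H2"
  using assms(1)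
proof (rule HinfD)
  fix B assume "f \<in> borel_measurable circ" "AE t in circ. cmod (f t) \<le> B" "f \<in> H2"
  then show ?thesis using assms(2)
    by (auto simp: H2_def intro: L2_bounded_mult fourier_H2_mult[unfolded H2_def])
qed

lemma Hinf_mult:
  assumes "f \<in> Hinf" "g \<in> Hinf"
  shows "(\<lambda>t. f t * g t) \<in> Hinf"
proof -
  from assms obtain B where B: "AE t in circ. cmod (f t) \<le> B" by (elim HinfD)
  from assms obtain C where C: "AE t in circ. cmod (g t) \<le> C" by (elim HinfD)
  from B C have "AE t in circ. cmod (f t * g t) \<le> B * C"
  proof eventually_elim
    case (elim t)
    then have "0 \<le> B" using norm_ge_zero order_trans by blast
    with elim show ?case by (auto simp: norm_mult intro: mult_mono)
  qed
  with assms show ?thesis by (intro HinfI[OF Hinf_H2_mult] Hinf_H2)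
qed

lemma Hinf_add:
  assumes "f \<in> Hinf" "g \<in> Hinf"
  shows "(\<lambda>t. f t + g t) \<in> Hinf"
proof -
  from assms obtain B where B: "AE t in circ. cmod (f t) \<le> B" by (elim HinfD)
  from assms obtain C where C: "AE t in circ. cmod (g t) \<le> C" by (elim HinfD)
  from B C have "AE t in circ. cmod (f t + g t) \<le> B + C"
    by eventually_elim (rule norm_triangle_mono)
  with assms show ?thesis by (intro HinfI[OF H2_add] Hinf_H2)
qed

lemma Hinf_const: "(\<lambda>_. a) \<in> Hinf"
  by (rule HinfI[OF H2_const, of _ "cmod a"]) simp

lemma Hinf_ez: "k \<ge> 0 \<Longrightarrow> ez k \<in> Hinf"
  using H2_ez_mult[OF H2_const[of 1], of k] by (intro HinfI[of _ 1]) auto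

text \<open>Up to the factor 2 pi, the Fourier coefficients of the pointwise inner product are the
  pairings of shifts of \<open>\<phi>\<close> with \<open>\<psi>\<close>, and only index 0 survives.
  This is how orthogonality in L^2 becomes a pointwise statement.\<close>

lemma pointwise_vinner_const:
  assumes \<phi>: "L2v n \<phi>" and \<psi>: "L2v n \<psi>"
    and 0: "\<And>k. k \<noteq> 0 \<Longrightarrow> vinner n (\<lambda>c t. ez k t * \<phi> c t) \<psi> = 0"
  shows "AE t in circ. (\<Sum>c<n. \<phi> c t * cnj (\<psi> c t)) = vinner n \<phi> \<psi> / of_real (2*pi)"
proof -
  define f where "f = (\<lambda>t. \<Sum>c<n. \<phi> c t * cnj (\<psi> c t))"
  define C where "C = vinner n \<phi> \<psi> / of_real (2*pi)"
  have f: "integrable circ f" unfolding f_def by (rule vinner_integrable[OF \<phi> \<psi>])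
  have "AE t in circ. f t + (-C) = 0"
  proof (rule fourier_unique)
    show "integrable circ (\<lambda>t. f t + (-C))" using f by (intro Bochner_Integration.integrable_add) auto
    fix k
    have fk: "fourier f k = vinner n (\<lambda>c t. ez (-k) t * \<phi> c t) \<psi> / of_real (2*pi)"
      unfolding fourier_ez f_def vinner_def by (simp add: sum_distrib_left ac_simps)
    have "fourier (\<lambda>t. f t + (-C)) k = fourier f k + fourier (\<lambda>_. -C) k"
      using f by (intro fourier_add) auto
    also have "\<dots> = 0"
    proof (cases "k = 0")
      case True
      have "fourier (\<lambda>_. -C) 0 = -C" by (simp add: fourier_ez circ_def measure_restrict_space scaleR_conv_of_real)
      then show ?thesis unfolding fk using True by (simp add: C_def)
    next
      case False
      then show ?thesis unfolding fk using 0[of "-k"] by (simp add: fourier_const)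
    qed
    finally show "fourier (\<lambda>t. f t + (-C)) k = 0" .
  qed
  then show ?thesis unfolding f_def C_def by eventually_elim simp
qed

section \<open>Boundary uniqueness and quotients of bounded functions\<close>

lemma not_AE_circ_False: "\<not> (AE t in circ. False)"
proof
  assume "AE t in circ. False"
  then have "emeasure circ (space circ) = 0" using emeasure_eq_0_AE[of "\<lambda>_. True" circ] by (auto simp del: space_circ)
  then show False by (simp add: circ_def emeasure_restrict_space)
qed

text \<open>Positive shifts suffice because conjugate symmetry of the inner product covers the
  negative ones.\<close>

lemma pointwise_norm_const:
  assumes \<phi>: "L2v n \<phi>" and 0: "\<And>k. k > 0 \<Longrightarrow> vinner n (\<lambda>c t. ez k t * \<phi> c t) \<phi> = 0"
  shows "AE t in circ. (\<Sum>c<n. (cmod (\<phi> c t))\<^sup>2) = (vnorm n \<phi>)\<^sup>2 / (2*pi)"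
proof -
  have "AE t in circ. (\<Sum>c<n. \<phi> c t * cnj (\<phi> c t)) = vinner n \<phi> \<phi> / of_real (2*pi)"
  proof (rule pointwise_vinner_const[OF \<phi> \<phi>])
    fix k :: int assume "k \<noteq> 0"
    show "vinner n (\<lambda>c t. ez k t * \<phi> c t) \<phi> = 0"
    proof (cases "k > 0")
      case False
      with \<open>k \<noteq> 0\<close> have "vinner n (\<lambda>c t. ez (-k) t * \<phi> c t) \<phi> = 0" by (intro 0) simp
      then show ?thesis
        by (simp add: vinner_ez_left vinner_commute[of n \<phi> "\<lambda>c t. ez (-k) t * \<phi> c t"])
    qed (rule 0)
  qed
  then show ?thesis
  proof eventually_elim
    case (elim t)
    have "complex_of_real (\<Sum>c<n. (cmod (\<phi> c t))\<^sup>2) = (\<Sum>c<n. \<phi> c t * cnj (\<phi> c t))"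
      by (simp only: of_real_sum complex_norm_square)
    also have "\<dots> = of_real ((vnorm n \<phi>)\<^sup>2 / (2*pi))"
      unfolding elim vinner_self[OF \<phi>] by simp
    finally show ?case by (simp only: of_real_eq_iff)
  qed
qed

text \<open>A function at positive distance from the span of its own proper shifts
  produces a function of constant modulus; this replaces the inner--outer factorisation.\<close>

lemma wandering_function:
  assumes g: "g \<in> L2" and d: "d > 0"
    and dist: "\<And>K a. d \<le> vnorm (Suc 0) (\<lambda>c t. g t - (\<Sum>k\<le>K. a k * (ez (int k + 1) t * g t)))"
  obtains \<phi> C where "\<phi> \<in> L2" "C > 0" "AE t in circ. (cmod (\<phi> t))\<^sup>2 = C"
    "\<And>j::int. j > 0 \<Longrightarrow> (\<integral>t. ez j t * g t * cnj (\<phi> t) \<partial>circ) = 0"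
    "AE t in circ. g t = 0 \<longrightarrow> \<phi> t = 0"
proof -
  let ?w = "\<lambda>k (i::nat) (c::nat) t. ez (int k + 1) t * g t"
  have w: "\<And>k::nat. L2v (Suc 0) (\<lambda>(c::nat) t. ez (int k + 1) t * g t)"
    and u: "L2v (Suc 0) (\<lambda>c::nat. g)"
    using g L2_ez_mult by auto
  obtain \<phi> K a where P: "L2v (Suc 0) \<phi>"
    "(\<lambda>m. vnorm (Suc 0) (\<lambda>c t. (g t - (\<Sum>k\<le>K m. \<Sum>i<Suc 0. a m k i * ?w k i c t)) - \<phi> c t)) \<longlonglongrightarrow> 0"
    "\<And>k i. i < Suc 0 \<Longrightarrow> vinner (Suc 0) \<phi> (?w k i) = 0"
    by (rule span_projection[where w="?w" and s="Suc 0", OF w u]) (rule that)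
  define x where "x = (\<lambda>m (c::nat) t. g t - (\<Sum>k\<le>K m. a m k 0 * (ez (int k + 1) t * g t)))"
  have x: "L2v (Suc 0) (x m)" for m
    unfolding x_def using g by (auto intro!: L2_diff L2_sum L2_cmult L2_ez_mult)
  have lim: "(\<lambda>m. vnorm (Suc 0) (\<lambda>c t. x m c t - \<phi> c t)) \<longlonglongrightarrow> 0"
    using P(2) unfolding x_def by simp
  have g0: "vinner (Suc 0) (\<lambda>c t. ez j t * g t) \<phi> = 0" if "j > 0" for j
    using P(3)[of 0 "nat (j - 1)"] that by (simp add: vinner_commute[of _ _ \<phi>])
  \<comment> \<open>The distance hypothesis passes to the limit, so the residual is not of norm
    0.\<close>
  have "d \<le> vnorm (Suc 0) \<phi>"
  proof (rule LIMSEQ_le_const)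
    show "(\<lambda>m. vnorm (Suc 0) (\<lambda>c t. x m c t - \<phi> c t) + vnorm (Suc 0) \<phi>) \<longlonglongrightarrow> vnorm (Suc 0) \<phi>"
      using tendsto_add[OF lim tendsto_const] by simp
    have "d \<le> vnorm (Suc 0) (\<lambda>c t. x m c t - \<phi> c t) + vnorm (Suc 0) \<phi>" for m
      using dist[where K="K m" and a="\<lambda>k. a m k 0"] vnorm_triangle[OF L2v_diff[OF x P(1)] P(1), of m]
      by (simp add: x_def)
    then show "\<exists>N. \<forall>m\<ge>N. d \<le> vnorm (Suc 0) (\<lambda>c t. x m c t - \<phi> c t) + vnorm (Suc 0) \<phi>" by blast
  qed
  then have pos: "(vnorm (Suc 0) \<phi>)\<^sup>2 / (2*pi) > 0" using d by simp
  \<comment> \<open>For j > 0, z^j times \<open>x m\<close> is a combination of functions z^i g with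
    i > 0, all orthogonal to \<open>\<phi>\<close>; the limit in \<open>m\<close> replaces
    \<open>x m\<close> by \<open>\<phi>\<close>.\<close>
  have "vinner (Suc 0) (\<lambda>c t. ez j t * \<phi> c t) \<phi> = 0" if "j > 0" for j
  proof -
    have "vinner (Suc 0) (x m) (\<lambda>c t. ez (-j) t * \<phi> c t) = 0" for m
    proof -
      have "(\<lambda>c t. ez j t * x m c t)
          = (\<lambda>c t. ez j t * g t - (\<Sum>k\<le>K m. a m k 0 * (ez (j + int k + 1) t * g t)))"
        unfolding x_def by (simp add: right_diff_distrib sum_distrib_left add.assoc flip: ez_mult) (simp add: ac_simps)
      moreover have "vinner (Suc 0) (\<lambda>c t. ez j t * g t - (\<Sum>k\<le>K m. a m k 0 * (ez (j + int k + 1) t * g t))) \<phi>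
        = vinner (Suc 0) (\<lambda>c t. ez j t * g t) \<phi>
          - (\<Sum>k\<le>K m. vinner (Suc 0) (\<lambda>c t. a m k 0 * (ez (j + int k + 1) t * g t)) \<phi>)"
        using P(1) g
        by (subst vinner_diff_left) (auto intro!: L2_sum L2_cmult L2_ez_mult vinner_sum_left)
      ultimately show ?thesis
        using that by (simp add: vinner_cmult_left g0 flip: vinner_ez_left)
    qed
    moreover have "(\<lambda>m. vinner (Suc 0) (x m) (\<lambda>c t. ez (-j) t * \<phi> c t)) \<longlonglongrightarrow> vinner (Suc 0) \<phi> (\<lambda>c t. ez (-j) t * \<phi> c t)"
      by (rule vinner_tendsto[OF x P(1) L2v_ez[OF P(1)] lim])
    ultimately show ?thesis by (simp add: LIMSEQ_const_iff vinner_ez_left)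
  qed
  from pointwise_norm_const[OF P(1) this]
  have mod: "AE t in circ. (cmod (\<phi> 0 t))\<^sup>2 = (vnorm (Suc 0) \<phi>)\<^sup>2 / (2*pi)" by simp
  have \<phi>L: "\<phi> 0 \<in> L2" using P(1) by simp
  have [measurable]: "\<phi> 0 \<in> borel_measurable circ" "g \<in> borel_measurable circ"
    using \<phi>L g L2_measurable by auto
  \<comment> \<open>\<open>\<phi>\<close> cut down to the zero set of \<open>g\<close>. Every
    \<open>x m\<close> vanishes there, so the limit of the pairings with \<open>\<psi>\<close> shows
    that \<open>\<psi>\<close> has norm 0.\<close>
  define \<psi> where "\<psi> = (\<lambda>t. indicator {0} (g t) * \<phi> 0 t)"
  have \<psi>L: "\<psi> \<in> L2" unfolding \<psi>_def
    by (rule L2_bounded_mult[where B=1, OF _ _ \<phi>L]) (auto simp: indicator_def)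
  have "(\<lambda>m. vinner (Suc 0) (x m) (\<lambda>_. \<psi>)) \<longlonglongrightarrow> vinner (Suc 0) \<phi> (\<lambda>_. \<psi>)"
    by (rule vinner_tendsto[OF x P(1) _ lim]) (simp add: \<psi>L)
  moreover have "vinner (Suc 0) (x m) (\<lambda>_. \<psi>) = 0" for m
  proof -
    have "x m 0 t * cnj (\<psi> t) = 0" for t by (simp add: x_def \<psi>_def indicator_def)
    then show ?thesis unfolding vinner_1 by (simp only: Bochner_Integration.integral_zero)
  qed
  ultimately have "(\<integral>t. \<phi> 0 t * cnj (\<psi> t) \<partial>circ) = 0" by (simp add: LIMSEQ_const_iff vinner_1)
  moreover have "\<phi> 0 t * cnj (\<psi> t) = of_real ((cmod (\<psi> t))\<^sup>2)" for t
    unfolding complex_norm_square by (simp add: \<psi>_def indicator_def)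
  ultimately have "(\<integral>t. (cmod (\<psi> t))\<^sup>2 \<partial>circ) = 0"
    by (simp del: of_real_power)
  then have "AE t in circ. (cmod (\<psi> t))\<^sup>2 = 0"
    using L2_integrable_sq[OF \<psi>L] by (subst (asm) integral_nonneg_eq_0_iff_AE) auto
  then have "AE t in circ. g t = 0 \<longrightarrow> \<phi> 0 t = 0"
    by eventually_elim (auto simp: \<psi>_def indicator_def)
  moreover have "(\<integral>t. ez j t * g t * cnj (\<phi> 0 t) \<partial>circ) = 0" if "j > 0" for j
    using g0[OF that] by (simp add: vinner_1)
  ultimately show ?thesis using that[OF \<phi>L pos mod] by blast
qed

lemma vnorm_ez: "vnorm (Suc 0) (\<lambda>_. ez k) = sqrt (2*pi)"
  by (simp add: vnorm_def circ_def measure_restrict_space)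

text \<open>At the first index m with a nonzero Fourier coefficient, all of zf, z^2 f, ... have
  coefficient 0. Hence f keeps a positive distance from their span, and the resulting function of
  positive constant modulus can vanish only on a null set, which must contain the zeros of
  f.\<close>

theorem H2_nonvanishing:
  assumes f: "f \<in> H2" and nz: "\<not> (AE t in circ. f t = 0)"
  shows "AE t in circ. f t \<noteq> 0"
proof -
  have fL: "f \<in> L2" using f by (rule H2_L2)
  have "\<exists>k. fourier f k \<noteq> 0" using nz fourier_unique_L2[OF fL] by blast
  then obtain k0 where "fourier f k0 \<noteq> 0" ..
  moreover from this have "k0 \<ge> 0" using f by (force simp: H2_def)
  ultimately have "\<exists>m::nat. fourier f (int m) \<noteq> 0" by (metis nat_0_le)
  then obtain m :: nat where m: "fourier f (int m) \<noteq> 0" "\<And>j. j < m \<Longrightarrow> fourier f (int j) = 0"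
    using exists_least_iff[of "\<lambda>m. fourier f (int m) \<noteq> 0"] by auto
  have low: "fourier f j = 0" if "j < int m" for j
    using m(2)[of "nat j"] that f by (cases "j < 0") (auto simp: H2_def)
  \<comment> \<open>Cauchy-Schwarz against z^m: the numerator is the modulus of the pairing with
    z^m, and sqrt(2 pi) is the norm of z^m.\<close>
  define d where "d = cmod (of_real (2*pi) * fourier f (int m)) / sqrt (2*pi)"
  have "d > 0" using m(1) by (simp add: d_def)
  have "d \<le> vnorm (Suc 0) (\<lambda>c t. f t - (\<Sum>k\<le>K. a k * (ez (int k + 1) t * f t)))" for K a
  proof -
    let ?x = "\<lambda>(c::nat) t. f t - (\<Sum>k\<le>K. a k * (ez (int k + 1) t * f t))"
    have x: "L2v (Suc 0) ?x" using fL by (auto intro!: L2_diff L2_sum L2_cmult L2_ez_mult)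
    have "vinner (Suc 0) ?x (\<lambda>_. ez (int m))
        = vinner (Suc 0) (\<lambda>_. f) (\<lambda>_. ez (int m))
          - (\<Sum>k\<le>K. vinner (Suc 0) (\<lambda>c t. a k * (ez (int k + 1) t * f t)) (\<lambda>_. ez (int m)))"
      using fL L2_ez
      by (subst vinner_diff_left) (auto intro!: L2_sum L2_cmult L2_ez_mult vinner_sum_left)
    also have "(\<Sum>k\<le>K. vinner (Suc 0) (\<lambda>c t. a k * (ez (int k + 1) t * f t)) (\<lambda>_. ez (int m))) = 0"
    proof (rule sum.neutral, intro ballI)
      fix k
      have "fourier (\<lambda>t. ez (int k + 1) t * f t) (int m) = 0"
        unfolding fourier_ez_mult by (rule low) simp
      then show "vinner (Suc 0) (\<lambda>c t. a k * (ez (int k + 1) t * f t)) (\<lambda>_. ez (int m)) = 0"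
        by (simp add: vinner_cmult_left fourier_vinner)
    qed
    finally have "vinner (Suc 0) ?x (\<lambda>_. ez (int m)) = of_real (2*pi) * fourier f (int m)"
      by (simp add: fourier_vinner)
    with Cauchy_Schwarz_vinner[OF x, of "\<lambda>_. ez (int m)"]
    have "cmod (of_real (2*pi) * fourier f (int m)) \<le> vnorm (Suc 0) ?x * sqrt (2*pi)"
      by (simp add: L2_ez vnorm_ez)
    then show ?thesis by (simp add: d_def divide_le_eq)
  qed
  then obtain \<phi> C where P: "\<phi> \<in> L2" "C > 0" "AE t in circ. (cmod (\<phi> t))\<^sup>2 = C"
    "\<And>j::int. j > 0 \<Longrightarrow> (\<integral>t. ez j t * f t * cnj (\<phi> t) \<partial>circ) = 0"
    "AE t in circ. f t = 0 \<longrightarrow> \<phi> t = 0"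
    by (rule wandering_function[OF fL \<open>d > 0\<close>]) (rule that)
  from P(3,5) show ?thesis by eventually_elim (use P(2) in auto)
qed

text \<open>The weight \<open>g\<close> is chosen so that g and fg are bounded by 1 while 1/g is
  still square-integrable; the latter keeps g at a positive distance from its proper shifts.\<close>

theorem H2_subset_Nev: "H2 \<subseteq> Nev"
proof
  fix f assume f: "f \<in> H2"
  then have fL: "f \<in> L2" by (rule H2_L2)
  have [measurable]: "f \<in> borel_measurable circ" using fL by (rule L2_measurable)
  define r where "r = (\<lambda>t. sqrt (1 + (cmod (f t))\<^sup>2))"
  define g where "g = (\<lambda>t. complex_of_real (1 / r t))"
  define g' where "g' = (\<lambda>t. complex_of_real (r t))"
  have r1: "r t \<ge> 1" for t by (simp add: r_def)
  then have r0: "r t > 0" for t by (meson less_le_trans zero_less_one)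
  have rf: "r t \<ge> cmod (f t)" for t
    unfolding r_def by (rule real_le_rsqrt) simp
  have [measurable]: "r \<in> borel_measurable circ" unfolding r_def by measurable
  have g1: "cmod (g t) \<le> 1" for t using r1[of t] by (simp add: g_def norm_divide)
  have [measurable]: "g \<in> borel_measurable circ" unfolding g_def by measurable
  have gL: "g \<in> L2" by (rule L2_bounded[where B=1]) (use g1 in auto)
  have g'L: "g' \<in> L2"
  proof -
    have "g' \<in> borel_measurable circ" unfolding g'_def by measurable
    moreover have "(cmod (g' t))\<^sup>2 = 1 + (cmod (f t))\<^sup>2" for t
      by (simp add: g'_def r_def)
    ultimately show ?thesis using L2_integrable_sq[OF fL] by (simp add: L2_def)
  qed
  \<comment> \<open>Pairing with g' = 1/g leaves 1 minus a combination of z, z^2, ..., whose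
    integral is 2 pi whatever the coefficients.\<close>
  have CS: "2 * pi \<le> vnorm (Suc 0) (\<lambda>c t. g t - (\<Sum>k\<le>K. a k * (ez (int k + 1) t * g t))) * vnorm (Suc 0) (\<lambda>_. g')" for K a
  proof -
    let ?x = "\<lambda>(c::nat) t. g t - (\<Sum>k\<le>K. a k * (ez (int k + 1) t * g t))"
    have x: "L2v (Suc 0) ?x" using gL by (auto intro!: L2_diff L2_sum L2_cmult L2_ez_mult)
    have "?x 0 t * cnj (g' t) = 1 - (\<Sum>k\<le>K. a k * ez (int k + 1) t)" for t
      using r0[of t] by (simp add: g_def g'_def left_diff_distrib sum_distrib_right)
    then have "vinner (Suc 0) ?x (\<lambda>_. g') = (\<integral>t. 1 - (\<Sum>k\<le>K. a k * ez (int k + 1) t) \<partial>circ)"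
      unfolding vinner_1 by simp
    also have "\<dots> = (\<integral>t. ez 0 t \<partial>circ) - (\<Sum>k\<le>K. \<integral>t. a k * ez (int k + 1) t \<partial>circ)"
      by (simp add: L2_integrable L2_sum L2_cmult L2_ez)
    also have "\<dots> = of_real (2*pi)" by (simp add: integral_ez del: ez_0)
    finally show ?thesis using Cauchy_Schwarz_vinner[OF x, of "\<lambda>_. g'"] g'L by simp
  qed
  have "vnorm (Suc 0) (\<lambda>_. g') \<noteq> 0"
  proof
    assume "vnorm (Suc 0) (\<lambda>_. g') = 0"
    with CS[where K=0 and a="\<lambda>_. 0"] have "2 * pi \<le> 0" by simp
    then show False using pi_gt_zero by linarith
  qed
  then have g'pos: "vnorm (Suc 0) (\<lambda>_. g') > 0" using vnorm_nonneg[of "Suc 0" "\<lambda>_. g'"] by linarith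
  have "2 * pi / vnorm (Suc 0) (\<lambda>_. g') \<le> vnorm (Suc 0) (\<lambda>c t. g t - (\<Sum>k\<le>K. a k * (ez (int k + 1) t * g t)))" for K a
    using CS[where K=K and a=a] g'pos by (simp add: divide_le_eq)
  note dist = this
  have dpos: "2 * pi / vnorm (Suc 0) (\<lambda>_. g') > 0" using g'pos by simp
  obtain \<phi> C where P: "\<phi> \<in> L2" "C > 0" "AE t in circ. (cmod (\<phi> t))\<^sup>2 = C"
    "\<And>j::int. j > 0 \<Longrightarrow> (\<integral>t. ez j t * g t * cnj (\<phi> t) \<partial>circ) = 0"
    "AE t in circ. g t = 0 \<longrightarrow> \<phi> t = 0"
    by (rule wandering_function[OF gL dpos dist]) (rule that)
  define v where "v = (\<lambda>t. g t * cnj (\<phi> t))"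
  define u where "u = (\<lambda>t. f t * v t)"
  have \<phi>b: "AE t in circ. cmod (\<phi> t) = sqrt C" using P(3) by eventually_elim (simp add: real_sqrt_unique)
  have vL: "v \<in> L2" unfolding v_def by (rule L2_bounded_mult[where B=1]) (use g1 P(1) L2_cnj in auto)
  \<comment> \<open>Orthogonality of z^j g to \<open>\<phi>\<close> for j > 0 is exactly the
    vanishing of the coefficient of \<open>v\<close> at -j.\<close>
  have vH: "v \<in> H2"
  proof -
    have "fourier v k = 0" if "k < 0" for k
      using P(4)[of "-k"] that unfolding fourier_eq_0_iff v_def by (simp add: ac_simps)
    with vL show ?thesis by (simp add: H2_def)
  qed
  have "AE t in circ. cmod (v t) \<le> sqrt C"
    using \<phi>b by eventually_elim (use g1 P(2) in \<open>auto simp: v_def norm_mult intro: mult_left_le_one_le\<close>)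
  with vH have vI: "v \<in> Hinf" by (rule HinfI)
  have ub: "AE t in circ. cmod (u t) \<le> sqrt C"
    using \<phi>b
  proof eventually_elim
    case (elim t)
    have "cmod (f t) / r t \<le> 1" using rf[of t] r0[of t] by simp
    then have "cmod (f t) / r t * sqrt C \<le> 1 * sqrt C" using P(2) by (intro mult_right_mono) auto
    moreover have "cmod (u t) = cmod (f t) / r t * sqrt C"
      unfolding u_def v_def g_def using elim r0[of t] by (simp add: norm_mult norm_divide)
    ultimately show ?case by simp
  qed
  have "u \<in> L2" by (rule L2_bounded[OF _ ub]) (use L2_measurable[OF vL] in \<open>simp add: u_def\<close>)
  moreover have "fourier u k = 0" if "k < 0" for k unfolding u_def by (rule fourier_H2_mult[OF f vH that])
  ultimately have "u \<in> H2" by (simp add: H2_def)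
  then have uI: "u \<in> Hinf" using ub by (rule HinfI)
  have vnz: "AE t in circ. v t \<noteq> 0"
    using P(3) by eventually_elim (use r0 P(2) in \<open>auto simp: v_def g_def less_imp_neq[symmetric]\<close>)
  have "\<not> (AE t in circ. v t = 0)"
  proof
    assume "AE t in circ. v t = 0"
    with vnz have "AE t in circ. False" by eventually_elim simp
    then show False using not_AE_circ_False by simp
  qed
  moreover have "AE t in circ. f t = u t / v t" using vnz by eventually_elim (simp add: u_def)
  ultimately show "f \<in> Nev" unfolding Nev_def using uI vI by blast
qed

section \<open>The Nevanlinna field\<close>

lemma Hinf_nonvanishing: "f \<in> Hinf \<Longrightarrow> \<not> (AE t in circ. f t = 0) \<Longrightarrow> AE t in circ. f t \<noteq> 0"
  by (rule H2_nonvanishing[OF Hinf_H2])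

lemma AE_circ_nonzero: "AE t in circ. f t \<noteq> (0::complex) \<Longrightarrow> \<not> (AE t in circ. f t = 0)"
proof
  assume "AE t in circ. f t \<noteq> 0" "AE t in circ. f t = 0"
  then have "AE t in circ. False" by eventually_elim simp
  then show False using not_AE_circ_False by simp
qed

text \<open>\<open>Nev\<close> asks only for a denominator that is not a.e. zero; boundary
  uniqueness strengthens this to a.e. nonzero, as pointwise arithmetic with fractions
  requires.\<close>

lemma NevE:
  assumes "\<phi> \<in> Nev"
  obtains a b where "a \<in> Hinf" "b \<in> Hinf" "AE t in circ. b t \<noteq> 0" "AE t in circ. \<phi> t = a t / b t"
  using assms Hinf_nonvanishing unfolding Nev_def by blast

lemma NevI:
  assumes "a \<in> Hinf" "b \<in> Hinf" "AE t in circ. b t \<noteq> 0" "AE t in circ. \<phi> t = a t / b t"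
  shows "\<phi> \<in> Nev"
  using assms AE_circ_nonzero unfolding Nev_def by blast

lemma Nev_cong: "\<phi> \<in> Nev \<Longrightarrow> AE t in circ. \<psi> t = \<phi> t \<Longrightarrow> \<psi> \<in> Nev"
proof (erule NevE)
  fix a b
  assume ab: "a \<in> Hinf" "b \<in> Hinf" "AE t in circ. b t \<noteq> 0"
  assume "AE t in circ. \<psi> t = \<phi> t" "AE t in circ. \<phi> t = a t / b t"
  then have "AE t in circ. \<psi> t = a t / b t" by eventually_elim simp
  with ab show "\<psi> \<in> Nev" by (rule NevI)
qed

lemma Nev_add:
  assumes "\<phi> \<in> Nev" "\<psi> \<in> Nev"
  shows "(\<lambda>t. \<phi> t + \<psi> t) \<in> Nev"
proof -
  from assms obtain a b c d where *: "a \<in> Hinf" "b \<in> Hinf" "AE t in circ. b t \<noteq> 0" "AE t in circ. \<phi> t = a t / b t"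
    "c \<in> Hinf" "d \<in> Hinf" "AE t in circ. d t \<noteq> 0" "AE t in circ. \<psi> t = c t / d t" by (elim NevE)
  show ?thesis
  proof (rule NevI)
    show "(\<lambda>t. a t * d t + c t * b t) \<in> Hinf" "(\<lambda>t. b t * d t) \<in> Hinf"
      by (intro Hinf_add Hinf_mult *)+
    show "AE t in circ. b t * d t \<noteq> 0" using *(3,7) by eventually_elim simp
    show "AE t in circ. \<phi> t + \<psi> t = (a t * d t + c t * b t) / (b t * d t)"
      using *(3,4,7,8) by eventually_elim (simp add: field_simps)
  qed
qed

lemma Nev_mult:
  assumes "\<phi> \<in> Nev" "\<psi> \<in> Nev"
  shows "(\<lambda>t. \<phi> t * \<psi> t) \<in> Nev"
proof -
  from assms obtain a b c d where *: "a \<in> Hinf" "b \<in> Hinf" "AE t in circ. b t \<noteq> 0" "AE t in circ. \<phi> t = a t / b t"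
    "c \<in> Hinf" "d \<in> Hinf" "AE t in circ. d t \<noteq> 0" "AE t in circ. \<psi> t = c t / d t" by (elim NevE)
  show ?thesis
  proof (rule NevI)
    show "(\<lambda>t. a t * c t) \<in> Hinf" "(\<lambda>t. b t * d t) \<in> Hinf" by (intro Hinf_mult *)+
    show "AE t in circ. b t * d t \<noteq> 0" using *(3,7) by eventually_elim simp
    show "AE t in circ. \<phi> t * \<psi> t = (a t * c t) / (b t * d t)"
      using *(4,8) by eventually_elim simp
  qed
qed

lemma Hinf_Nev: "f \<in> Hinf \<Longrightarrow> f \<in> Nev"
  by (rule NevI[of f "\<lambda>_. 1"]) (auto intro: Hinf_const)

lemma Nev_const: "(\<lambda>_. a) \<in> Nev"
  by (intro Hinf_Nev Hinf_const)

lemma Nev_inverse: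
  assumes "\<phi> \<in> Nev"
  shows "(\<lambda>t. inverse (\<phi> t)) \<in> Nev"
proof -
  from assms obtain a b where *: "a \<in> Hinf" "b \<in> Hinf" "AE t in circ. b t \<noteq> 0" "AE t in circ. \<phi> t = a t / b t"
    by (elim NevE)
  show ?thesis
  proof (cases "AE t in circ. a t = 0")
    \<comment> \<open>The convention \<open>inverse 0 = 0\<close> keeps this case inside
      \<open>Nev\<close>.\<close>
    case True
    with *(4) have "AE t in circ. inverse (\<phi> t) = 0" by eventually_elim simp
    then show ?thesis by (rule Nev_cong[OF Nev_const])
  next
    case False
    show ?thesis
    proof (rule NevI[OF *(2,1)])
      show "AE t in circ. a t \<noteq> 0" by (rule Hinf_nonvanishing[OF *(1) False])
      show "AE t in circ. inverse (\<phi> t) = b t / a t" using *(4) by eventually_elim simp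
    qed
  qed
qed

lemma Nev_divide: "\<phi> \<in> Nev \<Longrightarrow> \<psi> \<in> Nev \<Longrightarrow> (\<lambda>t. \<phi> t / \<psi> t) \<in> Nev"
  unfolding divide_inverse by (intro Nev_mult Nev_inverse)

lemma Nev_diff: "\<phi> \<in> Nev \<Longrightarrow> \<psi> \<in> Nev \<Longrightarrow> (\<lambda>t. \<phi> t - \<psi> t) \<in> Nev"
  using Nev_add[OF _ Nev_mult[OF Nev_const[of "-1"]], of \<phi> \<psi>] by simp

lemma Nev_sum: "(\<And>i. i \<in> I \<Longrightarrow> \<phi> i \<in> Nev) \<Longrightarrow> (\<lambda>t. \<Sum>i\<in>I. \<phi> i t) \<in> Nev"
  by (induction I rule: infinite_finite_induct) (auto intro: Nev_add Nev_const)

text \<open>Makes pointwise division by a pivot legitimate during elimination; the zeros of a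
  fraction are those of its numerator up to a null set.\<close>

lemma Nev_nonvanishing:
  assumes "\<phi> \<in> Nev" "\<not> (AE t in circ. \<phi> t = 0)"
  shows "AE t in circ. \<phi> t \<noteq> 0"
proof -
  from assms obtain a b where *: "a \<in> Hinf" "b \<in> Hinf" "AE t in circ. b t \<noteq> 0" "AE t in circ. \<phi> t = a t / b t"
    by (elim NevE)
  have "\<not> (AE t in circ. a t = 0)"
  proof
    assume "AE t in circ. a t = 0"
    with *(4) have "AE t in circ. \<phi> t = 0" by eventually_elim simp
    with assms(2) show False ..
  qed
  then have "AE t in circ. a t \<noteq> 0" by (rule Hinf_nonvanishing[OF *(1)])
  with *(3,4) show ?thesis by eventually_elim simp
qed

lemma Nev_common_denominator:
  assumes "finite I" "\<And>i. i \<in> I \<Longrightarrow> \<phi> i \<in> Nev"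
  shows "\<exists>b\<in>Hinf. (AE t in circ. b t \<noteq> 0) \<and> (\<forall>i\<in>I. \<exists>x\<in>Hinf. AE t in circ. b t * \<phi> i t = x t)"
  using assms
proof (induction I rule: finite_induct)
  case empty
  then show ?case using Hinf_const[of 1] by (intro bexI[of _ "\<lambda>_. 1"]) auto
next
  case (insert j I)
  then obtain b where b: "b \<in> Hinf" "AE t in circ. b t \<noteq> 0" "\<And>i. i \<in> I \<Longrightarrow> \<exists>x\<in>Hinf. AE t in circ. b t * \<phi> i t = x t"
    by auto
  from insert.prems[of j] obtain c d where cd: "c \<in> Hinf" "d \<in> Hinf" "AE t in circ. d t \<noteq> 0" "AE t in circ. \<phi> j t = c t / d t"
    by (auto elim: NevE)
  show ?case
  proof (rule bexI[of _ "\<lambda>t. b t * d t"], intro conjI ballI)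
    show "AE t in circ. b t * d t \<noteq> 0" using b(2) cd(3) by eventually_elim simp
    show "(\<lambda>t. b t * d t) \<in> Hinf" by (intro Hinf_mult b cd)
    fix i assume "i \<in> insert j I"
    then consider "i = j" | "i \<in> I" by blast
    then show "\<exists>x\<in>Hinf. AE t in circ. b t * d t * \<phi> i t = x t"
    proof cases
      case 1
      have "AE t in circ. b t * d t * \<phi> i t = b t * c t"
        using cd(3,4) by eventually_elim (simp add: 1)
      then show ?thesis by (intro bexI[of _ "\<lambda>t. b t * c t"] Hinf_mult b cd)
    next
      case 2
      from b(3)[OF 2] obtain x where x: "x \<in> Hinf" "AE t in circ. b t * \<phi> i t = x t" by blast
      from x(2) have "AE t in circ. b t * d t * \<phi> i t = d t * x t"
        by eventually_elim (simp add: ac_simps)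
      then show ?thesis by (intro bexI[of _ "\<lambda>t. d t * x t"] Hinf_mult x cd)
    qed
  qed
qed

text \<open>Full column rank over the Nevanlinna field; only the first \<open>k\<close> columns count.\<close>

definition rows_inj_Nev :: "nat \<Rightarrow> nat set \<Rightarrow> (nat \<Rightarrow> nat \<Rightarrow> real \<Rightarrow> complex) \<Rightarrow> bool" where
  "rows_inj_Nev k I \<Theta> \<longleftrightarrow> (\<forall>h. (\<forall>j<k. h j \<in> Nev) \<longrightarrow>
     (\<forall>i\<in>I. AE t in circ. (\<Sum>j<k. \<Theta> i j t * h j t) = 0) \<longrightarrow> (\<forall>j<k. AE t in circ. h j t = 0))"

lemma rows_inj_NevD:
  assumes "rows_inj_Nev k I \<Theta>" "\<And>j. j < k \<Longrightarrow> h j \<in> Nev"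
    "\<And>i. i \<in> I \<Longrightarrow> AE t in circ. (\<Sum>j<k. \<Theta> i j t * h j t) = 0" "j < k"
  shows "AE t in circ. h j t = 0"
  using assms unfolding rows_inj_Nev_def by blast

text \<open>Gaussian elimination over the Nevanlinna field, one column per step: choose a pivot row
  \<open>r\<close> for the last column and apply induction to the Schur complement on the remaining
  rows.\<close>

lemma rows_inj_Nev_subset:
  assumes "finite I" "\<And>i j. i \<in> I \<Longrightarrow> j < k \<Longrightarrow> \<Theta> i j \<in> Nev" "rows_inj_Nev k I \<Theta>"
  shows "\<exists>I0\<subseteq>I. card I0 = k \<and> rows_inj_Nev k I0 \<Theta>"
  using assms
proof (induction k arbitrary: I \<Theta>)
  case 0
  then show ?case by (intro exI[of _ "{}"]) (auto simp: rows_inj_Nev_def)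
next
  case (Suc k)
  note inj = Suc.prems(3)
  have "\<exists>r\<in>I. \<not> (AE t in circ. \<Theta> r k t = 0)"
  proof (rule ccontr)
    assume "\<not> ?thesis"
    \<comment> \<open>If the last column vanished on \<open>I\<close>, the unit vector in coordinate
      \<open>k\<close> would be a nonzero kernel vector.\<close>
    then have "AE t in circ. (if k = k then 1 else 0 :: complex) = 0"
      by (intro rows_inj_NevD[OF inj, of "\<lambda>j t. if j = k then 1 else 0"])
         (auto simp: Nev_const)
    then show False using not_AE_circ_False by simp
  qed
  then obtain r where r: "r \<in> I" "\<not> (AE t in circ. \<Theta> r k t = 0)" by blast
  have rN: "\<Theta> r k \<in> Nev" using Suc.prems(2)[OF r(1), of k] by simp
  from Nev_nonvanishing[OF this r(2)] have piv: "AE t in circ. \<Theta> r k t \<noteq> 0" .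
  \<comment> \<open>Schur complement with respect to the pivot in row \<open>r\<close> and column
    \<open>k\<close>.\<close>
  define \<Theta>' where "\<Theta>' = (\<lambda>i j t. \<Theta> i j t - \<Theta> i k t * \<Theta> r j t / \<Theta> r k t)"
  have \<Theta>'N: "\<Theta>' i j \<in> Nev" if "i \<in> I - {r}" "j < k" for i j
    unfolding \<Theta>'_def using that r(1) rN by (intro Nev_diff Nev_divide Nev_mult Suc.prems) auto
  have elim_eq: "(\<Sum>j<Suc k. \<Theta> i j t * h j t) = (\<Sum>j<k. \<Theta>' i j t * h j t)"
    if "\<Theta> r k t \<noteq> 0" "(\<Sum>j<Suc k. \<Theta> r j t * h j t) = 0" for i t h
  proof -
    have hk: "h k t = - (\<Sum>j<k. \<Theta> r j t * h j t) / \<Theta> r k t"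
      using that by (simp add: field_simps eq_neg_iff_add_eq_0)
    have "(\<Sum>j<k. \<Theta>' i j t * h j t) = (\<Sum>j<k. \<Theta> i j t * h j t) - \<Theta> i k t / \<Theta> r k t * (\<Sum>j<k. \<Theta> r j t * h j t)"
      unfolding \<Theta>'_def sum_distrib_left sum_subtractf[symmetric]
      by (intro sum.cong) (auto simp: algebra_simps)
    then show ?thesis using hk by simp
  qed
  have "rows_inj_Nev k (I - {r}) \<Theta>'"
    unfolding rows_inj_Nev_def
  proof (intro allI impI)
    fix h :: "nat \<Rightarrow> real \<Rightarrow> complex" and j
    assume h: "\<forall>j<k. h j \<in> Nev" and 0: "\<forall>i\<in>I - {r}. AE t in circ. (\<Sum>j<k. \<Theta>' i j t * h j t) = 0" and j: "j < k"
    \<comment> \<open>Coordinate \<open>k\<close> gets the value forced by row \<open>r\<close>; the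
      other rows then vanish through \<open>elim_eq\<close>.\<close>
    define h' where "h' = (\<lambda>j. if j < k then h j else (\<lambda>t. - 1 * (\<Sum>j<k. \<Theta> r j t * h j t) / \<Theta> r k t))"
    have h'N: "h' j \<in> Nev" if "j < Suc k" for j
      unfolding h'_def using that h r(1) rN
      by (auto intro!: Nev_divide Nev_mult[of "\<lambda>_. - 1", simplified] Nev_const Nev_sum Nev_mult Suc.prems)
    have row_r: "AE t in circ. (\<Sum>j<Suc k. \<Theta> r j t * h' j t) = 0"
      using piv by eventually_elim (simp add: h'_def)
    have "AE t in circ. h' j t = 0"
    proof (rule rows_inj_NevD[OF inj h'N])
      fix i assume "i \<in> I"
      show "AE t in circ. (\<Sum>j<Suc k. \<Theta> i j t * h' j t) = 0"
      proof (cases "i = r")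
        case False
        with 0 \<open>i \<in> I\<close> have "AE t in circ. (\<Sum>j<k. \<Theta>' i j t * h j t) = 0" by blast
        with piv row_r show ?thesis
        proof eventually_elim
          case (elim t)
          have "(\<Sum>j<Suc k. \<Theta> i j t * h' j t) = (\<Sum>j<k. \<Theta>' i j t * h' j t)"
            by (rule elim_eq) (use elim in auto)
          also have "\<dots> = (\<Sum>j<k. \<Theta>' i j t * h j t)" by (intro sum.cong) (auto simp: h'_def)
          finally show ?case using elim by simp
        qed
      qed (use row_r in simp)
    qed (use j in auto)
    then show "AE t in circ. h j t = 0" using j by (simp add: h'_def)
  qed
  from Suc.IH[OF _ \<Theta>'N this] Suc.prems(1) obtain I0
    where I0: "I0 \<subseteq> I - {r}" "card I0 = k" "rows_inj_Nev k I0 \<Theta>'" by auto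
  have "rows_inj_Nev (Suc k) (insert r I0) \<Theta>"
    unfolding rows_inj_Nev_def
  proof (intro allI impI)
    fix h :: "nat \<Rightarrow> real \<Rightarrow> complex" and j
    assume h: "\<forall>j<Suc k. h j \<in> Nev" and 0: "\<forall>i\<in>insert r I0. AE t in circ. (\<Sum>j<Suc k. \<Theta> i j t * h j t) = 0"
      and j: "j < Suc k"
    from 0 have row_r: "AE t in circ. (\<Sum>j<Suc k. \<Theta> r j t * h j t) = 0" by blast
    have low: "AE t in circ. h j t = 0" if "j < k" for j
    proof (rule rows_inj_NevD[OF I0(3)])
      fix i assume "i \<in> I0"
      with 0 have "AE t in circ. (\<Sum>j<Suc k. \<Theta> i j t * h j t) = 0" by blast
      with piv row_r show "AE t in circ. (\<Sum>j<k. \<Theta>' i j t * h j t) = 0"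
        by eventually_elim (use elim_eq in metis)
    qed (use h that in auto)
    show "AE t in circ. h j t = 0"
    proof (cases "j < k")
      case False
      with j have "j = k" by simp
      have "AE t in circ. \<forall>j\<in>{..<k}. h j t = 0" using low by (intro AE_finite_allI) auto
      with piv row_r show ?thesis unfolding \<open>j = k\<close> by eventually_elim simp
    qed (rule low)
  qed
  moreover have "card (insert r I0) = Suc k"
    using I0 Suc.prems(1) by (subst card_insert_disjoint) (auto intro: finite_subset)
  ultimately show ?case using I0(1) r(1) by (intro exI[of _ "insert r I0"]) auto
qed

section \<open>The Beurling-Lax theorem\<close>

text \<open>Presenting subspaces by annihilators gives closedness under L^2 limits, and stability of
  \<open>W\<close> under 1/z turns into stability under z.\<close>

definition orth :: "nat \<Rightarrow> (nat \<Rightarrow> real \<Rightarrow> complex) set \<Rightarrow> (nat \<Rightarrow> real \<Rightarrow> complex) set" where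
  "orth n W = {h. L2v n h \<and> (\<forall>w\<in>W. vinner n h w = 0)}"

lemma orth_lin:
  assumes W: "\<And>w. w \<in> W \<Longrightarrow> L2v n w" and "v \<in> orth n W" "u \<in> orth n W"
  shows "(\<lambda>c t. v c t + a * u c t) \<in> orth n W"
proof -
  have "vinner n (\<lambda>c t. v c t + a * u c t) w = 0" if "w \<in> W" for w
    using assms that by (subst vinner_add_left) (auto simp: orth_def vinner_cmult_left intro: L2v_cmult)
  then show ?thesis using assms by (auto simp: orth_def intro!: L2v_add L2v_cmult)
qed

lemma orth_diff:
  assumes W: "\<And>w. w \<in> W \<Longrightarrow> L2v n w" and "v \<in> orth n W" "u \<in> orth n W"
  shows "(\<lambda>c t. v c t - u c t) \<in> orth n W"
  using orth_lin[OF W assms(2,3), of "-1"] by simp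

lemma orth_limit:
  assumes W: "\<And>w. w \<in> W \<Longrightarrow> L2v n w" and x: "\<And>m. x m \<in> orth n W" and \<phi>: "L2v n \<phi>"
    and lim: "(\<lambda>m. vnorm n (\<lambda>c t. x m c t - \<phi> c t)) \<longlonglongrightarrow> 0"
  shows "\<phi> \<in> orth n W"
proof -
  have "vinner n \<phi> w = 0" if "w \<in> W" for w
  proof -
    have "(\<lambda>m. vinner n (x m) w) \<longlonglongrightarrow> vinner n \<phi> w"
      using x by (intro vinner_tendsto[OF _ \<phi> W[OF that] lim]) (auto simp: orth_def)
    moreover have "vinner n (x m) w = 0" for m using x[of m] that by (auto simp: orth_def)
    ultimately show ?thesis by (simp add: LIMSEQ_const_iff)
  qed
  with \<phi> show ?thesis by (simp add: orth_def)
qed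

lemma orth_shift:
  assumes sh: "\<And>w. w \<in> W \<Longrightarrow> (\<lambda>c t. ez (-1) t * w c t) \<in> W" and h: "h \<in> orth n W"
  shows "(\<lambda>c t. ez (int k) t * h c t) \<in> orth n W"
proof (induction k)
  case 0
  then show ?case using h by simp
next
  case (Suc k)
  have "(\<lambda>c t. ez (int (Suc k)) t * h c t) = (\<lambda>c t. ez 1 t * (ez (int k) t * h c t))"
    by (simp flip: mult.assoc add: ez_mult)
  moreover have "(\<lambda>c t. ez 1 t * (ez (int k) t * h c t)) \<in> orth n W"
    using Suc sh L2v_ez[of n "\<lambda>c t. ez (int k) t * h c t" 1] by (auto simp: orth_def vinner_ez_left[of n 1])
  ultimately show ?case by simp
qed

text \<open>The test vector is z^k times the c-th unit vector. Reading off Fourier coefficients in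
  this way makes analyticity an orthogonality condition, which survives limits.\<close>

lemma vinner_unit:
  assumes "c < n"
  shows "vinner n g (\<lambda>d t. if d = c then ez k t else 0) = of_real (2*pi) * fourier (g c) k"
proof -
  have "(\<Sum>d<n. g d t * cnj (if d = c then ez k t else 0)) = g c t * ez (-k) t" for t
  proof -
    have "(\<Sum>d<n. g d t * cnj (if d = c then ez k t else 0)) = (\<Sum>d<n. if d = c then g c t * ez (-k) t else 0)"
      by (intro sum.cong) auto
    then show ?thesis using assms by simp
  qed
  then show ?thesis unfolding vinner_def fourier_ez by simp
qed

lemma L2v_unit: "L2v n (\<lambda>d t. if d = c then ez k t else 0)"
proof -
  have "(\<lambda>t. if d = c then ez k t else 0) \<in> L2" for d
    using L2_ez L2_const[of 0] by (cases "d = c") auto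
  then show ?thesis by (simp add: L2v_def)
qed

text \<open>The second clause is orthogonality to zM. Orthonormality is pointwise rather than in
  L^2: this makes the vectors the columns of an inner matrix and limits \<open>k\<close> by
  \<open>n\<close>.\<close>

definition wandering_frame ::
  "nat \<Rightarrow> (nat \<Rightarrow> real \<Rightarrow> complex) set \<Rightarrow> nat \<Rightarrow> (nat \<Rightarrow> nat \<Rightarrow> real \<Rightarrow> complex) \<Rightarrow> bool" where
  "wandering_frame n M k \<phi> \<longleftrightarrow> (\<forall>j<k. \<phi> j \<in> M) \<and>
     (\<forall>j<k. \<forall>h\<in>M. vinner n (\<lambda>c t. ez 1 t * h c t) (\<phi> j) = 0) \<and>
     (AE t in circ. \<forall>j<k. \<forall>l<k. (\<Sum>c<n. cnj (\<phi> j c t) * \<phi> l c t) = (if j = l then 1 else 0))"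

text \<open>Entry j of \<Phi>^* h, where \<Phi> is the matrix with columns
  \<open>\<phi> j\<close>.\<close>

definition coef :: "nat \<Rightarrow> (nat \<Rightarrow> nat \<Rightarrow> real \<Rightarrow> complex) \<Rightarrow> (nat \<Rightarrow> real \<Rightarrow> complex) \<Rightarrow> nat \<Rightarrow> real \<Rightarrow> complex" where
  "coef n \<phi> h j t = (\<Sum>c<n. cnj (\<phi> j c t) * h c t)"

text \<open>This is h - \<Phi> \<Phi>^* h; for a frame it is pointwise the part of h orthogonal to
  the columns.\<close>

definition rest :: "nat \<Rightarrow> nat \<Rightarrow> (nat \<Rightarrow> nat \<Rightarrow> real \<Rightarrow> complex) \<Rightarrow> (nat \<Rightarrow> real \<Rightarrow> complex) \<Rightarrow> nat \<Rightarrow> real \<Rightarrow> complex" where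
  "rest n k \<phi> h = (\<lambda>c t. h c t - (\<Sum>j<k. \<phi> j c t * coef n \<phi> h j t))"

text \<open>With all integer shifts present, orthogonality to them amounts to pointwise
  orthogonality to the frame, by \<open>pointwise_vinner_const\<close>, and the set stays stable
  under 1/z.\<close>

definition frame_shifts :: "(nat \<Rightarrow> real \<Rightarrow> complex) set \<Rightarrow> nat \<Rightarrow> (nat \<Rightarrow> nat \<Rightarrow> real \<Rightarrow> complex) \<Rightarrow> (nat \<Rightarrow> real \<Rightarrow> complex) set" where
  "frame_shifts W k \<phi> = W \<union> {\<lambda>c t. ez i t * \<phi> j c t | i j. j < k}"

section \<open>Wandering frames of a z-invariant subspace of H^2\<close>

context
  fixes n :: nat and W M :: "(nat \<Rightarrow> real \<Rightarrow> complex) set"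
  assumes W: "\<And>w. w \<in> W \<Longrightarrow> L2v n w"
    and W_shift: "\<And>w. w \<in> W \<Longrightarrow> (\<lambda>c t. ez (-1) t * w c t) \<in> W"
    and M_H2: "\<And>h c. h \<in> M \<Longrightarrow> c < n \<Longrightarrow> h c \<in> H2"
    and M_def: "M = orth n W"
begin

lemma M_L2v: "h \<in> M \<Longrightarrow> L2v n h"
  by (simp add: M_def orth_def)

lemma M_shift: "h \<in> M \<Longrightarrow> (\<lambda>c t. ez (int k) t * h c t) \<in> M"
  unfolding M_def by (rule orth_shift[OF W_shift])

context
  fixes k :: nat and \<phi> :: "nat \<Rightarrow> nat \<Rightarrow> real \<Rightarrow> complex"
  assumes frame: "wandering_frame n M k \<phi>"
begin

lemma frame_mem: "j < k \<Longrightarrow> \<phi> j \<in> M"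
  using frame by (simp add: wandering_frame_def)

lemma frame_wandering: "j < k \<Longrightarrow> h \<in> M \<Longrightarrow> vinner n (\<lambda>c t. ez 1 t * h c t) (\<phi> j) = 0"
  using frame by (simp add: wandering_frame_def)

lemma frame_orthonormal:
  "AE t in circ. \<forall>j<k. \<forall>l<k. (\<Sum>c<n. cnj (\<phi> j c t) * \<phi> l c t) = (if j = l then 1 else 0)"
  using frame by (simp add: wandering_frame_def)

lemma frame_bounded:
  assumes "j < k" "c < n"
  shows "AE t in circ. cmod (\<phi> j c t) \<le> 1"
  using frame_orthonormal
proof eventually_elim
  case (elim t)
  have "complex_of_real (\<Sum>c<n. (cmod (\<phi> j c t))\<^sup>2) = (\<Sum>c<n. cnj (\<phi> j c t) * \<phi> j c t)"
    by (simp only: of_real_sum complex_norm_square mult.commute)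
  also have "\<dots> = 1" using elim \<open>j < k\<close> by auto
  finally have "(\<Sum>c<n. (cmod (\<phi> j c t))\<^sup>2) = 1" by (simp only: of_real_eq_1_iff)
  moreover have "(cmod (\<phi> j c t))\<^sup>2 \<le> (\<Sum>c<n. (cmod (\<phi> j c t))\<^sup>2)"
    using assms(2) by (intro member_le_sum) auto
  ultimately show ?case by (simp add: power_le_one_iff abs_square_le_1)
qed

lemma frame_Hinf: "j < k \<Longrightarrow> c < n \<Longrightarrow> \<phi> j c \<in> Hinf"
  using M_H2[OF frame_mem] frame_bounded by (rule HinfI)

lemma frame_mult_L2: "j < k \<Longrightarrow> c < n \<Longrightarrow> g \<in> L2 \<Longrightarrow> (\<lambda>t. \<phi> j c t * g t) \<in> L2"
  by (rule L2_bounded_mult[OF L2_measurable[OF H2_L2[OF Hinf_H2[OF frame_Hinf]]] frame_bounded])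

lemma frame_cnj_mult_L2: "j < k \<Longrightarrow> c < n \<Longrightarrow> g \<in> L2 \<Longrightarrow> (\<lambda>t. cnj (\<phi> j c t) * g t) \<in> L2"
  using frame_bounded
  by (intro L2_bounded_mult[where B=1] borel_measurable_cnj L2_measurable[OF H2_L2[OF Hinf_H2[OF frame_Hinf]]]) auto

lemma frame_L2v_apply:
  assumes "\<And>j. j < k \<Longrightarrow> q j \<in> L2"
  shows "L2v n (\<lambda>c t. \<Sum>j<k. \<phi> j c t * q j t)"
  unfolding L2v_def using assms by (auto intro!: L2_sum frame_mult_L2)

lemma vinner_frame_apply:
  assumes "\<And>j. j < k \<Longrightarrow> q j \<in> L2" "L2v n w"
  shows "vinner n (\<lambda>c t. \<Sum>j<k. \<phi> j c t * q j t) w = (\<Sum>j<k. \<integral>t. q j t * (\<Sum>c<n. \<phi> j c t * cnj (w c t)) \<partial>circ)"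
proof -
  have "vinner n (\<lambda>c t. \<Sum>j<k. \<phi> j c t * q j t) w = (\<Sum>j<k. vinner n (\<lambda>c t. \<phi> j c t * q j t) w)"
    using assms by (intro vinner_sum_left) (auto simp: L2v_def intro!: frame_mult_L2)
  then show ?thesis unfolding vinner_def by (simp add: sum_distrib_left ac_simps)
qed

text \<open>Frame entries are bounded, so the pointwise pairing of \<open>\<phi> j\<close> with
  \<open>w\<close> is in L^2. It is annihilated by z^i for i \<ge> 0 because z^i times
  \<open>\<phi> j\<close> lies in M, and \<open>H2_annihilator\<close> passes from z^i to
  \<open>q j\<close>.\<close>

lemma frame_apply_mem:
  assumes q: "\<And>j. j < k \<Longrightarrow> q j \<in> H2"
  shows "(\<lambda>c t. \<Sum>j<k. \<phi> j c t * q j t) \<in> M"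
proof -
  have "vinner n (\<lambda>c t. \<Sum>j<k. \<phi> j c t * q j t) w = 0" if w: "w \<in> W" for w
  proof -
    have "(\<integral>t. q j t * (\<Sum>c<n. \<phi> j c t * cnj (w c t)) \<partial>circ) = 0" if j: "j < k" for j
    proof (rule H2_annihilator[OF q[OF j]])
      show "(\<lambda>t. \<Sum>c<n. \<phi> j c t * cnj (w c t)) \<in> L2"
        using W[OF w] j by (intro L2_sum frame_mult_L2 L2_cnj) (auto simp: L2v_def)
      fix i :: nat
      have "vinner n (\<lambda>c t. ez (int i) t * \<phi> j c t) w = 0"
        using M_shift[OF frame_mem[OF j], of i] w by (simp add: M_def orth_def)
      then show "(\<integral>t. ez (int i) t * (\<Sum>c<n. \<phi> j c t * cnj (w c t)) \<partial>circ) = 0"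
        unfolding vinner_def by (simp add: sum_distrib_left ac_simps)
    qed
    then show ?thesis using q H2_L2 W[OF w] by (subst vinner_frame_apply) auto
  qed
  then show ?thesis unfolding M_def orth_def using q H2_L2 frame_L2v_apply by auto
qed

text \<open>The coefficient at i < 0 is a pairing of z^(-i) h with \<open>\<phi> j\<close>, and
  z^(-i) h lies in zM.\<close>

lemma coef_H2:
  assumes h: "h \<in> M" and j: "j < k"
  shows "coef n \<phi> h j \<in> H2"
proof -
  have "coef n \<phi> h j \<in> L2" unfolding coef_def[abs_def]
    using M_L2v[OF h] j by (intro L2_sum frame_cnj_mult_L2) (auto simp: L2v_def)
  moreover have "fourier (coef n \<phi> h j) i = 0" if "i < 0" for i
  proof -
    have "vinner n (\<lambda>c t. ez 1 t * (ez (int (nat (-i-1))) t * h c t)) (\<phi> j) = 0"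
      by (rule frame_wandering[OF j M_shift[OF h]])
    moreover have "ez 1 t * (ez (int (nat (-i-1))) t * z) = ez (-i) t * z" for t z
      using that ez_mult[of 1 t "-i-1"] by (simp flip: mult.assoc)
    ultimately have "vinner n (\<lambda>c t. ez (-i) t * h c t) (\<phi> j) = 0" by (simp only:)
    then show ?thesis unfolding fourier_eq_0_iff coef_def vinner_def
      by (simp add: sum_distrib_left ac_simps)
  qed
  ultimately show ?thesis by (simp add: H2_def)
qed

lemma frame_shifts_L2v: "w \<in> (frame_shifts W k \<phi>) \<Longrightarrow> L2v n w"
  unfolding frame_shifts_def using W L2v_ez[OF M_L2v[OF frame_mem]] by auto

lemma frame_shifts_shift: "w \<in> (frame_shifts W k \<phi>) \<Longrightarrow> (\<lambda>c t. ez (-1) t * w c t) \<in> (frame_shifts W k \<phi>)"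
proof -
  assume "w \<in> (frame_shifts W k \<phi>)"
  then consider "w \<in> W" | i j where "w = (\<lambda>c t. ez i t * \<phi> j c t)" "j < k"
    unfolding frame_shifts_def by blast
  then show ?thesis
  proof cases
    case 2
    then have "(\<lambda>c t. ez (-1) t * w c t) = (\<lambda>c t. ez (-1 + i) t * \<phi> j c t)"
      by (simp add: ez_mult flip: mult.assoc)
    then show ?thesis unfolding frame_shifts_def using 2 by blast
  qed (auto simp: frame_shifts_def W_shift)
qed

lemma orth_frame_shifts_subset: "orth n (frame_shifts W k \<phi>) \<subseteq> M"
  unfolding M_def orth_def frame_shifts_def by blast

text \<open>Both h and \<Phi> \<Phi>^* h lie in M; \<Phi>^* annihilates their difference a.e.
  because \<Phi>^* \<Phi> = I, hence every shift of a column is orthogonal to it.\<close>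

lemma rest_mem:
  assumes h: "h \<in> M"
  shows "rest n k \<phi> h \<in> orth n (frame_shifts W k \<phi>)"
proof -
  have M: "rest n k \<phi> h \<in> M"
    unfolding rest_def M_def
    by (rule orth_diff[OF W h[unfolded M_def] frame_apply_mem[OF coef_H2[OF h], unfolded M_def]])
  have "vinner n (rest n k \<phi> h) (\<lambda>c t. ez i t * \<phi> j c t) = 0" if j: "j < k" for i j
  proof -
    have "AE t in circ. (\<Sum>c<n. rest n k \<phi> h c t * cnj (ez i t * \<phi> j c t)) = 0"
      using frame_orthonormal
    proof eventually_elim
      case (elim t)
      have "(\<Sum>c<n. rest n k \<phi> h c t * cnj (\<phi> j c t))
          = coef n \<phi> h j t - (\<Sum>c<n. \<Sum>l<k. cnj (\<phi> j c t) * \<phi> l c t * coef n \<phi> h l t)"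
        unfolding rest_def coef_def[of n \<phi> h j t] sum_subtractf[symmetric]
        by (intro sum.cong refl) (simp add: algebra_simps sum_distrib_left)
      also have "(\<Sum>c<n. \<Sum>l<k. cnj (\<phi> j c t) * \<phi> l c t * coef n \<phi> h l t)
          = (\<Sum>l<k. (\<Sum>c<n. cnj (\<phi> j c t) * \<phi> l c t) * coef n \<phi> h l t)"
        by (subst sum.swap) (simp add: sum_distrib_right)
      also have "\<dots> = (\<Sum>l<k. if l = j then coef n \<phi> h j t else 0)"
        using elim j by (intro sum.cong) auto
      also have "\<dots> = coef n \<phi> h j t" using j by simp
      finally have "(\<Sum>c<n. rest n k \<phi> h c t * cnj (\<phi> j c t)) = 0" by simp
      moreover have "(\<Sum>c<n. rest n k \<phi> h c t * cnj (ez i t * \<phi> j c t)) = ez (-i) t * (\<Sum>c<n. rest n k \<phi> h c t * cnj (\<phi> j c t))"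
        by (simp add: sum_distrib_left ac_simps)
      ultimately show ?case by simp
    qed
    then show ?thesis unfolding vinner_def by (rule integral_eq_zero_AE)
  qed
  then show ?thesis using M unfolding M_def orth_def frame_shifts_def by auto
qed

text \<open>Write M' for the subspace in question and let m be the least index at which some u in M'
  has a nonzero coefficient. Elements of zM' have coefficient 0 at m, so removing from u its
  projection onto the closure of zM' leaves that coefficient, and a nonzero vector.\<close>

lemma new_wandering_vector:
  assumes u0: "u0 \<in> orth n (frame_shifts W k \<phi>)" "c0 < n" "\<not> (AE t in circ. u0 c0 t = 0)"
  obtains \<psi> where "\<psi> \<in> orth n (frame_shifts W k \<phi>)" "vnorm n \<psi> > 0"
    "\<And>v. v \<in> orth n (frame_shifts W k \<phi>) \<Longrightarrow> vinner n \<psi> (\<lambda>c t. ez 1 t * v c t) = 0"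
proof -
  let ?M' = "orth n (frame_shifts W k \<phi>)"
  have M'H2: "u c \<in> H2" if "u \<in> ?M'" "c < n" for u c
    using that orth_frame_shifts_subset M_H2 by blast
  let ?P = "\<lambda>m::nat. \<exists>u\<in>?M'. \<exists>c<n. fourier (u c) (int m) \<noteq> 0"
  have "\<exists>m. ?P m"
  proof -
    have u0H: "u0 c0 \<in> H2" using u0 M'H2 by blast
    then obtain i where "fourier (u0 c0) i \<noteq> 0"
      using fourier_unique_L2[OF H2_L2[OF u0H]] u0(3) by blast
    moreover from this have "i \<ge> 0" using u0H by (force simp: H2_def)
    ultimately have "fourier (u0 c0) (int (nat i)) \<noteq> 0" by simp
    then show ?thesis using u0 by blast
  qed
  then obtain m where m: "?P m" "\<And>i. i < m \<Longrightarrow> \<not> ?P i"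
    using exists_least_iff[of ?P] by blast
  from m(1) obtain u c where u: "u \<in> ?M'" "c < n" "fourier (u c) (int m) \<noteq> 0" by blast
  \<comment> \<open>Index m - 1 of v is index m of zv. For m = 0 it is -1, where analyticity gives
    0.\<close>
  have low: "fourier (v c) (int m - 1) = 0" if "v \<in> ?M'" for v
  proof (cases m)
    case 0
    then show ?thesis using M'H2[OF that u(2)] by (simp add: H2_def)
  next
    case (Suc l)
    then show ?thesis using m(2)[of l] that u(2) by auto
  qed
  define V where "V = {\<lambda>c t. ez 1 t * v c t | v. v \<in> ?M'}"
  have M'L2v: "v \<in> ?M' \<Longrightarrow> L2v n v" for v by (simp add: orth_def)
  have V_L2v: "L2v n v" if "v \<in> V" for v using that M'L2v unfolding V_def by (auto intro: L2v_ez)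
  have V_ne: "V \<noteq> {}" unfolding V_def using u(1) by blast
  have V_lin: "(\<lambda>c t. v c t + a * w c t) \<in> V" if v: "v \<in> V" and w: "w \<in> V" for v w a
  proof -
    from v w obtain v' w' where *: "v = (\<lambda>c t. ez 1 t * v' c t)" "w = (\<lambda>c t. ez 1 t * w' c t)" "v' \<in> ?M'" "w' \<in> ?M'"
      unfolding V_def by blast
    have "(\<lambda>c t. v c t + a * w c t) = (\<lambda>c t. ez 1 t * (v' c t + a * w' c t))"
      unfolding * by (simp add: algebra_simps)
    moreover have "(\<lambda>c t. v' c t + a * w' c t) \<in> ?M'"
      by (rule orth_lin[OF frame_shifts_L2v *(3,4)])
    ultimately show ?thesis unfolding V_def mem_Collect_eq
      by (intro exI[of _ "\<lambda>c t. v' c t + a * w' c t"]) simp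
  qed
  obtain \<psi> v where P: "L2v n \<psi>" "\<And>i. v i \<in> V"
    "(\<lambda>i. vnorm n (\<lambda>c t. (u c t - v i c t) - \<psi> c t)) \<longlonglongrightarrow> 0"
    "\<And>w. w \<in> V \<Longrightarrow> vinner n \<psi> w = 0"
    using orthogonal_projection[OF V_L2v V_ne V_lin M'L2v[OF u(1)]] by blast
  from P(2) have "\<forall>i. \<exists>v'. v i = (\<lambda>c t. ez 1 t * v' c t) \<and> v' \<in> ?M'" unfolding V_def by blast
  from choice[OF this] obtain v' where v': "\<And>i. v i = (\<lambda>c t. ez 1 t * v' i c t)" "\<And>i. v' i \<in> ?M'"
    by blast
  have x: "(\<lambda>c t. u c t - v i c t) \<in> ?M'" for i
    unfolding v' using orth_diff[OF frame_shifts_L2v u(1) orth_shift[OF frame_shifts_shift v'(2), of 1]] by simp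
  have \<psi>: "\<psi> \<in> ?M'" by (rule orth_limit[OF frame_shifts_L2v x P(1,3)])
  have "(\<lambda>i. vinner n (\<lambda>c t. u c t - v i c t) (\<lambda>d t. if d = c then ez (int m) t else 0))
      \<longlonglongrightarrow> vinner n \<psi> (\<lambda>d t. if d = c then ez (int m) t else 0)"
    by (rule vinner_tendsto[OF M'L2v[OF x] P(1) L2v_unit P(3)])
  moreover have "vinner n (\<lambda>c t. u c t - v i c t) (\<lambda>d t. if d = c then ez (int m) t else 0)
      = of_real (2*pi) * fourier (u c) (int m)" for i
    unfolding v' using low[OF v'(2)]
    by (subst vinner_diff_left[OF M'L2v[OF u(1)] L2v_ez[OF M'L2v[OF v'(2)]] L2v_unit])
      (simp add: vinner_unit[OF u(2)] fourier_ez_mult)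
  ultimately have "vinner n \<psi> (\<lambda>d t. if d = c then ez (int m) t else 0) = of_real (2*pi) * fourier (u c) (int m)"
    by (simp add: LIMSEQ_const_iff)
  then have "vinner n \<psi> (\<lambda>d t. if d = c then ez (int m) t else 0) \<noteq> 0" using u(3) by simp
  then have "vnorm n \<psi> \<noteq> 0"
    using Cauchy_Schwarz_vinner[OF P(1) L2v_unit, of c "int m"] by auto
  then have "vnorm n \<psi> > 0" using vnorm_nonneg[of n \<psi>] by linarith
  moreover have "vinner n \<psi> (\<lambda>c t. ez 1 t * v c t) = 0" if "v \<in> ?M'" for v
    using P(4) that unfolding V_def by blast
  ultimately show ?thesis using that \<psi> by blast
qed

lemma frame_extend:
  assumes h0: "h0 \<in> M" "c0 < n" "\<not> (AE t in circ. rest n k \<phi> h0 c0 t = 0)"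
  shows "\<exists>\<phi>'. wandering_frame n M (Suc k) \<phi>'"
proof -
  obtain \<psi> where \<psi>: "\<psi> \<in> orth n (frame_shifts W k \<phi>)" "vnorm n \<psi> > 0"
    "\<And>v. v \<in> orth n (frame_shifts W k \<phi>) \<Longrightarrow> vinner n \<psi> (\<lambda>c t. ez 1 t * v c t) = 0"
    using new_wandering_vector[OF rest_mem[OF h0(1)] h0(2,3)] by blast
  have L: "L2v n \<psi>" using \<psi>(1) by (simp add: orth_def)
  \<comment> \<open>The a.e. constant value of the squared pointwise norm of \<open>\<psi>\<close>;
    dividing by its root gives a unit column.\<close>
  define C where "C = (vnorm n \<psi>)\<^sup>2 / (2*pi)"
  have C: "C > 0" using \<psi>(2) by (simp add: C_def)
  have "vinner n (\<lambda>c t. ez i t * \<psi> c t) \<psi> = 0" if "i > 0" for i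
  proof -
    have "vinner n \<psi> (\<lambda>c t. ez 1 t * (ez (int (nat (i - 1))) t * \<psi> c t)) = 0"
      by (rule \<psi>(3)) (rule orth_shift[OF frame_shifts_shift \<psi>(1)])
    moreover have "ez 1 t * (ez (int (nat (i-1))) t * z) = ez i t * z" for t z
      using that ez_mult[of 1 t "i-1"] by (simp flip: mult.assoc)
    ultimately have "vinner n \<psi> (\<lambda>c t. ez i t * \<psi> c t) = 0" by (simp only:)
    then show ?thesis by (simp add: vinner_commute[of n _ \<psi>])
  qed
  from pointwise_norm_const[OF L this]
  have norm: "AE t in circ. (\<Sum>c<n. (cmod (\<psi> c t))\<^sup>2) = C" by (simp add: C_def)
  have perp: "AE t in circ. (\<Sum>c<n. \<phi> j c t * cnj (\<psi> c t)) = 0" if j: "j < k" for j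
  proof -
    have "vinner n \<psi> (\<lambda>c t. ez i t * \<phi> j c t) = 0" for i
      using \<psi>(1) j by (auto simp: orth_def frame_shifts_def)
    then have 0: "vinner n (\<lambda>c t. ez i t * \<phi> j c t) \<psi> = 0" for i
      by (simp add: vinner_commute[of n _ \<psi>])
    from pointwise_vinner_const[OF M_L2v[OF frame_mem[OF j]] L this] 0[of 0]
    show ?thesis by simp
  qed
  define \<psi>' where "\<psi>' = (\<lambda>c t. of_real (1 / sqrt C) * \<psi> c t)"
  have \<psi>'M: "\<psi>' \<in> M"
  proof -
    have "\<psi>' \<in> orth n (frame_shifts W k \<phi>)"
      using \<psi>(1) L2v_cmult[of n \<psi>] unfolding \<psi>'_def orth_def by (simp only: mem_Collect_eq vinner_cmult_left) simp
    then show ?thesis using orth_frame_shifts_subset by blast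
  qed
  \<comment> \<open>So far \<open>\<psi>\<close> is orthogonal only to z times vectors of M that are
    pointwise orthogonal to the frame. For general \<open>h\<close> the rest of zh is a pointwise
    combination of the \<open>\<phi> j\<close>, and \<open>perp\<close> removes it.\<close>
  have wander: "vinner n (\<lambda>c t. ez 1 t * h c t) \<psi>' = 0" if h: "h \<in> M" for h
  proof -
    let ?q = "coef n \<phi> h"
    have qL: "?q j \<in> L2" if "j < k" for j using coef_H2[OF h that] by (rule H2_L2)
    have "(\<lambda>c t. ez 1 t * h c t) = (\<lambda>c t. ez 1 t * rest n k \<phi> h c t + (\<Sum>j<k. \<phi> j c t * (ez 1 t * ?q j t)))"
      by (simp add: rest_def algebra_simps sum_distrib_left)
    moreover have "vinner n (\<lambda>c t. ez 1 t * rest n k \<phi> h c t + (\<Sum>j<k. \<phi> j c t * (ez 1 t * ?q j t))) \<psi>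
       = vinner n (\<lambda>c t. ez 1 t * rest n k \<phi> h c t) \<psi> + vinner n (\<lambda>c t. \<Sum>j<k. \<phi> j c t * (ez 1 t * ?q j t)) \<psi>"
      using rest_mem[OF h] qL L by (intro vinner_add_left L2v_ez frame_L2v_apply L2_ez_mult) (auto simp: orth_def)
    moreover have "vinner n (\<lambda>c t. ez 1 t * rest n k \<phi> h c t) \<psi> = 0"
      using \<psi>(3)[OF rest_mem[OF h]] by (simp add: vinner_commute[of n _ \<psi>])
    moreover have "vinner n (\<lambda>c t. \<Sum>j<k. \<phi> j c t * (ez 1 t * ?q j t)) \<psi> = 0"
    proof -
      have "(\<integral>t. ez 1 t * ?q j t * (\<Sum>c<n. \<phi> j c t * cnj (\<psi> c t)) \<partial>circ) = 0" if "j < k" for j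
        using perp[OF that] by (intro integral_eq_zero_AE) (auto elim: eventually_mono)
      then show ?thesis using qL L2_ez_mult L by (subst vinner_frame_apply) auto
    qed
    ultimately have "vinner n \<psi> (\<lambda>c t. ez 1 t * h c t) = 0"
      by (simp add: vinner_commute[of n \<psi>])
    then have "vinner n \<psi>' (\<lambda>c t. ez 1 t * h c t) = 0"
      unfolding \<psi>'_def vinner_cmult_left by simp
    then show ?thesis by (simp add: vinner_commute[of n _ \<psi>'])
  qed
  have "AE t in circ. \<forall>j\<in>{..<k}. (\<Sum>c<n. \<phi> j c t * cnj (\<psi> c t)) = 0"
    using perp by (intro AE_finite_allI) auto
  with frame_orthonormal norm
  have "AE t in circ. \<forall>j<Suc k. \<forall>l<Suc k. (\<Sum>c<n. cnj ((\<phi>(k := \<psi>')) j c t) * (\<phi>(k := \<psi>')) l c t) = (if j = l then 1 else 0)"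
  proof eventually_elim
    case (elim t)
    have 1: "(\<Sum>c<n. cnj (\<psi>' c t) * \<psi>' c t) = 1"
    proof -
      have "(\<Sum>c<n. cnj (\<psi>' c t) * \<psi>' c t) = of_real (\<Sum>c<n. (cmod (\<psi>' c t))\<^sup>2)"
        by (simp only: of_real_sum complex_norm_square mult.commute)
      also have "(\<Sum>c<n. (cmod (\<psi>' c t))\<^sup>2) = (\<Sum>c<n. (cmod (\<psi> c t))\<^sup>2) / C"
        using C unfolding \<psi>'_def by (simp add: norm_mult norm_divide power_divide sum_divide_distrib)
      finally show ?thesis using elim C by simp
    qed
    have 2: "(\<Sum>c<n. cnj (\<psi>' c t) * \<phi> j c t) = 0" if "j < k" for j
    proof -
      have "(\<Sum>c<n. cnj (\<psi>' c t) * \<phi> j c t) = of_real (1 / sqrt C) * (\<Sum>c<n. \<phi> j c t * cnj (\<psi> c t))"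
        unfolding \<psi>'_def by (simp add: sum_distrib_left ac_simps)
      then show ?thesis using elim that by simp
    qed
    have 3: "(\<Sum>c<n. cnj (\<phi> j c t) * \<psi>' c t) = 0" if "j < k" for j
      using arg_cong[OF 2[OF that], of cnj] by (simp add: mult.commute)
    show ?case using elim 1 2 3 by (auto simp: less_Suc_eq)
  qed
  moreover have "\<forall>j<Suc k. (\<phi>(k := \<psi>')) j \<in> M" using \<psi>'M frame_mem by auto
  moreover have "\<forall>j<Suc k. \<forall>h\<in>M. vinner n (\<lambda>c t. ez 1 t * h c t) ((\<phi>(k := \<psi>')) j) = 0"
    using wander frame_wandering by (simp add: less_Suc_eq)
  ultimately show ?thesis unfolding wandering_frame_def by blast
qed

text \<open>\<Phi>^* is a left inverse of \<Phi> at almost every point, so even the pointwise kernel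
  is zero.\<close>

lemma frame_rows_inj: "rows_inj_Nev k {..<n} (\<lambda>c j. \<phi> j c)"
  unfolding rows_inj_Nev_def
proof (intro allI impI)
  fix h :: "nat \<Rightarrow> real \<Rightarrow> complex" and j
  assume 0: "\<forall>i\<in>{..<n}. AE t in circ. (\<Sum>j<k. \<phi> j i t * h j t) = 0" and j: "j < k"
  from 0 have "AE t in circ. \<forall>i\<in>{..<n}. (\<Sum>j<k. \<phi> j i t * h j t) = 0" by (intro AE_finite_allI) auto
  with frame_orthonormal show "AE t in circ. h j t = 0"
  proof eventually_elim
    case (elim t)
    have "0 = (\<Sum>i<n. cnj (\<phi> j i t) * (\<Sum>l<k. \<phi> l i t * h l t))" using elim by simp
    also have "\<dots> = (\<Sum>i<n. \<Sum>l<k. cnj (\<phi> j i t) * \<phi> l i t * h l t)" by (simp add: sum_distrib_left ac_simps)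
    also have "\<dots> = (\<Sum>l<k. (\<Sum>i<n. cnj (\<phi> j i t) * \<phi> l i t) * h l t)"
      by (subst sum.swap) (simp add: sum_distrib_right)
    also have "\<dots> = (\<Sum>l<k. if l = j then h j t else 0)" using elim j by (intro sum.cong) auto
    also have "\<dots> = h j t" using j by simp
    finally show ?case by simp
  qed
qed

text \<open>Row selection finds k distinct rows among n; this stops the growth of frames.\<close>

lemma frame_card_le: "k \<le> n"
proof -
  obtain I0 where "I0 \<subseteq> {..<n}" "card I0 = k"
    using rows_inj_Nev_subset[OF finite_lessThan _ frame_rows_inj] Hinf_Nev[OF frame_Hinf] by (metis lessThan_iff)
  then show ?thesis using card_mono[of "{..<n}" I0] by simp
qed

end

theorem Beurling_Lax:
  obtains k \<Theta> where "inner_matrix n k \<Theta>" "k \<le> n" "rows_inj_Nev k {..<n} \<Theta>"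
    "\<And>j. j < k \<Longrightarrow> (\<lambda>c. \<Theta> c j) \<in> M"
    "\<forall>q. (\<forall>j<k. q j \<in> H2) \<longrightarrow> (\<lambda>c t. \<Sum>j<k. \<Theta> c j t * q j t) \<in> M"
    "\<And>h. h \<in> M \<Longrightarrow> \<exists>q. (\<forall>j<k. q j \<in> H2) \<and> (\<forall>c<n. AE t in circ. h c t = (\<Sum>j<k. \<Theta> c j t * q j t))"
proof -
  \<comment> \<open>Were something left over for every frame, each could be extended, up to one with
    n + 1 vectors.\<close>
  have "\<exists>k \<phi>. wandering_frame n M k \<phi> \<and> (\<forall>h\<in>M. \<forall>c<n. AE t in circ. (rest n k \<phi> h) c t = 0)"
  proof (rule ccontr)
    assume contr: "\<not> ?thesis"
    have "\<exists>\<phi>. wandering_frame n M k \<phi>" for k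
    proof (induction k)
      case 0
      then show ?case by (simp add: wandering_frame_def)
    next
      case (Suc k)
      then obtain \<phi> where \<phi>: "wandering_frame n M k \<phi>" ..
      with contr obtain h c where "h \<in> M" "c < n" "\<not> (AE t in circ. (rest n k \<phi> h) c t = 0)" by blast
      then show ?case by (rule frame_extend[OF \<phi>])
    qed
    then obtain \<phi> where "wandering_frame n M (Suc n) \<phi>" by blast
    from frame_card_le[OF this] show False by simp
  qed
  then obtain k \<phi> where \<phi>: "wandering_frame n M k \<phi>" and
    full: "\<And>h c. h \<in> M \<Longrightarrow> c < n \<Longrightarrow> AE t in circ. (rest n k \<phi> h) c t = 0" by blast
  show ?thesis
  proof (rule that[of k "\<lambda>c j. \<phi> j c"])
    show "inner_matrix n k (\<lambda>c j. \<phi> j c)"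
      unfolding inner_matrix_def using frame_Hinf[OF \<phi>] frame_orthonormal[OF \<phi>] by auto
    show "k \<le> n" by (rule frame_card_le[OF \<phi>])
    show "rows_inj_Nev k {..<n} (\<lambda>c j. \<phi> j c)" by (rule frame_rows_inj[OF \<phi>])
    show "(\<lambda>c. \<phi> j c) \<in> M" if "j < k" for j using frame_mem[OF \<phi> that] by simp
    show "\<forall>q. (\<forall>j<k. q j \<in> H2) \<longrightarrow> (\<lambda>c t. \<Sum>j<k. \<phi> j c t * q j t) \<in> M"
      using frame_apply_mem[OF \<phi>] by blast
    show "\<exists>q. (\<forall>j<k. q j \<in> H2) \<and> (\<forall>c<n. AE t in circ. h c t = (\<Sum>j<k. \<phi> j c t * q j t))" if h: "h \<in> M" for h
    proof (intro exI[of _ "coef n \<phi> h"] conjI allI impI)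
      show "coef n \<phi> h j \<in> H2" if "j < k" for j by (rule coef_H2[OF \<phi> h that])
      fix c assume "c < n"
      from full[OF h this] show "AE t in circ. h c t = (\<Sum>j<k. \<phi> j c t * coef n \<phi> h j t)"
        by eventually_elim (simp add: rest_def)
    qed
  qed
qed

end

section \<open>The backward shift and the rank computation\<close>

lemma bshift_ez: "bshift g = (\<lambda>c t. ez (-1) t * (g c t - fourier (g c) 0))"
  by (simp add: bshift_def ez_def cis_conv_exp)

lemma fourier_const_0: "fourier (\<lambda>_. a) 0 = a"
  by (simp add: fourier_ez circ_def measure_restrict_space scaleR_conv_of_real)

lemma bshift_H2vec:
  assumes g: "g \<in> H2vec n"
  shows "bshift g \<in> H2vec n"
proof -
  have "bshift g c \<in> H2" if "c < n" for c
  proof -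
    have gc: "g c \<in> H2" using g that by (simp add: H2vec_def)
    let ?a = "fourier (g c) 0"
    have "fourier (\<lambda>t. ez (-1) t * (g c t - ?a)) k = 0" if "k < 0" for k
    proof -
      have "fourier (\<lambda>t. ez (-1) t * (g c t - ?a)) k = fourier (\<lambda>t. g c t + - ?a) (k + 1)"
        unfolding fourier_ez_mult by simp
      also have "\<dots> = fourier (g c) (k + 1) + fourier (\<lambda>_. - ?a) (k + 1)"
        using L2_integrable[OF H2_L2[OF gc]] L2_integrable[OF L2_const] by (rule fourier_add)
      \<comment> \<open>At k = -1 the coefficient of index 0 appears, and the subtracted constant
        cancels it.\<close>
      also have "\<dots> = 0"
        using that gc by (cases "k + 1 = 0") (auto simp: fourier_const_0 fourier_const H2_def)
      finally show ?thesis .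
    qed
    then show ?thesis unfolding bshift_ez H2_def
      using L2_ez_mult[OF L2_diff[OF H2_L2[OF gc] L2_const]] by auto
  qed
  moreover have "bshift g c = (\<lambda>_. 0)" if "c \<ge> n" for c
  proof -
    have "g c = (\<lambda>_. 0)" using g that by (simp add: H2vec_def)
    then show ?thesis by (simp add: bshift_ez fourier_const_0)
  qed
  ultimately show ?thesis by (simp add: H2vec_def)
qed

lemma bshift_pow_H2vec: "g \<in> H2vec n \<Longrightarrow> (bshift ^^ k) g \<in> H2vec n"
  by (induction k) (auto intro: bshift_H2vec)

lemma H2vec_L2v: "g \<in> H2vec n \<Longrightarrow> L2v n g"
  by (auto simp: H2vec_def L2v_def intro: H2_L2)

text \<open>Subtracting the constant contributes a multiple of the coefficient of \<open>h\<close>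
  at -1, which is 0 for H^2.\<close>

lemma vinner_bshift:
  assumes h: "\<And>c. c < n \<Longrightarrow> h c \<in> H2" and g: "g \<in> H2vec n"
  shows "vinner n h (bshift g) = vinner n (\<lambda>c t. ez 1 t * h c t) g"
proof -
  have hL: "L2v n h" using h H2_L2 by (auto simp: L2v_def)
  have "(\<integral>t. h c t * cnj (bshift g c t) \<partial>circ) = (\<integral>t. ez 1 t * h c t * cnj (g c t) \<partial>circ)" if c: "c < n" for c
  proof -
    have gL: "g c \<in> L2" using H2vec_L2v[OF g] c by (simp add: L2v_def)
    have hc: "h c \<in> L2" using hL c by (simp add: L2v_def)
    let ?a = "cnj (fourier (g c) 0)"
    have "(\<integral>t. h c t * cnj (bshift g c t) \<partial>circ)
        = (\<integral>t. ez 1 t * h c t * cnj (g c t) - ?a * (h c t * ez (- (-1)) t) \<partial>circ)"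
      unfolding bshift_ez by (simp add: algebra_simps)
    also have "\<dots> = (\<integral>t. ez 1 t * h c t * cnj (g c t) \<partial>circ) - (\<integral>t. ?a * (h c t * ez (- (-1)) t) \<partial>circ)"
      by (rule Bochner_Integration.integral_diff[OF L2_mult[OF L2_ez_mult[OF hc] L2_cnj[OF gL]]
          L2_integrable[OF L2_cmult]]) (use L2_ez_mult[OF hc, of 1] in \<open>simp add: mult.commute\<close>)
    also have "(\<integral>t. ?a * (h c t * ez (- (-1)) t) \<partial>circ) = 0"
      using h[OF c] unfolding H2_def fourier_eq_0_iff integral_mult_right_zero by (simp del: minus_minus)
    finally show ?thesis by simp
  qed
  then show ?thesis
    using vinner_eq_sum[OF hL H2vec_L2v[OF bshift_H2vec[OF g]]] vinner_eq_sum[OF L2v_ez[OF hL] H2vec_L2v[OF g], of 1]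
    by simp
qed

text \<open>The two right-hand vectors differ only in negative frequencies, which H^2 does not see;
  this lets \<open>annihilators\<close> avoid \<open>bshift\<close>. \<open>h\<close> is generalised
  because each step moves a factor z onto it.\<close>

lemma vinner_bshift_pow:
  assumes "\<And>c. c < n \<Longrightarrow> h c \<in> H2" and g: "g \<in> H2vec n"
  shows "vinner n h ((bshift ^^ k) g) = vinner n h (\<lambda>c t. ez (- int k) t * g c t)"
  using assms(1)
proof (induction k arbitrary: h)
  case 0
  then show ?case by simp
next
  case (Suc k)
  have "vinner n h ((bshift ^^ Suc k) g) = vinner n (\<lambda>c t. ez 1 t * h c t) ((bshift ^^ k) g)"
    using vinner_bshift[OF Suc.prems bshift_pow_H2vec[OF g]] by simp
  also have "\<dots> = vinner n (\<lambda>c t. ez 1 t * h c t) (\<lambda>c t. ez (- int k) t * g c t)"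
    using Suc.prems by (intro Suc.IH H2_ez_mult) auto
  also have "\<dots> = vinner n h (\<lambda>c t. ez (- 1) t * (ez (- int k) t * g c t))"
    by (rule vinner_ez_left)
  also have "(\<lambda>c t. ez (- 1) t * (ez (- int k) t * g c t)) = (\<lambda>c t. ez (- int (Suc k)) t * g c t)"
    by (simp add: ez_mult flip: mult.assoc)
  finally show ?case .
qed

text \<open>Orthogonality to these vectors cuts out \<open>H\<^sup>2 \<ominus> E\<^sup>*\<^sub>A\<close>, described without the backward shift
  so that invariance under multiplication by \<open>z\<close> is evident.\<close>

definition annihilators :: "nat \<Rightarrow> nat \<Rightarrow> (nat \<Rightarrow> nat \<Rightarrow> real \<Rightarrow> complex) \<Rightarrow> (nat \<Rightarrow> real \<Rightarrow> complex) set" where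
  "annihilators n s f = {\<lambda>d t. if d = c then ez k t else 0 | c k. c < n \<and> k < 0} \<union>
     {\<lambda>c t. ez (- int k) t * f i c t | k i. i < s}"

section \<open>The complement of E^*_A and the rank of F^*\<close>

context
  fixes n s :: nat and f :: "nat \<Rightarrow> nat \<Rightarrow> real \<Rightarrow> complex"
  assumes f: "\<forall>i<s. f i \<in> H2vec n"
begin

lemma annihilators_L2v: "w \<in> annihilators n s f \<Longrightarrow> L2v n w"
  unfolding annihilators_def using f L2v_unit L2v_ez[OF H2vec_L2v] by auto

lemma annihilators_shift:
  assumes "w \<in> annihilators n s f"
  shows "(\<lambda>c t. ez (-1) t * w c t) \<in> annihilators n s f"
proof -
  from assms consider
    (u) c k where "w = (\<lambda>d t. if d = c then ez k t else 0)" "c < n" "k < 0" |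
    (f) k i where "w = (\<lambda>c t. ez (- int k) t * f i c t)" "i < s"
    unfolding annihilators_def by blast
  then show ?thesis
  proof cases
    case u
    then have "(\<lambda>d t. ez (-1) t * w d t) = (\<lambda>d t. if d = c then ez (-1 + k) t else 0)"
      by (auto simp: ez_mult fun_eq_iff)
    moreover have "-1 + k < 0" using u by simp
    ultimately show ?thesis unfolding annihilators_def using u(2) by blast
  next
    case f
    then have "(\<lambda>c t. ez (-1) t * w c t) = (\<lambda>c t. ez (- int (Suc k)) t * f i c t)"
      by (simp add: ez_mult flip: mult.assoc)
    then show ?thesis unfolding annihilators_def using f(2) by blast
  qed
qed

lemma mem_orth_annihilators_iff:
  "h \<in> orth n (annihilators n s f) \<longleftrightarrow> (\<forall>c<n. h c \<in> H2) \<and>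
     (\<forall>i<s. \<forall>k. vinner n h (\<lambda>c t. ez (- int k) t * f i c t) = 0)" (is "?L \<longleftrightarrow> ?R")
proof
  assume L: ?L
  have "h c \<in> H2" if c: "c < n" for c
  proof -
    have "fourier (h c) k = 0" if "k < 0" for k
    proof -
      have "(\<lambda>d t. if d = c then ez k t else 0) \<in> annihilators n s f"
        unfolding annihilators_def using c that by blast
      then have "vinner n h (\<lambda>d t. if d = c then ez k t else 0) = 0" using L by (simp add: orth_def)
      then show ?thesis by (simp add: vinner_unit[OF c])
    qed
    moreover have "h c \<in> L2" using L c by (simp add: orth_def L2v_def)
    ultimately show ?thesis by (simp add: H2_def)
  qed
  moreover have "vinner n h (\<lambda>c t. ez (- int k) t * f i c t) = 0" if "i < s" for i k
  proof -
    have "(\<lambda>c t. ez (- int k) t * f i c t) \<in> annihilators n s f" unfolding annihilators_def using that by blast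
    then show ?thesis using L by (simp add: orth_def)
  qed
  ultimately show ?R by blast
next
  assume R: ?R
  have "vinner n h w = 0" if "w \<in> annihilators n s f" for w
  proof -
    from that consider
      (u) c k where "w = (\<lambda>d t. if d = c then ez k t else 0)" "c < n" "k < 0" |
      (f) k i where "w = (\<lambda>c t. ez (- int k) t * f i c t)" "i < s"
      unfolding annihilators_def by blast
    then show ?thesis
    proof cases
      case u
      then show ?thesis using R by (simp add: vinner_unit H2_def)
    qed (use R in simp)
  qed
  moreover have "L2v n h" using R H2_L2 by (auto simp: L2v_def)
  ultimately show ?L by (simp add: orth_def)
qed

lemma orth_annihilators_bshift:
  assumes "h \<in> orth n (annihilators n s f)" "i < s"
  shows "vinner n h ((bshift ^^ k) (f i)) = 0"
  using assms f vinner_bshift_pow[of n h "f i" k] unfolding mem_orth_annihilators_iff by auto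

text \<open>A vector of \<open>Estar\<close> is approximated by combinations orthogonal to M.
  Conversely, the residual \<open>\<phi>\<close> of g off the span lies in M; g and all combinations
  are orthogonal to it, so its squared norm, a limit of such pairings, is 0.\<close>

lemma Estar_eq_H2_ominus:
  assumes M: "M = orth n (annihilators n s f)"
    and sub: "\<And>q. (\<And>j. j < k \<Longrightarrow> q j \<in> H2) \<Longrightarrow> (\<lambda>c t. \<Sum>j<k. \<Theta> c j t * q j t) \<in> M"
    and rep: "\<And>h. h \<in> M \<Longrightarrow> \<exists>q. (\<forall>j<k. q j \<in> H2) \<and> (\<forall>c<n. AE t in circ. h c t = (\<Sum>j<k. \<Theta> c j t * q j t))"
  shows "Estar n s f = H2_ominus n k \<Theta>"
proof (intro equalityI subsetI)
  \<comment> \<open>\<open>mat_apply\<close> cuts off components of index \<ge> n, which the inner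
    product ignores; M is described with the uncut product.\<close>
  have apply_eq: "vinner n g (mat_apply n k \<Theta> h) = vinner n g (\<lambda>c t. \<Sum>j<k. \<Theta> c j t * h j t)" for g h
    unfolding vinner_def mat_apply_def by (intro Bochner_Integration.integral_cong sum.cong) auto
  have fL: "L2v n ((bshift ^^ l) (f i))" if "i < s" for l i
    using bshift_pow_H2vec[of "f i" n l] f that by (intro H2vec_L2v) auto
  let ?comb = "\<lambda>K a c t. \<Sum>l\<le>K. \<Sum>i<s. a l i * (bshift ^^ l) (f i) c t"
  have comb_L: "L2v n (?comb K a)" for K a by (intro L2v_sum L2v_cmult fL) auto
  have comb_0: "vinner n (?comb K a) m = 0" if "m \<in> M" for K a m
  proof -
    have mL: "L2v n m" using that by (simp add: M orth_def)
    have "vinner n (?comb K a) m = (\<Sum>l\<le>K. vinner n (\<lambda>c t. \<Sum>i<s. a l i * (bshift ^^ l) (f i) c t) m)"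
      by (rule vinner_sum_left[OF _ mL]) (intro L2v_sum L2v_cmult fL, auto)
    also have "\<dots> = (\<Sum>l\<le>K. \<Sum>i<s. vinner n (\<lambda>c t. a l i * (bshift ^^ l) (f i) c t) m)"
      by (intro sum.cong refl vinner_sum_left[OF _ mL] L2v_cmult fL) auto
    also have "\<dots> = 0"
      using orth_annihilators_bshift that unfolding M vinner_cmult_left vinner_commute[of n _ m]
      by (intro sum.neutral ballI) simp
    finally show ?thesis .
  qed
  fix g
  {
    assume g: "g \<in> Estar n s f"
    then have gH: "g \<in> H2vec n" by (simp add: Estar_def)
    have "vinner n g (mat_apply n k \<Theta> h) = 0" if h: "h \<in> H2vec k" for h
    proof -
      define m where "m = (\<lambda>c t. \<Sum>j<k. \<Theta> c j t * h j t)"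
      have m: "m \<in> M" unfolding m_def using h by (intro sub) (auto simp: H2vec_def)
      then have mL: "L2v n m" by (simp add: M orth_def)
      have "cmod (vinner n g m) \<le> e" if "e > 0" for e
      proof -
        have "e / (vnorm n m + 1) > 0" using that vnorm_nonneg[of n m] by simp
        with g obtain K a where Ka: "vnorm n (\<lambda>c t. g c t - ?comb K a c t) < e / (vnorm n m + 1)"
          unfolding Estar_def by blast
        have "vinner n g m = vinner n (\<lambda>c t. g c t - ?comb K a c t) m"
          unfolding vinner_diff_left[OF H2vec_L2v[OF gH] comb_L mL] comb_0[OF m] by simp
        then have "cmod (vinner n g m) \<le> vnorm n (\<lambda>c t. g c t - ?comb K a c t) * vnorm n m"
          using Cauchy_Schwarz_vinner[OF L2v_diff[OF H2vec_L2v[OF gH] comb_L] mL] by simp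
        also have "\<dots> \<le> e / (vnorm n m + 1) * (vnorm n m + 1)"
          using Ka vnorm_nonneg[of n m] \<open>e > 0\<close> by (intro mult_mono vnorm_nonneg) auto
        also have "\<dots> = e" using vnorm_nonneg[of n m] by simp
        finally show ?thesis .
      qed
      then have "cmod (vinner n g m) \<le> 0" by (rule field_le_epsilon[of _ 0, simplified])
      then show ?thesis unfolding apply_eq m_def by simp
    qed
    with gH show "g \<in> H2_ominus n k \<Theta>" by (simp add: H2_ominus_def)
  }
  {
    assume g: "g \<in> H2_ominus n k \<Theta>"
    then have gH: "g \<in> H2vec n" by (simp add: H2_ominus_def)
    have gL: "L2v n g" by (rule H2vec_L2v[OF gH])
    obtain \<phi> K a where P: "L2v n \<phi>"
      "(\<lambda>m. vnorm n (\<lambda>c t. (g c t - ?comb (K m) (a m) c t) - \<phi> c t)) \<longlonglongrightarrow> 0"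
      "\<And>l i. i < s \<Longrightarrow> vinner n \<phi> ((bshift ^^ l) (f i)) = 0"
      by (rule span_projection[where w="\<lambda>l i. (bshift ^^ l) (f i)" and s=s, OF fL gL]) (assumption, rule that)
    have xL: "L2v n (\<lambda>c t. g c t - ?comb (K m) (a m) c t)" for m by (rule L2v_diff[OF gL comb_L])
    have xH: "(\<lambda>t. g c t - ?comb (K m) (a m) c t) \<in> H2" if "c < n" for c m
      using gH bshift_pow_H2vec f that by (intro H2_diff H2_sum H2_cmult) (auto simp: H2vec_def)
    have \<phi>H: "\<phi> c \<in> H2" if c: "c < n" for c
    proof -
      have "fourier (\<phi> c) i = 0" if "i < 0" for i
      proof -
        have "(\<lambda>m. vinner n (\<lambda>c t. g c t - ?comb (K m) (a m) c t) (\<lambda>d t. if d = c then ez i t else 0))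
            \<longlonglongrightarrow> vinner n \<phi> (\<lambda>d t. if d = c then ez i t else 0)"
          by (rule vinner_tendsto[OF xL P(1) L2v_unit P(2)])
        moreover have "vinner n (\<lambda>c t. g c t - ?comb (K m) (a m) c t) (\<lambda>d t. if d = c then ez i t else 0) = 0" for m
          unfolding vinner_unit[OF c] using xH[OF c, of m] that by (simp add: H2_def)
        ultimately show ?thesis unfolding vinner_unit[OF c] by (simp add: LIMSEQ_const_iff)
      qed
      then show ?thesis using P(1) c by (simp add: H2_def L2v_def)
    qed
    have \<phi>M: "\<phi> \<in> M"
      unfolding M mem_orth_annihilators_iff
      using \<phi>H P(3) vinner_bshift_pow[OF \<phi>H] f by auto
    obtain q where q: "\<And>j. j < k \<Longrightarrow> q j \<in> H2" "\<And>c. c < n \<Longrightarrow> AE t in circ. \<phi> c t = (\<Sum>j<k. \<Theta> c j t * q j t)"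
      using rep[OF \<phi>M] by blast
    \<comment> \<open>\<open>H2vec k\<close> demands zero components from index \<open>k\<close> on,
      about which \<open>rep\<close> says nothing.\<close>
    define q' where "q' = (\<lambda>j. if j < k then q j else (\<lambda>_. 0))"
    have q': "q' \<in> H2vec k" using q(1) by (simp add: q'_def H2vec_def)
    have mL: "L2v n (\<lambda>c t. \<Sum>j<k. \<Theta> c j t * q' j t)"
      using sub[of q'] q' by (simp add: M orth_def H2vec_def)
    have AEq: "AE t in circ. \<forall>c\<in>{..<n}. \<phi> c t = (\<Sum>j<k. \<Theta> c j t * q' j t)"
      using q(2) by (intro AE_finite_allI) (auto simp: q'_def)
    have "vinner n g \<phi> = vinner n g (mat_apply n k \<Theta> q')"
      unfolding apply_eq unfolding vinner_def
    proof (rule integral_cong_AE)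
      show "AE t in circ. (\<Sum>c<n. g c t * cnj (\<phi> c t)) = (\<Sum>c<n. g c t * cnj (\<Sum>j<k. \<Theta> c j t * q' j t))"
        using AEq by eventually_elim (intro sum.cong, auto)
    qed (use vinner_integrable[OF gL P(1)] vinner_integrable[OF gL mL] in auto)
    also have "\<dots> = 0" using g q' by (simp add: H2_ominus_def)
    finally have g\<phi>: "vinner n g \<phi> = 0" .
    have "(\<lambda>m. vinner n (\<lambda>c t. g c t - ?comb (K m) (a m) c t) \<phi>) \<longlonglongrightarrow> vinner n \<phi> \<phi>"
      by (rule vinner_tendsto[OF xL P(1) P(1) P(2)])
    moreover have "vinner n (\<lambda>c t. g c t - ?comb (K m) (a m) c t) \<phi> = 0" for m
      unfolding vinner_diff_left[OF gL comb_L P(1)] comb_0[OF \<phi>M] g\<phi> by simp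
    ultimately have "vnorm n \<phi> = 0" unfolding vinner_self[OF P(1)] by (simp add: LIMSEQ_const_iff)
    have "\<exists>K a. vnorm n (\<lambda>c t. g c t - ?comb K a c t) < e" if "e > 0" for e
    proof -
      from order_tendstoD(2)[OF P(2) that] obtain m
        where m: "vnorm n (\<lambda>c t. (g c t - ?comb (K m) (a m) c t) - \<phi> c t) < e"
        unfolding eventually_sequentially by blast
      have "vnorm n (\<lambda>c t. g c t - ?comb (K m) (a m) c t) \<le> vnorm n (\<lambda>c t. (g c t - ?comb (K m) (a m) c t) - \<phi> c t) + vnorm n \<phi>"
        using vnorm_triangle[OF L2v_diff[OF xL P(1)] P(1)] by simp
      then have "vnorm n (\<lambda>c t. g c t - ?comb (K m) (a m) c t) < e" using m \<open>vnorm n \<phi> = 0\<close> by simp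
      then show ?thesis by blast
    qed
    with gH show "g \<in> Estar n s f" unfolding Estar_def by simp
  }
qed

text \<open>Every Nevanlinna vector a with F^*a Nevanlinna is \<Theta> q with q Nevanlinna, so
  relations supported on J correspond to q killed by the rows outside J. Largest independent J are
  thus complements of smallest row sets on which \<Theta> has trivial kernel.\<close>

lemma ind_Nev_eq:
  fixes \<Theta> :: "nat \<Rightarrow> nat \<Rightarrow> real \<Rightarrow> complex"
  assumes M: "M = orth n (annihilators n s f)"
    and inner: "inner_matrix n k \<Theta>" and inj: "rows_inj_Nev k {..<n} \<Theta>"
    and col: "\<And>j. j < k \<Longrightarrow> (\<lambda>c. \<Theta> c j) \<in> M"
    and rep: "\<And>h. h \<in> M \<Longrightarrow> \<exists>q. (\<forall>j<k. q j \<in> H2) \<and> (\<forall>c<n. AE t in circ. h c t = (\<Sum>j<k. \<Theta> c j t * q j t))"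
  shows "ind_Nev s n (\<lambda>i j t. cnj (f j i t)) = n - k" and "k \<le> n"
proof -
  let ?G = "\<lambda>i j t. cnj (f j i t)"
  have \<Theta>I: "\<Theta> i j \<in> Hinf" if "i < n" "j < k" for i j using inner that by (simp add: inner_matrix_def)
  have \<Theta>N: "\<Theta> i j \<in> Nev" if "i \<in> {..<n}" "j < k" for i j using \<Theta>I that by (simp add: Hinf_Nev)
  have fL: "f c i \<in> L2" if "c < s" "i < n" for c i
    using f that by (auto simp: H2vec_def intro: H2_L2)
  \<comment> \<open>The sum is entry c of F^* applied to column j of \<Theta>; orthogonality of that
    column to z^l f_c for l < 0 kills the negative coefficients.\<close>
  have col_Nev: "(\<lambda>t. \<Sum>i<n. \<Theta> i j t * ?G i c t) \<in> Nev" if c: "c < s" and j: "j < k" for c j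
  proof -
    have "(\<lambda>t. \<Sum>i<n. \<Theta> i j t * ?G i c t) \<in> L2"
    proof (intro L2_sum)
      fix i assume "i \<in> {..<n}"
      with \<Theta>I[of i j] j obtain B where "\<Theta> i j \<in> borel_measurable circ" "AE t in circ. cmod (\<Theta> i j t) \<le> B"
        by (auto elim: HinfD)
      then show "(\<lambda>t. \<Theta> i j t * ?G i c t) \<in> L2"
        using fL c \<open>i \<in> {..<n}\<close> by (intro L2_bounded_mult L2_cnj) auto
    qed
    moreover have "fourier (\<lambda>t. \<Sum>i<n. \<Theta> i j t * ?G i c t) l = 0" if "l < 0" for l
    proof -
      have "vinner n (\<lambda>c. \<Theta> c j) (\<lambda>i t. ez (- int (nat (-l))) t * f c i t) = 0"
        using col[OF j] c unfolding M mem_orth_annihilators_iff by blast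
      then show ?thesis unfolding fourier_eq_0_iff vinner_def
        using that by (simp add: sum_distrib_left sum_distrib_right ac_simps)
    qed
    ultimately have "(\<lambda>t. \<Sum>i<n. \<Theta> i j t * ?G i c t) \<in> H2" by (simp add: H2_def)
    then show ?thesis using H2_subset_Nev by blast
  qed
  \<comment> \<open>Two denominators are cleared, \<open>b\<close> for a and \<open>d\<close> for
    F^*a, since M asks for analyticity of h as well as of F^*h.\<close>
  have kernel: "\<exists>q. (\<forall>j<k. q j \<in> Nev) \<and> (\<forall>i<n. AE t in circ. a i t = (\<Sum>j<k. \<Theta> i j t * q j t))"
    if a: "\<And>i. i < n \<Longrightarrow> a i \<in> Nev" and Ga: "\<And>c. c < s \<Longrightarrow> (\<lambda>t. \<Sum>i<n. a i t * ?G i c t) \<in> Nev" for a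
  proof -
    obtain b where b: "b \<in> Hinf" "AE t in circ. b t \<noteq> 0" "\<And>i. i < n \<Longrightarrow> \<exists>x\<in>Hinf. AE t in circ. b t * a i t = x t"
      using Nev_common_denominator[of "{..<n}" a] a by auto
    obtain d where d: "d \<in> Hinf" "AE t in circ. d t \<noteq> 0"
      "\<And>c. c < s \<Longrightarrow> \<exists>y\<in>Hinf. AE t in circ. d t * (\<Sum>i<n. a i t * ?G i c t) = y t"
      using Nev_common_denominator[of "{..<s}" "\<lambda>c t. \<Sum>i<n. a i t * ?G i c t"] Ga by auto
    have "\<forall>i. \<exists>x. i < n \<longrightarrow> x \<in> Hinf \<and> (AE t in circ. b t * a i t = x t)" using b(3) by blast
    from choice[OF this] obtain x where x: "\<And>i. i < n \<Longrightarrow> x i \<in> Hinf" "\<And>i. i < n \<Longrightarrow> AE t in circ. b t * a i t = x i t"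
      by blast
    \<comment> \<open>The additional factor z is there because in M the coefficient of F^*h at index
      0 must vanish too, and b y alone is only analytic.\<close>
    define e where "e = (\<lambda>t. ez 1 t * d t)"
    have e: "e \<in> Hinf" unfolding e_def by (intro Hinf_mult Hinf_ez d) simp
    have xall: "AE t in circ. \<forall>i\<in>{..<n}. b t * a i t = x i t" using x(2) by (intro AE_finite_allI) auto
    define h where "h = (\<lambda>i t. e t * x i t)"
    have hI: "h i \<in> Hinf" if "i < n" for i unfolding h_def using e x(1)[OF that] by (rule Hinf_mult)
    have "h \<in> M"
      unfolding M mem_orth_annihilators_iff
    proof (intro conjI allI impI)
      show "h c \<in> H2" if "c < n" for c using hI[OF that] by (rule Hinf_H2)
      fix c l assume c: "c < s"
      obtain y where y: "y \<in> Hinf" "AE t in circ. d t * (\<Sum>i<n. a i t * ?G i c t) = y t" using d(3)[OF c] by blast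
      have hL: "L2v n h" using Hinf_H2[OF hI] H2_L2 by (auto simp: L2v_def)
      have fcL: "L2v n (\<lambda>i t. ez (- int l) t * f c i t)" using fL c by (intro L2v_ez) (auto simp: L2v_def)
      have byI: "(\<lambda>t. b t * y t) \<in> Hinf" using b(1) y(1) by (rule Hinf_mult)
      have "vinner n h (\<lambda>i t. ez (- int l) t * f c i t) = (\<integral>t. b t * y t * ez (- (- int l - 1)) t \<partial>circ)"
        unfolding vinner_def
      proof (rule integral_cong_AE)
        show "AE t in circ. (\<Sum>i<n. h i t * cnj (ez (- int l) t * f c i t)) = b t * y t * ez (- (- int l - 1)) t"
          using xall y(2)
        proof eventually_elim
          case (elim t)
          have "(\<Sum>i<n. h i t * cnj (ez (- int l) t * f c i t)) = (\<Sum>i<n. (ez (int l) t * ez 1 t) * b t * (d t * (a i t * ?G i c t)))"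
            using elim(1) by (intro sum.cong refl) (simp add: h_def e_def ac_simps flip: elim(1)[rule_format])
          also have "\<dots> = (ez (int l) t * ez 1 t) * b t * (d t * (\<Sum>i<n. a i t * ?G i c t))"
            by (simp add: sum_distrib_left)
          also have "\<dots> = b t * y t * ez (- (- int l - 1)) t" unfolding elim(2) ez_mult by (simp add: ac_simps)
          finally show ?case .
        qed
        show "(\<lambda>t. b t * y t * ez (- (- int l - 1)) t) \<in> borel_measurable circ"
          using L2_measurable[OF H2_L2[OF Hinf_H2[OF byI]]] by measurable
      qed (use vinner_integrable[OF hL fcL] in auto)
      also have "\<dots> = 0"
      proof -
        have "fourier (\<lambda>t. b t * y t) (- int l - 1) = 0" using Hinf_H2[OF byI] by (simp add: H2_def)
        then show ?thesis by (simp only: fourier_eq_0_iff)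
      qed
      finally show "vinner n h (\<lambda>i t. ez (- int l) t * f c i t) = 0" .
    qed
    from rep[OF this] obtain q where q: "\<And>j. j < k \<Longrightarrow> q j \<in> H2"
      "\<And>i. i < n \<Longrightarrow> AE t in circ. h i t = (\<Sum>j<k. \<Theta> i j t * q j t)" by blast
    define q' where "q' = (\<lambda>j t. q j t / (e t * b t))"
    have "q' j \<in> Nev" if "j < k" for j
      unfolding q'_def using q(1)[OF that] H2_subset_Nev Hinf_Nev e b(1) by (intro Nev_divide Nev_mult) auto
    moreover have "AE t in circ. a i t = (\<Sum>j<k. \<Theta> i j t * q' j t)" if i: "i < n" for i
      using q(2)[OF i] x(2)[OF i] b(2) d(2)
    proof eventually_elim
      case (elim t)
      have nz: "e t * b t \<noteq> 0" using elim by (simp add: e_def)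
      have "(\<Sum>j<k. \<Theta> i j t * q' j t) = h i t / (e t * b t)"
        unfolding elim(1) by (simp add: q'_def sum_divide_distrib)
      also have "h i t = e t * b t * a i t" using elim(2) by (simp add: h_def)
      finally show ?case using nz by simp
    qed
    ultimately show ?thesis by blast
  qed
  \<comment> \<open>Left to right: a kernel vector h of the rows outside \<open>J\<close> gives the
    relation \<Theta> h supported on \<open>J\<close>, so \<Theta> h = 0 and injectivity gives h =
    0. Right to left: a relation on \<open>J\<close>, extended by 0, is \<Theta> q with q killed by
    the rows outside \<open>J\<close>.\<close>
  have indep_iff: "indep_Nev s J ?G \<longleftrightarrow> rows_inj_Nev k ({..<n} - J) \<Theta>" if J: "J \<subseteq> {..<n}" for J
  proof
    assume indep: "indep_Nev s J ?G"
    show "rows_inj_Nev k ({..<n} - J) \<Theta>"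
      unfolding rows_inj_Nev_def
    proof (intro allI impI)
      fix h :: "nat \<Rightarrow> real \<Rightarrow> complex" and j
      assume h: "\<forall>j<k. h j \<in> Nev" and 0: "\<forall>i\<in>{..<n} - J. AE t in circ. (\<Sum>j<k. \<Theta> i j t * h j t) = 0" and j: "j < k"
      define a where "a = (\<lambda>i t. \<Sum>j<k. \<Theta> i j t * h j t)"
      have aN: "a i \<in> Nev" if "i < n" for i
        unfolding a_def using h \<Theta>N that by (intro Nev_sum Nev_mult) auto
      have out: "AE t in circ. \<forall>i\<in>{..<n} - J. a i t = 0" using 0 unfolding a_def by (intro AE_finite_allI) auto
      have "(\<lambda>t. \<Sum>i\<in>J. a i t * ?G i c t) \<in> Nev" if c: "c < s" for c
      proof (rule Nev_cong)
        show "(\<lambda>t. \<Sum>j<k. h j t * (\<Sum>i<n. \<Theta> i j t * ?G i c t)) \<in> Nev"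
          using h by (intro Nev_sum Nev_mult[OF _ col_Nev[OF c]]) auto
        show "AE t in circ. (\<Sum>i\<in>J. a i t * ?G i c t) = (\<Sum>j<k. h j t * (\<Sum>i<n. \<Theta> i j t * ?G i c t))"
          using out
        proof eventually_elim
          case (elim t)
          have "(\<Sum>i\<in>J. a i t * ?G i c t) = (\<Sum>i<n. a i t * ?G i c t)"
            using J elim by (intro sum.mono_neutral_left) auto
          also have "\<dots> = (\<Sum>i<n. \<Sum>j<k. h j t * (\<Theta> i j t * ?G i c t))"
            unfolding a_def by (simp add: sum_distrib_left sum_distrib_right ac_simps)
          also have "\<dots> = (\<Sum>j<k. h j t * (\<Sum>i<n. \<Theta> i j t * ?G i c t))"
            by (subst sum.swap) (simp add: sum_distrib_left)
          finally show ?case .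
        qed
      qed
      with indep aN J have inJ: "AE t in circ. a i t = 0" if "i \<in> J" for i
        using that unfolding indep_Nev_def by blast
      show "AE t in circ. h j t = 0"
      proof (rule rows_inj_NevD[OF inj])
        fix i assume "i \<in> {..<n}"
        then show "AE t in circ. (\<Sum>j<k. \<Theta> i j t * h j t) = 0" using inJ[of i] 0 unfolding a_def by blast
      qed (use h j in auto)
    qed
  next
    assume R: "rows_inj_Nev k ({..<n} - J) \<Theta>"
    show "indep_Nev s J ?G"
      unfolding indep_Nev_def
    proof (intro allI impI ballI, elim conjE)
      fix a :: "nat \<Rightarrow> real \<Rightarrow> complex" and i
      assume a: "\<forall>j\<in>J. a j \<in> Nev" and Ga: "\<forall>c<s. (\<lambda>t. \<Sum>j\<in>J. a j t * ?G j c t) \<in> Nev" and i: "i \<in> J"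
      define a' where "a' = (\<lambda>i. if i \<in> J then a i else (\<lambda>_. 0))"
      have "(\<Sum>i<n. a' i t * ?G i c t) = (\<Sum>j\<in>J. a j t * ?G j c t)" for c t
        using J by (intro sum.mono_neutral_cong_right) (auto simp: a'_def)
      then have "(\<lambda>t. \<Sum>i<n. a' i t * ?G i c t) \<in> Nev" if "c < s" for c using Ga that by simp
      moreover have "a' i \<in> Nev" for i using a Nev_const[of 0] by (simp add: a'_def)
      ultimately obtain q where q: "\<And>j. j < k \<Longrightarrow> q j \<in> Nev"
        "\<And>i. i < n \<Longrightarrow> AE t in circ. a' i t = (\<Sum>j<k. \<Theta> i j t * q j t)"
        using kernel[of a'] by blast
      have "AE t in circ. q j t = 0" if "j < k" for j
      proof (rule rows_inj_NevD[OF R q(1)])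
        fix i assume "i \<in> {..<n} - J"
        with q(2)[of i] show "AE t in circ. (\<Sum>j<k. \<Theta> i j t * q j t) = 0" by (auto simp: a'_def elim: eventually_mono)
      qed (use that in auto)
      then have "AE t in circ. \<forall>j\<in>{..<k}. q j t = 0" by (intro AE_finite_allI) auto
      moreover have "AE t in circ. a' i t = (\<Sum>j<k. \<Theta> i j t * q j t)" using q(2)[of i] i J by auto
      ultimately have "AE t in circ. a' i t = 0" by eventually_elim simp
      then show "AE t in circ. a i t = 0" using i by (simp add: a'_def)
    qed
  qed
  obtain I0 where I0: "I0 \<subseteq> {..<n}" "card I0 = k" "rows_inj_Nev k I0 \<Theta>"
    using rows_inj_Nev_subset[OF finite_lessThan \<Theta>N inj] by blast
  show "k \<le> n" using card_mono[OF finite_lessThan I0(1)] I0(2) by simp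
  \<comment> \<open>Row selection enters twice: among all rows it produces an independent set of
    size n - k, and among the rows outside an arbitrary independent \<open>J\<close> it shows that
    at least k of them remain.\<close>
  show "ind_Nev s n ?G = n - k"
    unfolding ind_Nev_def
  proof (rule Max_eqI)
    show "finite {card J |J. J \<subseteq> {..<n} \<and> indep_Nev s J ?G}"
      by (rule finite_subset[of _ "card ` Pow {..<n}"]) auto
    have "{..<n} - ({..<n} - I0) = I0" using I0(1) by blast
    then have "indep_Nev s ({..<n} - I0) ?G" using indep_iff[of "{..<n} - I0"] I0(3) by auto
    moreover have "card ({..<n} - I0) = n - k"
      using I0 by (subst card_Diff_subset) (auto intro: finite_subset)
    ultimately show "n - k \<in> {card J |J. J \<subseteq> {..<n} \<and> indep_Nev s J ?G}"
      unfolding mem_Collect_eq by (intro exI[of _ "{..<n} - I0"]) auto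
  next
    fix y assume "y \<in> {card J |J. J \<subseteq> {..<n} \<and> indep_Nev s J ?G}"
    then obtain J where J: "J \<subseteq> {..<n}" "indep_Nev s J ?G" "y = card J" by blast
    then have "rows_inj_Nev k ({..<n} - J) \<Theta>" using indep_iff by blast
    then obtain I where I: "I \<subseteq> {..<n} - J" "card I = k"
      using rows_inj_Nev_subset[of "{..<n} - J" k \<Theta>] \<Theta>N by auto
    have "k \<le> card ({..<n} - J)" using card_mono[of "{..<n} - J" I] I by simp
    also have "\<dots> = n - y" using J by (subst card_Diff_subset) (auto intro: finite_subset)
    finally have "k \<le> n - y" .
    moreover have "y \<le> n" using J card_mono[of "{..<n}" J] by simp
    ultimately show "y \<le> n - k" by simp
  qed
qed

end

theorem mainTheorem4:
  fixes n s :: nat and f :: "nat \<Rightarrow> nat \<Rightarrow> real \<Rightarrow> complex"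
  assumes "\<forall>i<s. f i \<in> H2vec n"
  defines "gbar \<equiv> (\<lambda>i j t. cnj (f j i t))"
  defines "\<alpha> \<equiv> ind_Nev s n gbar"
  shows "\<exists>\<Theta>. inner_matrix n (n - \<alpha>) \<Theta> \<and> Estar n s f = H2_ominus n (n - \<alpha>) \<Theta>"
proof -
  let ?W = "annihilators n s f"
  note f = assms(1)
  have H2: "h c \<in> H2" if "h \<in> orth n ?W" "c < n" for h c
    using that unfolding mem_orth_annihilators_iff[OF f] by blast
  obtain k \<Theta> where B: "inner_matrix n k \<Theta>" "k \<le> n" "rows_inj_Nev k {..<n} \<Theta>"
    "\<And>j. j < k \<Longrightarrow> (\<lambda>c. \<Theta> c j) \<in> orth n ?W"
    "\<forall>q. (\<forall>j<k. q j \<in> H2) \<longrightarrow> (\<lambda>c t. \<Sum>j<k. \<Theta> c j t * q j t) \<in> orth n ?W"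
    "\<And>h. h \<in> orth n ?W \<Longrightarrow> \<exists>q. (\<forall>j<k. q j \<in> H2) \<and> (\<forall>c<n. AE t in circ. h c t = (\<Sum>j<k. \<Theta> c j t * q j t))"
    by (rule Beurling_Lax[where n=n and W="?W" and M="orth n ?W",
          OF annihilators_L2v[OF f] annihilators_shift[OF f] _ refl]) (assumption, assumption, erule (1) H2, rule that)
  have "\<alpha> = n - k" unfolding \<alpha>_def gbar_def by (rule ind_Nev_eq(1)[OF f refl B(1,3,4,6)])
  then have "n - \<alpha> = k" using B(2) by simp
  then show ?thesis using B(1) Estar_eq_H2_ominus[OF f refl B(5)[rule_format] B(6)] by auto
qed

end
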